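(* Let $T$ be the Bel-Robinson tensor of a Weyl tensor $W$ and suppose that $\operatorname{Tr}T^2=0$ and $9t^3\equiv\operatorname{Tr}T^3\neq0$. Then the Weyl tensor can be obtained from $T$, up to duality rotation, as $$W=\cos\theta\,W_0+\sin\theta\,*W_0,\qquad W_0=\sqrt t\,J,\qquad J_{\alpha\beta\mu\nu}\equiv2(H_{\alpha\mu\beta\nu}-H_{\alpha\nu\beta\mu}),$$ where $H$ is the following concomitant of $T$: $$H=\frac1{2w\Delta}\left[-(\alpha w^3+2r\alpha^2+r^2)A+(w^3+r\alpha)E+rI\right].$$ Here $$A=\tfrac13\left[\tfrac1tT+\tfrac1{t^2}T^2+\tfrac1{t^3}T^3\right],\qquad B_{\alpha\beta\gamma\delta\lambda\mu}=2A_{\alpha\beta\lambda}{}^{\epsilon}A_{\gamma\delta\mu\epsilon}-\tfrac12A_{\alpha\beta\gamma\delta}\,g_{\lambda\mu},$$ $$C_{\alpha\beta\nu\rho\gamma\delta\lambda\mu}=2A_{\alpha\beta\nu}{}^{\epsilon}B_{\gamma\delta\lambda\mu\rho\epsilon}-\tfrac12B_{\alpha\beta\gamma\delta\lambda\mu}\,g_{\nu\rho},$$ $$E=A(X)\otimes A(X)-\tfrac12C(X,X),\qquad I=\tfrac14B(X,X)\otimes B(X,X)-\beta\,B(X),$$ $$\alpha=\tfrac13A(X,X),\quad \beta=\tfrac16B(X,X,X),\quad \gamma=\tfrac1{12}C(X,X,X,X),$$ $$\Delta=\sqrt{s^2+r^3},\quad r=\gamma-\alpha^2,\quad s=\tfrac12(3\alpha\gamma-\beta^2)-\alpha^3,$$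 $w$ is a nonvanishing scalar defined by one of the expressions $w^3=-s\pm\Delta$, and $X$ is an arbitrary symmetric 2-tensor such that $\Delta\neq0$.
   Context: $(V,g)$ is an oriented 4-dimensional real vector space with a Lorentzian metric of signature $(-,+,+,+)$ (the tangent space of a space-time at a point); indices are moved with $g$; $\eta$ is the metric volume element. Hodge dual on double 2-forms: $( *W)_{\alpha\beta\mu\nu}=\frac12\eta_{\alpha\beta}{}^{\rho\sigma}W_{\rho\sigma\mu\nu}$. A Weyl tensor $W$ is a real 4-tensor with the algebraic symmetries of a Riemann tensor and vanishing traces; its self-dual Weyl tensor is $\mathcal W=\frac12(W-\mathrm i*W)$. The Bel-Robinson tensor of $W$ is $T_{\alpha\mu\beta\nu}=\mathcal W_{\alpha}{}^{\rho}{}_{\beta}{}^{\sigma}\,\overline{\mathcal W}_{\mu\rho\nu\sigma}$; it is real, totally symmetric and traceless. "Up to duality rotation" means that $\theta$ is an undetermined real phase. Powers and trace are as endomorphisms of symmetric tensors: $(T^2)_{\alpha\beta\rho\sigma}=T_{\alpha\beta}{}^{\mu\nu}T_{\mu\nu\rho\sigma}$, $T^3$ similarly, $\operatorname{Tr}T=T^{\alpha\beta}{}_{\alpha\beta}$. The tensors $A$, $B$, $C$ have respectively 2, 3, 4 successive pairs of indices; an expression such as $B(X)$, $B(X,X)$, $C(X,X)$, $C(X,X,X,X)$ with $k$ arguments denotes contraction of $X$ with each of the last $k$ index pairs (e.g. $C(X,X)_{\alpha\beta\nu\rho}=C_{\alpha\beta\nu\rho\gamma\delta\lambda\mu}X^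{\gamma\delta}X^{\lambda\mu}$).
   Formalization: For real X, Δ is imaginary and √t J is complex, so the printed equality fails; W_0 is taken as the real tensor with the same self-dual part, Re(√t J)+*Im(√t J), and w^3=-s±Δ is used with one suitable sign, not either one. *)

theory Defs
  imports "HOL-Analysis.Analysis"
begin

text \<open>
  Everything is written in components with respect to an arbitrary positively oriented basis
  of \<open>V\<close> (not assumed orthonormal), indexed by the four-element type \<open>4 = {0,1,2,3}\<close>.
  The metric is its Gram matrix, and all tensors are given by their covariant components;
  every contraction therefore goes through the inverse Gram matrix.
\<close>

type_synonym 'c tensor2 = "4 \<Rightarrow> 4 \<Rightarrow> 'c"
type_synonym 'c tensor4 = "4 \<Rightarrow> 4 \<Rightarrow> 'c tensor2"
type_synonym 'c tensor6 = "4 \<Rightarrow> 4 \<Rightarrow> 'c tensor4"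
type_synonym 'c tensor8 = "4 \<Rightarrow> 4 \<Rightarrow> 'c tensor6"

definition minkowski :: "real^4^4" where
  "minkowski = (\<chi> i j. if i = j then (if i = 0 then -1 else 1) else 0)"

text \<open>The columns of \<open>P\<close> form an orthonormal frame of signature \<open>(-,+,+,+)\<close>.\<close>

definition lorentzian :: "real^4^4 \<Rightarrow> bool" where
  "lorentzian g \<longleftrightarrow> transpose g = g \<and>
     (\<exists>P. invertible P \<and> transpose P ** g ** P = minkowski)"

abbreviation ginv :: "real^4^4 \<Rightarrow> 4 \<Rightarrow> 4 \<Rightarrow> real" where
  "ginv g \<alpha> \<beta> \<equiv> matrix_inv g $ \<alpha> $ \<beta>"

text \<open>Levi-Civita symbol with \<open>levi_civita 0 1 2 3 = 1\<close>.\<close>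

definition levi_civita :: "real tensor4" where
  "levi_civita \<alpha> \<beta> \<gamma> \<delta> =
     det (\<chi> i j. if j = (if i = 0 then \<alpha> else if i = 1 then \<beta> else if i = 2 then \<gamma> else \<delta>)
                 then 1 else 0 :: real^4^4)"

definition vol :: "real^4^4 \<Rightarrow> real tensor4" where
  "vol g \<alpha> \<beta> \<gamma> \<delta> = sqrt \<bar>det g\<bar> * levi_civita \<alpha> \<beta> \<gamma> \<delta>"

definition hodge :: "real^4^4 \<Rightarrow> 'c::real_vector tensor4 \<Rightarrow> 'c tensor4" where
  "hodge g W \<alpha> \<beta> \<mu> \<nu> =
     (1/2) *\<^sub>R (\<Sum>\<rho>\<in>UNIV. \<Sum>\<sigma>\<in>UNIV. \<Sum>\<rho>'\<in>UNIV. \<Sum>\<sigma>'\<in>UNIV.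
        (vol g \<alpha> \<beta> \<rho>' \<sigma>' * ginv g \<rho>' \<rho> * ginv g \<sigma>' \<sigma>) *\<^sub>R W \<rho> \<sigma> \<mu> \<nu>)"

definition weyl_tensor :: "real^4^4 \<Rightarrow> real tensor4 \<Rightarrow> bool" where
  "weyl_tensor g W \<longleftrightarrow>
     (\<forall>\<alpha> \<beta> \<mu> \<nu>. W \<beta> \<alpha> \<mu> \<nu> = - W \<alpha> \<beta> \<mu> \<nu>) \<and>
     (\<forall>\<alpha> \<beta> \<mu> \<nu>. W \<alpha> \<beta> \<nu> \<mu> = - W \<alpha> \<beta> \<mu> \<nu>) \<and>
     (\<forall>\<alpha> \<beta> \<mu> \<nu>. W \<mu> \<nu> \<alpha> \<beta> = W \<alpha> \<beta> \<mu> \<nu>) \<and>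
     (\<forall>\<alpha> \<beta> \<mu> \<nu>. W \<alpha> \<beta> \<mu> \<nu> + W \<alpha> \<mu> \<nu> \<beta> + W \<alpha> \<nu> \<beta> \<mu> = 0) \<and>
     (\<forall>\<beta> \<nu>. (\<Sum>\<alpha>\<in>UNIV. \<Sum>\<mu>\<in>UNIV. ginv g \<alpha> \<mu> * W \<alpha> \<beta> \<mu> \<nu>) = 0)"

definition complexify4 :: "real tensor4 \<Rightarrow> complex tensor4" where
  "complexify4 W = (\<lambda>\<alpha> \<beta> \<mu> \<nu>. complex_of_real (W \<alpha> \<beta> \<mu> \<nu>))"

definition complexify2 :: "real tensor2 \<Rightarrow> complex tensor2" where
  "complexify2 X = (\<lambda>\<alpha> \<beta>. complex_of_real (X \<alpha> \<beta>))"

definition self_dual :: "real^4^4 \<Rightarrow> complex tensor4 \<Rightarrow> complex tensor4" where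
  "self_dual g Z \<alpha> \<beta> \<mu> \<nu> = (Z \<alpha> \<beta> \<mu> \<nu> - \<i> * hodge g Z \<alpha> \<beta> \<mu> \<nu>) / 2"

text \<open>\<open>dot1 g u v\<close> is \<open>u\<^sub>\<epsilon> v\<^sup>\<epsilon>\<close>, and \<open>dot2 g P Q\<close> is \<open>P\<^sub>\<mu>\<^sub>\<nu> Q\<^sup>\<mu>\<^sup>\<nu>\<close>.\<close>

definition dot1 :: "real^4^4 \<Rightarrow> (4 \<Rightarrow> complex) \<Rightarrow> (4 \<Rightarrow> complex) \<Rightarrow> complex" where
  "dot1 g u v = (\<Sum>\<epsilon>\<in>UNIV. \<Sum>\<epsilon>'\<in>UNIV. of_real (ginv g \<epsilon> \<epsilon>') * u \<epsilon> * v \<epsilon>')"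

definition dot2 :: "real^4^4 \<Rightarrow> complex tensor2 \<Rightarrow> complex tensor2 \<Rightarrow> complex" where
  "dot2 g P Q = (\<Sum>\<mu>\<in>UNIV. \<Sum>\<nu>\<in>UNIV. \<Sum>\<mu>'\<in>UNIV. \<Sum>\<nu>'\<in>UNIV.
     of_real (ginv g \<mu> \<mu>' * ginv g \<nu> \<nu>') * P \<mu> \<nu> * Q \<mu>' \<nu>')"

text \<open>
  The values of the Bel-Robinson tensor are real numbers; it is kept complex-valued because
  its defining contraction is.
\<close>

definition bel_robinson :: "real^4^4 \<Rightarrow> real tensor4 \<Rightarrow> complex tensor4" where
  "bel_robinson g W \<alpha> \<mu> \<beta> \<nu> =
     (let S = self_dual g (complexify4 W)
      in dot2 g (\<lambda>\<rho> \<sigma>. S \<alpha> \<rho> \<beta> \<sigma>) (\<lambda>\<rho> \<sigma>. cnj (S \<mu> \<rho> \<nu> \<sigma>)))"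

definition comp4 :: "real^4^4 \<Rightarrow> complex tensor4 \<Rightarrow> complex tensor4 \<Rightarrow> complex tensor4" where
  "comp4 g S T \<alpha> \<beta> \<rho> \<sigma> = dot2 g (S \<alpha> \<beta>) (\<lambda>\<mu> \<nu>. T \<mu> \<nu> \<rho> \<sigma>)"

definition trace4 :: "real^4^4 \<Rightarrow> complex tensor4 \<Rightarrow> complex" where
  "trace4 g T = (\<Sum>\<alpha>\<in>UNIV. \<Sum>\<beta>\<in>UNIV. \<Sum>\<alpha>'\<in>UNIV. \<Sum>\<beta>'\<in>UNIV.
     of_real (ginv g \<alpha> \<alpha>' * ginv g \<beta> \<beta>') * T \<alpha>' \<beta>' \<alpha> \<beta>)"

definition tensor_A :: "real^4^4 \<Rightarrow> real \<Rightarrow> complex tensor4 \<Rightarrow> complex tensor4" where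
  "tensor_A g t T \<alpha> \<beta> \<mu> \<nu> =
     (1/3) * (1 / of_real t * T \<alpha> \<beta> \<mu> \<nu>
            + 1 / of_real (t^2) * comp4 g T T \<alpha> \<beta> \<mu> \<nu>
            + 1 / of_real (t^3) * comp4 g (comp4 g T T) T \<alpha> \<beta> \<mu> \<nu>)"

definition tensor_B :: "real^4^4 \<Rightarrow> complex tensor4 \<Rightarrow> complex tensor6" where
  "tensor_B g A \<alpha> \<beta> \<gamma> \<delta> \<kappa> \<mu> =
     2 * dot1 g (A \<alpha> \<beta> \<kappa>) (A \<gamma> \<delta> \<mu>) - (1/2) * A \<alpha> \<beta> \<gamma> \<delta> * of_real (g $ \<kappa> $ \<mu>)"

definition tensor_C :: "real^4^4 \<Rightarrow> complex tensor4 \<Rightarrow> complex tensor8" where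
  "tensor_C g A \<alpha> \<beta> \<nu> \<rho> \<gamma> \<delta> \<kappa> \<mu> =
     2 * dot1 g (A \<alpha> \<beta> \<nu>) (tensor_B g A \<gamma> \<delta> \<kappa> \<mu> \<rho>)
     - (1/2) * tensor_B g A \<alpha> \<beta> \<gamma> \<delta> \<kappa> \<mu> * of_real (g $ \<nu> $ \<rho>)"

text \<open>Contraction of \<open>X\<close> with the last index pair of a tensor with 2, 3 or 4 pairs.\<close>

definition contr4 :: "real^4^4 \<Rightarrow> complex tensor4 \<Rightarrow> complex tensor2 \<Rightarrow> complex tensor2" where
  "contr4 g Y X \<alpha> \<beta> = dot2 g (Y \<alpha> \<beta>) X"

definition contr6 :: "real^4^4 \<Rightarrow> complex tensor6 \<Rightarrow> complex tensor2 \<Rightarrow> complex tensor4" where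
  "contr6 g Y X \<alpha> \<beta> = contr4 g (Y \<alpha> \<beta>) X"

definition contr8 :: "real^4^4 \<Rightarrow> complex tensor8 \<Rightarrow> complex tensor2 \<Rightarrow> complex tensor6" where
  "contr8 g Y X \<alpha> \<beta> = contr6 g (Y \<alpha> \<beta>) X"

definition tensor_E :: "real^4^4 \<Rightarrow> complex tensor4 \<Rightarrow> complex tensor2 \<Rightarrow> complex tensor4" where
  "tensor_E g A X \<alpha> \<beta> \<mu> \<nu> =
     (let AX = contr4 g A X; CXX = contr6 g (contr8 g (tensor_C g A) X) X
      in AX \<alpha> \<beta> * AX \<mu> \<nu> - (1/2) * CXX \<alpha> \<beta> \<mu> \<nu>)"

definition scalar_\<alpha> :: "real^4^4 \<Rightarrow> complex tensor4 \<Rightarrow> complex tensor2 \<Rightarrow> complex" where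
  "scalar_\<alpha> g A X = (1/3) * dot2 g (contr4 g A X) X"

definition scalar_\<beta> :: "real^4^4 \<Rightarrow> complex tensor4 \<Rightarrow> complex tensor2 \<Rightarrow> complex" where
  "scalar_\<beta> g A X = (1/6) * dot2 g (contr4 g (contr6 g (tensor_B g A) X) X) X"

definition scalar_\<gamma> :: "real^4^4 \<Rightarrow> complex tensor4 \<Rightarrow> complex tensor2 \<Rightarrow> complex" where
  "scalar_\<gamma> g A X =
     (1/12) * dot2 g (contr4 g (contr6 g (contr8 g (tensor_C g A) X) X) X) X"

definition tensor_I :: "real^4^4 \<Rightarrow> complex tensor4 \<Rightarrow> complex tensor2 \<Rightarrow> complex tensor4" where
  "tensor_I g A X \<alpha> \<beta> \<mu> \<nu> =
     (let BX = contr6 g (tensor_B g A) X; BXX = contr4 g BX X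
      in (1/4) * BXX \<alpha> \<beta> * BXX \<mu> \<nu> - scalar_\<beta> g A X * BX \<alpha> \<beta> \<mu> \<nu>)"

definition scalar_r :: "real^4^4 \<Rightarrow> complex tensor4 \<Rightarrow> complex tensor2 \<Rightarrow> complex" where
  "scalar_r g A X = scalar_\<gamma> g A X - (scalar_\<alpha> g A X)^2"

definition scalar_s :: "real^4^4 \<Rightarrow> complex tensor4 \<Rightarrow> complex tensor2 \<Rightarrow> complex" where
  "scalar_s g A X =
     (1/2) * (3 * scalar_\<alpha> g A X * scalar_\<gamma> g A X - (scalar_\<beta> g A X)^2) - (scalar_\<alpha> g A X)^3"

definition tensor_H ::
  "real^4^4 \<Rightarrow> complex tensor4 \<Rightarrow> complex tensor2 \<Rightarrow> complex \<Rightarrow> complex \<Rightarrow> complex tensor4" where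
  "tensor_H g A X \<Delta> w \<alpha>' \<beta>' \<mu> \<nu> =
     (let \<alpha> = scalar_\<alpha> g A X; r = scalar_r g A X
      in 1 / (2 * w * \<Delta>) *
         (- (\<alpha> * w^3 + 2 * r * \<alpha>^2 + r^2) * A \<alpha>' \<beta>' \<mu> \<nu>
          + (w^3 + r * \<alpha>) * tensor_E g A X \<alpha>' \<beta>' \<mu> \<nu>
          + r * tensor_I g A X \<alpha>' \<beta>' \<mu> \<nu>))"

definition tensor_J :: "complex tensor4 \<Rightarrow> complex tensor4" where
  "tensor_J H \<alpha> \<beta> \<mu> \<nu> = 2 * (H \<alpha> \<mu> \<beta> \<nu> - H \<alpha> \<nu> \<beta> \<mu>)"

text \<open>
  For real \<open>X\<close> with \<open>\<Delta> \<noteq> 0\<close> the scalars \<open>\<alpha>\<close>, \<open>\<beta>\<close>, \<open>\<gamma>\<close>, \<open>r\<close>, \<open>s\<close> are real, but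
  \<open>s\<^sup>2 + r\<^sup>3\<close> is negative, so \<open>\<Delta>\<close>, \<open>w\<close> and hence \<open>H\<close> and \<open>J\<close> are not real. A complex
  double 2-form \<open>Z\<close> stands for the real one that has the same self-dual part as \<open>Z\<close>, namely
  \<open>real_form g Z = Re Z + *(Im Z)\<close>; on a real \<open>Z\<close> this is \<open>Z\<close> itself.
\<close>

definition real_form :: "real^4^4 \<Rightarrow> complex tensor4 \<Rightarrow> real tensor4" where
  "real_form g Z \<alpha> \<beta> \<mu> \<nu> = 2 * Re (self_dual g Z \<alpha> \<beta> \<mu> \<nu>)"

lemma hodge_Re: "Re (hodge g Z \<alpha> \<beta> \<mu> \<nu>) = hodge g (\<lambda>a b m n. Re (Z a b m n)) \<alpha> \<beta> \<mu> \<nu>"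
  by (simp add: hodge_def)

lemma hodge_Im: "Im (hodge g Z \<alpha> \<beta> \<mu> \<nu>) = hodge g (\<lambda>a b m n. Im (Z a b m n)) \<alpha> \<beta> \<mu> \<nu>"
  by (simp add: hodge_def)

lemma real_form_eq:
  "real_form g Z \<alpha> \<beta> \<mu> \<nu> = Re (Z \<alpha> \<beta> \<mu> \<nu>) + hodge g (\<lambda>a b m n. Im (Z a b m n)) \<alpha> \<beta> \<mu> \<nu>"
  by (simp add: real_form_def self_dual_def hodge_Im)

lemma real_form_complexify4: "real_form g (complexify4 Z) = Z"
  by (intro ext) (simp add: real_form_eq complexify4_def, simp add: hodge_def)

end

theory Submission
  imports Defs
begin

text \<open>
  Self-dual 2-forms are a copy of the imaginary quaternions: they have bases \<open>y\<^sub>1, y\<^sub>2, y\<^sub>3\<close> whose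
  mixed components multiply like \<open>i, j, k\<close>, and they commute with their complex conjugates.
  Hence the self-dual Weyl tensor is a traceless symmetric \<open>3 \<times> 3\<close> matrix \<open>Q\<close>, and \<open>T\<close> is
  \<open>Q \<otimes> cnj Q\<close> acting on the traceless symmetric tensors, which have the orthonormal basis
  \<open>y\<^sub>i \<otimes> cnj y\<^sub>j / 2\<close>. Therefore \<open>Tr T\<^sup>k = \<bar>Tr Q\<^sup>k\<bar>\<^sup>2\<close>, the hypotheses force the eigenvalues of \<open>Q\<close> to be
  \<open>c, c \<omega>, c \<omega>\<^sup>2\<close> with \<open>\<bar>c\<bar>\<^sup>2 = t\<close>, and after a complex rotation of the \<open>y\<^sub>i\<close> the tensor \<open>A\<close>
  becomes \<open>\<Sum> H\<^sub>i \<otimes> H\<^sub>i\<close> with \<open>H\<^sub>i\<close> proportional to \<open>y\<^sub>i \<otimes> cnj y\<^sub>i\<close>.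

  What is lost in \<open>A\<close> is the cyclic order of the eigenvalues. Writing \<open>x\<^sub>i\<close> for the (real)
  contraction of \<open>X\<close> with \<open>H\<^sub>i\<close>, the scalars \<open>\<alpha>, \<beta>\<^sup>2, \<gamma>\<close> are, up to constants, the elementary symmetric functions
  of the \<open>x\<^sub>i\<^sup>2\<close>, and Cardano's \<open>w\<close> is a Lagrange resolvent. The concomitant \<open>H\<close> is
  \<open>\<Sum> h\<^sub>i H\<^sub>i \<otimes> H\<^sub>i\<close>, where \<open>h\<^sub>i\<close> is the phase of the \<open>i\<close>-th eigenvalue up to a common factor; which sign of
  \<open>\<Delta>\<close> is the right one depends on that order.
\<close>

subsection \<open>Two-forms in an orthonormal frame\<close>

text \<open>A complex symmetric matrix need not be diagonalizable by a complex orthogonal one. Here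
  it is: with the first two traces zero, Cayley-Hamilton makes the cube of Q a nonzero scalar, and
  the spectral projections are explicit polynomials in Q. The formula for A is a projector: T/t has
  eigenvalue omega^(i-j) on the basis tensor labelled (i, j), and (q + q^2 + q^3)/3 is 1 at q = 1
  and 0 at the other two cube roots of unity. B and C exploit the product rule of the diagonal
  tensors: contracting one index of H_i with one of H_j gives g/4 if i = j and -H_k/2 otherwise. The
  subtracted metric terms remove the products with equal labels. As all these expressions are
  symmetric in the labels, the numbers x_i are the only means of telling the H_i apart. The Hodge
  dual multiplies a self-dual tensor by the imaginary unit, so a unimodular factor on the self-dual
  part is a duality rotation of the real tensor. What remains at the end is that the factor between
  the recovered and the given self-dual part has modulus one.\<close>

lemma UNIV_4_from_0: "(UNIV :: 4 set) = {0, 1, 2, 3}"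
  using UNIV_4 by auto

lemma sum_4_from_0: "sum f (UNIV :: 4 set) = f 0 + f 1 + f 2 + f 3"
  unfolding UNIV_4_from_0 by (simp add: add.assoc)

lemma forall_4_from_0: "(\<forall>i::4. P i) \<longleftrightarrow> P 0 \<and> P 1 \<and> P 2 \<and> P 3"
  by (metis UNIV_4_from_0 UNIV_I empty_iff insert_iff)

section \<open>Determinants and the Levi-Civita symbol\<close>

lemma det_4:
  "det (A::'a::comm_ring_1^4^4) =
     A$0$0*A$1$1*A$2$2*A$3$3 - A$0$0*A$1$1*A$2$3*A$3$2 - A$0$0*A$1$2*A$2$1*A$3$3
   + A$0$0*A$1$2*A$2$3*A$3$1 + A$0$0*A$1$3*A$2$1*A$3$2 - A$0$0*A$1$3*A$2$2*A$3$1
   - A$0$1*A$1$0*A$2$2*A$3$3 + A$0$1*A$1$0*A$2$3*A$3$2 + A$0$1*A$1$2*A$2$0*A$3$3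
   - A$0$1*A$1$2*A$2$3*A$3$0 - A$0$1*A$1$3*A$2$0*A$3$2 + A$0$1*A$1$3*A$2$2*A$3$0
   + A$0$2*A$1$0*A$2$1*A$3$3 - A$0$2*A$1$0*A$2$3*A$3$1 - A$0$2*A$1$1*A$2$0*A$3$3
   + A$0$2*A$1$1*A$2$3*A$3$0 + A$0$2*A$1$3*A$2$0*A$3$1 - A$0$2*A$1$3*A$2$1*A$3$0
   - A$0$3*A$1$0*A$2$1*A$3$2 + A$0$3*A$1$0*A$2$2*A$3$1 + A$0$3*A$1$1*A$2$0*A$3$2
   - A$0$3*A$1$1*A$2$2*A$3$0 - A$0$3*A$1$2*A$2$0*A$3$1 + A$0$3*A$1$2*A$2$1*A$3$0"
proof -
  have f0: "finite {1::4, 2, 3}" "0 \<notin> {1::4, 2, 3}" by auto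
  have f1: "finite {2::4, 3}" "1 \<notin> {2::4, 3}" by auto
  have f2: "finite {3::4}" "2 \<notin> {3::4}" by auto
  show ?thesis
    unfolding det_def UNIV_4_from_0
    unfolding sum_over_permutations_insert[OF f0]
    unfolding sum_over_permutations_insert[OF f1]
    unfolding sum_over_permutations_insert[OF f2]
    unfolding permutes_sing
    by (simp add: sign_swap_id permutation_swap_id sign_compose sign_id swap_id_eq permutation_compose algebra_simps)
qed

text \<open>With a product of indicators in each of the 24 terms, a fourfold sum against the symbol
  collapses term by term through \<open>sum4_of_bool\<close>.\<close>

lemma levi_civita_expand:
  "levi_civita a b c d =
     of_bool (a = 0) * of_bool (b = 1) * of_bool (c = 2) * of_bool (d = 3)
      - of_bool (a = 0) * of_bool (b = 1) * of_bool (c = 3) * of_bool (d = 2)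
      - of_bool (a = 0) * of_bool (b = 2) * of_bool (c = 1) * of_bool (d = 3)
      + of_bool (a = 0) * of_bool (b = 2) * of_bool (c = 3) * of_bool (d = 1)
      + of_bool (a = 0) * of_bool (b = 3) * of_bool (c = 1) * of_bool (d = 2)
      - of_bool (a = 0) * of_bool (b = 3) * of_bool (c = 2) * of_bool (d = 1)
      - of_bool (a = 1) * of_bool (b = 0) * of_bool (c = 2) * of_bool (d = 3)
      + of_bool (a = 1) * of_bool (b = 0) * of_bool (c = 3) * of_bool (d = 2)
      + of_bool (a = 1) * of_bool (b = 2) * of_bool (c = 0) * of_bool (d = 3)
      - of_bool (a = 1) * of_bool (b = 2) * of_bool (c = 3) * of_bool (d = 0)
      - of_bool (a = 1) * of_bool (b = 3) * of_bool (c = 0) * of_bool (d = 2)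
      + of_bool (a = 1) * of_bool (b = 3) * of_bool (c = 2) * of_bool (d = 0)
      + of_bool (a = 2) * of_bool (b = 0) * of_bool (c = 1) * of_bool (d = 3)
      - of_bool (a = 2) * of_bool (b = 0) * of_bool (c = 3) * of_bool (d = 1)
      - of_bool (a = 2) * of_bool (b = 1) * of_bool (c = 0) * of_bool (d = 3)
      + of_bool (a = 2) * of_bool (b = 1) * of_bool (c = 3) * of_bool (d = 0)
      + of_bool (a = 2) * of_bool (b = 3) * of_bool (c = 0) * of_bool (d = 1)
      - of_bool (a = 2) * of_bool (b = 3) * of_bool (c = 1) * of_bool (d = 0)
      - of_bool (a = 3) * of_bool (b = 0) * of_bool (c = 1) * of_bool (d = 2)
      + of_bool (a = 3) * of_bool (b = 0) * of_bool (c = 2) * of_bool (d = 1)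
      + of_bool (a = 3) * of_bool (b = 1) * of_bool (c = 0) * of_bool (d = 2)
      - of_bool (a = 3) * of_bool (b = 1) * of_bool (c = 2) * of_bool (d = 0)
      - of_bool (a = 3) * of_bool (b = 2) * of_bool (c = 0) * of_bool (d = 1)
      + of_bool (a = 3) * of_bool (b = 2) * of_bool (c = 1) * of_bool (d = 0)"
  unfolding levi_civita_def det_4 by (simp add: of_bool_def)

lemma sum4_of_bool:
  fixes f :: "4 \<Rightarrow> 4 \<Rightarrow> 4 \<Rightarrow> 4 \<Rightarrow> 'a::comm_ring_1"
  shows "(\<Sum>a\<in>UNIV. \<Sum>b\<in>UNIV. \<Sum>c\<in>UNIV. \<Sum>d\<in>UNIV.
     f a b c d * (of_bool (a = p) * of_bool (b = q) * of_bool (c = r) * of_bool (d = s))) = f p q r s"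
proof -
  have "f a b c d * (of_bool (a = p) * of_bool (b = q) * of_bool (c = r) * of_bool (d = s))
     = (if d = s then if c = r then if b = q then if a = p then f a b c d else 0 else 0 else 0 else 0)" for a b c d
    by simp
  then show ?thesis by (simp add: sum.delta)
qed

text \<open>The symbol is the determinant of the matrix \<open>M\<close> whose rows are the selected
  basis vectors, so the transformation law is multiplicativity of \<open>det\<close>: the product of
  \<open>M\<close> with the transpose of \<open>F\<close> has as rows the columns of
  \<open>F\<close> named by the indices.\<close>

lemma levi_civita_det:
  fixes F :: "real^4^4"
  shows "(\<Sum>a\<in>UNIV. \<Sum>b\<in>UNIV. \<Sum>c\<in>UNIV. \<Sum>d\<in>UNIV.
            F$a$\<alpha> * F$b$\<beta> * F$c$\<gamma> * F$d$\<delta> * levi_civita a b c d)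
         = det F * levi_civita \<alpha> \<beta> \<gamma> \<delta>"
proof -
  define \<sigma> where "\<sigma> i = (if i = 0 then \<alpha> else if i = 1 then \<beta> else if i = 2 then \<gamma> else \<delta>)" for i :: 4
  define M :: "real^4^4" where "M = (\<chi> i j. if j = \<sigma> i then 1 else 0)"
  have \<sigma>: "\<sigma> 0 = \<alpha>" "\<sigma> 1 = \<beta>" "\<sigma> 2 = \<gamma>" "\<sigma> 3 = \<delta>"
    by (simp_all add: \<sigma>_def)
  have MF: "M ** transpose F = (\<chi> i j. F $ j $ \<sigma> i)"
  proof -
    have "(if k = \<sigma> i then 1 else 0) * F $ j $ k = (if k = \<sigma> i then F $ j $ k else 0)" for i j k
      by simp
    then show ?thesis
      by (simp add: M_def matrix_matrix_mult_def transpose_def vec_eq_iff)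
  qed
  have "det F * levi_civita \<alpha> \<beta> \<gamma> \<delta> = det (M ** transpose F)"
    by (simp add: det_mul levi_civita_def M_def \<sigma>_def)
  also have "\<dots> = (\<Sum>a\<in>UNIV. \<Sum>b\<in>UNIV. \<Sum>c\<in>UNIV. \<Sum>d\<in>UNIV.
            F$a$\<alpha> * F$b$\<beta> * F$c$\<gamma> * F$d$\<delta> * levi_civita a b c d)"
    unfolding MF levi_civita_expand right_diff_distrib distrib_left sum.distrib sum_subtractf sum4_of_bool
    by (simp add: det_4 \<sigma>)
  finally show ?thesis by simp
qed

text \<open>For (p, q, r, s) an even permutation of the frame indices with p = 0, the relative
  factor between the two planes makes this an eigenvector of the Hodge dual with eigenvalue
  \<i>.\<close>

definition two_form :: "4 \<Rightarrow> 4 \<Rightarrow> 4 \<Rightarrow> 4 \<Rightarrow> complex^4^4" where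
  "two_form p q r s = (\<chi> a b. if a = p \<and> b = q then \<i> else if a = q \<and> b = p then - \<i>
     else if a = r \<and> b = s then -1 else if a = s \<and> b = r then 1 else 0)"

definition cmat :: "real^4^4 \<Rightarrow> complex^4^4" where
  "cmat M = (\<chi> i j. of_real (M $ i $ j))"

definition cnjm :: "complex^4^4 \<Rightarrow> complex^4^4" where
  "cnjm M = (\<chi> i j. cnj (M $ i $ j))"

text \<open>Cycling the spatial indices keeps the permutation even, so the three forms lie in the
  same eigenspace.\<close>

definition std_form :: "3 \<Rightarrow> complex^4^4" where
  "std_form k = (if k = 1 then two_form 0 1 2 3 else if k = 2 then two_form 0 2 3 1 else two_form 0 3 1 2)"

lemma std_form_simps: "std_form 1 = two_form 0 1 2 3" "std_form 2 = two_form 0 2 3 1" "std_form 3 = two_form 0 3 1 2"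
  by (auto simp: std_form_def)

lemma std_form_antisym: "transpose (std_form k) = - std_form k"
  using exhaust_3[of k]
  by (elim disjE) (auto simp: std_form_simps two_form_def vec_eq_iff transpose_def forall_4_from_0)

text \<open>The matrix \<open>minkowski\<close> is its own inverse, and between two covariant
  matrices it raises the contracted index. Once the free index is raised too, these are the rules
  for i, j, k.\<close>

lemma std_form_quaternion:
  "std_form k ** cmat minkowski ** std_form k = - cmat minkowski"
  "std_form 1 ** cmat minkowski ** std_form 2 = std_form 3"
  "std_form 2 ** cmat minkowski ** std_form 3 = std_form 1"
  "std_form 3 ** cmat minkowski ** std_form 1 = std_form 2"
  using exhaust_3[of k]
  by (elim disjE; simp add: std_form_simps two_form_def vec_eq_iff cmat_def minkowski_def 
     matrix_matrix_mult_def sum_4_from_0 forall_4_from_0)+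

text \<open>Self-dual and anti-self-dual forms are the two commuting ideals of the complexified
  Lorentz algebra; in a fixed frame this is a finite check.\<close>

lemma std_form_commute:
  "std_form k ** cmat minkowski ** cnjm (std_form l) = cnjm (std_form l) ** cmat minkowski ** std_form k"
  using exhaust_3[of k] exhaust_3[of l]
  by (elim disjE; simp add: std_form_simps two_form_def vec_eq_iff cmat_def minkowski_def cnjm_def
     matrix_matrix_mult_def sum_4_from_0 forall_4_from_0)

lemma levi_civita_table:
  "levi_civita 0 0 c d = 0"
  "levi_civita 0 1 c d = of_bool (c = 2 \<and> d = 3) - of_bool (c = 3 \<and> d = 2)"
  "levi_civita 0 2 c d = of_bool (c = 3 \<and> d = 1) - of_bool (c = 1 \<and> d = 3)"
  "levi_civita 0 3 c d = of_bool (c = 1 \<and> d = 2) - of_bool (c = 2 \<and> d = 1)"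
  "levi_civita 1 0 c d = of_bool (c = 3 \<and> d = 2) - of_bool (c = 2 \<and> d = 3)"
  "levi_civita 1 1 c d = 0"
  "levi_civita 1 2 c d = of_bool (c = 0 \<and> d = 3) - of_bool (c = 3 \<and> d = 0)"
  "levi_civita 1 3 c d = of_bool (c = 2 \<and> d = 0) - of_bool (c = 0 \<and> d = 2)"
  "levi_civita 2 0 c d = of_bool (c = 1 \<and> d = 3) - of_bool (c = 3 \<and> d = 1)"
  "levi_civita 2 1 c d = of_bool (c = 3 \<and> d = 0) - of_bool (c = 0 \<and> d = 3)"
  "levi_civita 2 2 c d = 0"
  "levi_civita 2 3 c d = of_bool (c = 0 \<and> d = 1) - of_bool (c = 1 \<and> d = 0)"
  "levi_civita 3 0 c d = of_bool (c = 2 \<and> d = 1) - of_bool (c = 1 \<and> d = 2)"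
  "levi_civita 3 1 c d = of_bool (c = 0 \<and> d = 2) - of_bool (c = 2 \<and> d = 0)"
  "levi_civita 3 2 c d = of_bool (c = 1 \<and> d = 0) - of_bool (c = 0 \<and> d = 1)"
  "levi_civita 3 3 c d = 0"
  by (simp_all add: levi_civita_expand)

text \<open>On 2-forms the right-hand side is the kernel of four times the self-dual projection: the
  metric part contributes twice the identity, the volume part -2 \<i> times the Hodge dual.\<close>

lemma std_form_complete:
  "(\<Sum>k\<in>UNIV. std_form k $ a $ b * std_form k $ c $ d) =
     of_real (minkowski $ a $ c * minkowski $ b $ d - minkowski $ a $ d * minkowski $ b $ c)
     - \<i> * of_real (levi_civita a b c d)"
proof -
  have "\<forall>a b c d. (\<Sum>k\<in>UNIV. std_form k $ a $ b * std_form k $ c $ d) =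
     of_real (minkowski $ a $ c * minkowski $ b $ d - minkowski $ a $ d * minkowski $ b $ c)
     - \<i> * of_real (levi_civita a b c d)"
    by (simp add: forall_4_from_0 sum_3 levi_civita_table std_form_simps two_form_def minkowski_def)
  then show ?thesis by blast
qed

subsection \<open>Quaternionic triples of self-dual forms\<close>

lemma cmat_mult: "cmat (A ** B) = cmat A ** cmat B"
  by (simp add: cmat_def matrix_matrix_mult_def vec_eq_iff)

lemma cmat_mat_1: "cmat (mat 1) = mat 1"
  by (simp add: cmat_def mat_def vec_eq_iff)

lemma cmat_transpose: "cmat (transpose A) = transpose (cmat A)"
  by (simp add: cmat_def transpose_def vec_eq_iff)

lemma cnjm_mult: "cnjm (A ** B) = cnjm A ** cnjm B"
  by (simp add: cnjm_def matrix_matrix_mult_def vec_eq_iff)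

lemma cnjm_cmat [simp]: "cnjm (cmat A) = cmat A"
  by (simp add: cnjm_def cmat_def vec_eq_iff)

lemma cnjm_cnjm [simp]: "cnjm (cnjm A) = A"
  by (simp add: cnjm_def vec_eq_iff)

lemma cnjm_uminus: "cnjm (- A) = - cnjm A"
  by (simp add: cnjm_def vec_eq_iff)

lemma cnjm_transpose: "cnjm (transpose A) = transpose (cnjm A)"
  by (simp add: cnjm_def transpose_def vec_eq_iff)

lemma matrix_mult_uminus_left: "(- A) ** B = - (A ** B)" for A :: "'a::ring_1^'n^'m"
  by (simp add: matrix_matrix_mult_def vec_eq_iff sum_negf)

lemma matrix_mult_uminus_right: "A ** (- B) = - (A ** B)" for A :: "'a::ring_1^'n^'m"
  by (simp add: matrix_matrix_mult_def vec_eq_iff sum_negf)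

lemma minkowski_sq: "minkowski ** minkowski = mat 1"
  by (simp add: minkowski_def matrix_matrix_mult_def vec_eq_iff mat_def forall_4_from_0 sum_4_from_0)

lemma det_minkowski: "det minkowski = -1"
  by (simp add: det_4 minkowski_def)

lemma matrix_inv_unique:
  fixes A :: "'a::field^'n^'n"
  assumes "A ** B = mat 1"
  shows "matrix_inv A = B"
proof -
  have "B ** A = mat 1" using assms by (simp add: matrix_left_right_inverse)
  then have "A ** matrix_inv A = mat 1"
    using someI[of "\<lambda>A'. A ** A' = mat 1 \<and> A' ** A = mat 1" B] assms
    by (simp only: matrix_inv_def)
  then have "B ** (A ** matrix_inv A) = B" by simp
  then show ?thesis using \<open>B ** A = mat 1\<close> by (simp add: matrix_mul_assoc)
qed

text \<open>The frame in \<open>lorentzian\<close> may have either orientation. A positive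
  determinant is arranged here because \<open>vol_coframe\<close> replaces the square root in
  \<open>vol\<close> by \<open>det F\<close>.\<close>

lemma lorentzian_coframe:
  assumes "lorentzian g"
  obtains F where "det F > 0" "g = transpose F ** minkowski ** F"
    "F ** matrix_inv g ** transpose F = minkowski"
proof -
  from assms obtain P where P: "invertible P" "transpose P ** g ** P = minkowski"
    by (auto simp: lorentzian_def)
  \<comment> \<open>Reflection of one spatial axis, an isometry of \<open>minkowski\<close> that
    repairs a negatively oriented \<open>P\<close>.\<close>
  define D :: "real^4^4" where "D = (\<chi> i j. if i = j then (if i = 1 then -1 else 1) else 0)"
  have D: "transpose D ** minkowski ** D = minkowski" "det D = -1"
    by (simp_all add: D_def det_4 minkowski_def matrix_matrix_mult_def transpose_def vec_eq_iff forall_4_from_0 sum_4_from_0)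
  define R where "R = (if det P > 0 then P else P ** D)"
  have dR: "det R > 0"
    using P(1) D(2) by (auto simp: R_def det_mul invertible_det_nz)
  have R: "transpose R ** g ** R = minkowski"
  proof (cases "det P > 0")
    case False
    have "transpose (P ** D) ** g ** (P ** D) = transpose D ** (transpose P ** g ** P) ** D"
      by (simp add: matrix_transpose_mul matrix_mul_assoc)
    then show ?thesis using False P(2) D(1) by (simp add: R_def)
  qed (use P(2) in \<open>simp add: R_def\<close>)
  obtain F where F: "R ** F = mat 1" "F ** R = mat 1"
  proof -
    have "invertible R" using dR by (simp add: invertible_det_nz)
    then show ?thesis using that unfolding invertible_def by blast
  qed
  have "det R * det F = 1" using F(1) by (metis det_I det_mul)
  then have dF: "det F > 0" using dR by (metis zero_less_mult_pos zero_less_one)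
  have FT: "transpose F ** transpose R = mat 1" "transpose R ** transpose F = mat 1"
    by (simp_all add: matrix_transpose_mul[symmetric] F transpose_mat)
  have g: "g = transpose F ** minkowski ** F"
  proof -
    have "transpose F ** minkowski ** F = (transpose F ** transpose R) ** g ** (R ** F)"
      by (simp add: R[symmetric] matrix_mul_assoc)
    then show ?thesis by (simp add: F FT)
  qed
  have "g ** (R ** minkowski ** transpose R)
      = transpose F ** minkowski ** (F ** R) ** minkowski ** transpose R"
    by (simp add: g matrix_mul_assoc)
  also have "\<dots> = transpose F ** (minkowski ** minkowski) ** transpose R"
    by (simp add: F matrix_mul_assoc)
  also have "\<dots> = mat 1" by (simp add: minkowski_sq FT)
  finally have "matrix_inv g = R ** minkowski ** transpose R"
    by (rule matrix_inv_unique)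
  then have "F ** matrix_inv g ** transpose F
      = (F ** R) ** minkowski ** (transpose R ** transpose F)"
    by (simp add: matrix_mul_assoc)
  then show thesis using that dF g by (simp add: F FT)
qed

text \<open>The sign \<open>d\<close> is the handedness of the triple; a complex orthogonal change
  of basis with determinant -1 reverses it, so it cannot be fixed to 1. The last clause ties the
  triple to the orientation and normalises its members.\<close>

definition quaternionic_triple :: "real^4^4 \<Rightarrow> real \<Rightarrow> (3 \<Rightarrow> complex^4^4) \<Rightarrow> bool" where
  "quaternionic_triple g d y \<longleftrightarrow> d * d = 1 \<and>
     (\<forall>k. transpose (y k) = - y k) \<and>
     (\<forall>k. y k ** cmat (matrix_inv g) ** y k = - cmat g) \<and>
     y 1 ** cmat (matrix_inv g) ** y 2 = d *\<^sub>R y 3 \<and>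
     y 2 ** cmat (matrix_inv g) ** y 3 = d *\<^sub>R y 1 \<and>
     y 3 ** cmat (matrix_inv g) ** y 1 = d *\<^sub>R y 2 \<and>
     (\<forall>k l. y k ** cmat (matrix_inv g) ** cnjm (y l) = cnjm (y l) ** cmat (matrix_inv g) ** y k) \<and>
     (\<forall>\<alpha> \<beta> \<rho> \<sigma>. (\<Sum>k\<in>UNIV. y k $ \<alpha> $ \<beta> * y k $ \<rho> $ \<sigma>) =
        of_real (g $ \<alpha> $ \<rho> * g $ \<beta> $ \<sigma> - g $ \<alpha> $ \<sigma> * g $ \<beta> $ \<rho>) - \<i> * of_real (vol g \<alpha> \<beta> \<rho> \<sigma>))"

lemma sum2_mult_sum2:
  fixes p :: "'i::finite \<Rightarrow> 'a::comm_ring_1"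
  shows "(\<Sum>a\<in>UNIV. \<Sum>b\<in>UNIV. p a * q b * M a b) * (\<Sum>c\<in>UNIV. \<Sum>d\<in>UNIV. r c * s d * N c d)
     = (\<Sum>a\<in>UNIV. \<Sum>b\<in>UNIV. \<Sum>c\<in>UNIV. \<Sum>d\<in>UNIV. p a * q b * r c * s d * (M a b * N c d))"
  unfolding sum_distrib_right unfolding sum_distrib_left by (simp add: ac_simps)

lemma congruence_entry:
  fixes F M :: "'a::comm_ring_1^'n^'n"
  shows "(transpose F ** M ** F) $ \<alpha> $ \<beta> = (\<Sum>a\<in>UNIV. \<Sum>b\<in>UNIV. F $ a $ \<alpha> * F $ b $ \<beta> * M $ a $ b)"
proof -
  have "(transpose F ** M ** F) $ \<alpha> $ \<beta> = (\<Sum>b\<in>UNIV. \<Sum>a\<in>UNIV. F $ a $ \<alpha> * F $ b $ \<beta> * M $ a $ b)"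
    by (simp add: matrix_matrix_mult_def transpose_def sum_distrib_left ac_simps)
  then show ?thesis by (subst sum.swap)
qed

lemma sum_rotate:
  "(\<Sum>d\<in>D. \<Sum>b\<in>B. \<Sum>c\<in>C. h b c d) = (\<Sum>b\<in>B. \<Sum>c\<in>C. \<Sum>d\<in>D. h b c d)"
  by (subst sum.swap) (intro sum.cong refl sum.swap)

lemma vol_coframe:
  assumes "det F > 0" "g = transpose F ** minkowski ** F"
  shows "vol g \<alpha> \<beta> \<gamma> \<delta> = (\<Sum>a\<in>UNIV. \<Sum>b\<in>UNIV. \<Sum>c\<in>UNIV. \<Sum>d\<in>UNIV.
            F$a$\<alpha> * F$b$\<beta> * F$c$\<gamma> * F$d$\<delta> * levi_civita a b c d)"
proof -
  have "\<bar>det g\<bar> = (det F)\<^sup>2"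
    by (simp add: assms(2) det_mul det_transpose det_minkowski power2_eq_square abs_mult)
  then have "sqrt \<bar>det g\<bar> = det F" using assms(1) by simp
  then show ?thesis by (simp add: vol_def levi_civita_det)
qed

text \<open>The standard forms are pulled back along a coframe. Since \<open>F\<close> carries the
  inverse metric to \<open>minkowski\<close> (\<open>FGF\<close>), every product reduces to the
  standard one; completeness is multilinear in the coframe, with \<open>vol_coframe\<close> for the
  volume term.\<close>

lemma quaternionic_triple_exists:
  assumes "lorentzian g"
  obtains x where "quaternionic_triple g 1 x"
proof -
  obtain F where F: "det F > 0" "g = transpose F ** minkowski ** F"
      "F ** matrix_inv g ** transpose F = minkowski"
    using lorentzian_coframe[OF assms] .
  define x where "x k = transpose (cmat F) ** std_form k ** cmat F" for k
  have conj_x: "cnjm (x k) = transpose (cmat F) ** cnjm (std_form k) ** cmat F" for k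
    by (simp add: x_def cnjm_mult cnjm_transpose)
  have FGF: "cmat F ** cmat (matrix_inv g) ** transpose (cmat F) = cmat minkowski"
    unfolding cmat_transpose[symmetric] cmat_mult[symmetric] F(3) ..
  have prod: "(transpose (cmat F) ** M ** cmat F) ** cmat (matrix_inv g) ** (transpose (cmat F) ** N ** cmat F)
      = transpose (cmat F) ** (M ** cmat minkowski ** N) ** cmat F" for M N
    unfolding FGF[symmetric] by (simp add: matrix_mul_assoc)
  have cg: "cmat g = transpose (cmat F) ** cmat minkowski ** cmat F"
    by (subst F(2)) (simp add: cmat_mult cmat_transpose)
  have anti: "transpose (x k) = - x k" for k
    by (simp add: x_def matrix_transpose_mul transpose_transpose std_form_antisym matrix_mult_uminus_left
        matrix_mult_uminus_right matrix_mul_assoc)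
  have complete: "(\<Sum>k\<in>UNIV. x k $ \<alpha> $ \<beta> * x k $ \<rho> $ \<sigma>) =
        of_real (g $ \<alpha> $ \<rho> * g $ \<beta> $ \<sigma> - g $ \<alpha> $ \<sigma> * g $ \<beta> $ \<rho>) - \<i> * of_real (vol g \<alpha> \<beta> \<rho> \<sigma>)"
    for \<alpha> \<beta> \<rho> \<sigma>
  proof -
    define f where "f a b c d = F$a$\<alpha> * F$b$\<beta> * F$c$\<rho> * F$d$\<sigma>" for a b c d
    have xe: "x k $ \<alpha> $ \<beta> = (\<Sum>a\<in>UNIV. \<Sum>b\<in>UNIV. of_real (F$a$\<alpha>) * of_real (F$b$\<beta>) * std_form k $ a $ b)"
      for k \<alpha> \<beta>
      unfolding x_def congruence_entry by (simp add: cmat_def)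
    have ge: "g $ \<alpha> $ \<beta> = (\<Sum>a\<in>UNIV. \<Sum>b\<in>UNIV. F$a$\<alpha> * F$b$\<beta> * minkowski $ a $ b)" for \<alpha> \<beta>
      by (subst F(2)) (rule congruence_entry)
    have g1: "g $ \<alpha> $ \<rho> * g $ \<beta> $ \<sigma> = (\<Sum>a\<in>UNIV. \<Sum>b\<in>UNIV. \<Sum>c\<in>UNIV. \<Sum>d\<in>UNIV.
        f a b c d * (minkowski $ a $ c * minkowski $ b $ d))"
      unfolding ge sum2_mult_sum2
      by (rule sum.cong[OF refl], subst sum.swap) (simp add: f_def ac_simps)
    have g2: "g $ \<alpha> $ \<sigma> * g $ \<beta> $ \<rho> = (\<Sum>a\<in>UNIV. \<Sum>b\<in>UNIV. \<Sum>c\<in>UNIV. \<Sum>d\<in>UNIV.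
        f a b c d * (minkowski $ a $ d * minkowski $ b $ c))"
      unfolding ge sum2_mult_sum2
      by (subst sum_rotate) (simp add: f_def ac_simps)
    have "(\<Sum>k\<in>UNIV. x k $ \<alpha> $ \<beta> * x k $ \<rho> $ \<sigma>) =
       (\<Sum>k\<in>UNIV. \<Sum>a\<in>UNIV. \<Sum>b\<in>UNIV. \<Sum>c\<in>UNIV. \<Sum>d\<in>UNIV.
          of_real (f a b c d) * (std_form k $ a $ b * std_form k $ c $ d))"
      unfolding xe sum2_mult_sum2 f_def by (simp add: ac_simps)
    also have "\<dots> = (\<Sum>a\<in>UNIV. \<Sum>b\<in>UNIV. \<Sum>c\<in>UNIV. \<Sum>d\<in>UNIV.
          of_real (f a b c d) * (\<Sum>k\<in>UNIV. std_form k $ a $ b * std_form k $ c $ d))"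
      by (simp add: sum_3 sum.distrib distrib_left)
    also have "\<dots> = (\<Sum>a\<in>UNIV. \<Sum>b\<in>UNIV. \<Sum>c\<in>UNIV. \<Sum>d\<in>UNIV.
          of_real (f a b c d * (minkowski $ a $ c * minkowski $ b $ d))
        - of_real (f a b c d * (minkowski $ a $ d * minkowski $ b $ c))
        - \<i> * of_real (f a b c d * levi_civita a b c d))"
      unfolding std_form_complete by (simp add: algebra_simps)
    also have "\<dots> = of_real (g $ \<alpha> $ \<rho> * g $ \<beta> $ \<sigma>) - of_real (g $ \<alpha> $ \<sigma> * g $ \<beta> $ \<rho>)
        - \<i> * of_real (vol g \<alpha> \<beta> \<rho> \<sigma>)"
      unfolding g1 g2 vol_coframe[OF F(1,2)] f_def[symmetric] of_real_sum
      by (simp add: sum_subtractf sum_distrib_left)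
    finally show ?thesis by simp
  qed
  show thesis
  proof (rule that)
    show "quaternionic_triple g 1 x"
      unfolding quaternionic_triple_def
      using anti complete unfolding conj_x unfolding x_def prod cg
      by (simp add: std_form_quaternion std_form_commute matrix_mult_uminus_left matrix_mult_uminus_right)
  qed
qed

subsection \<open>Contractions\<close>

lemma dot1_add_left: "dot1 g (\<lambda>e. u e + u' e) v = dot1 g u v + dot1 g u' v"
  by (simp add: dot1_def algebra_simps sum.distrib)

lemma dot1_add_right: "dot1 g u (\<lambda>e. v e + v' e) = dot1 g u v + dot1 g u v'"
  by (simp add: dot1_def algebra_simps sum.distrib)

lemma dot1_scale_left: "dot1 g (\<lambda>e. c * u e) v = c * dot1 g u v"
  by (simp add: dot1_def sum_distrib_left ac_simps)

lemma dot1_scale_right: "dot1 g u (\<lambda>e. c * v e) = c * dot1 g u v"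
  by (simp add: dot1_def sum_distrib_left ac_simps)

lemma dot2_add_left: "dot2 g (\<lambda>\<mu> \<nu>. P \<mu> \<nu> + P' \<mu> \<nu>) Q = dot2 g P Q + dot2 g P' Q"
  by (simp add: dot2_def algebra_simps sum.distrib)

lemma dot2_add_right: "dot2 g P (\<lambda>\<mu> \<nu>. Q \<mu> \<nu> + Q' \<mu> \<nu>) = dot2 g P Q + dot2 g P Q'"
  by (simp add: dot2_def algebra_simps sum.distrib)

lemma dot2_scale_left: "dot2 g (\<lambda>\<mu> \<nu>. c * P \<mu> \<nu>) Q = c * dot2 g P Q"
  by (simp add: dot2_def sum_distrib_left ac_simps)

lemma dot2_scale_right: "dot2 g P (\<lambda>\<mu> \<nu>. c * Q \<mu> \<nu>) = c * dot2 g P Q"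
  by (simp add: dot2_def sum_distrib_left ac_simps)

lemma dot2_uminus_right: "dot2 g P (\<lambda>\<mu> \<nu>. - Q \<mu> \<nu>) = - dot2 g P Q"
  by (simp add: dot2_def sum_negf)

lemma dot2_sum_left: "dot2 g (\<lambda>\<mu> \<nu>. \<Sum>i\<in>I. P i \<mu> \<nu>) Q = (\<Sum>i\<in>I. dot2 g (P i) Q)"
proof (induction I rule: infinite_finite_induct)
  case (insert i I)
  then show ?case by (simp add: dot2_add_left)
qed (simp_all add: dot2_def)

lemma dot2_sum_right: "dot2 g P (\<lambda>\<mu> \<nu>. \<Sum>i\<in>I. Q i \<mu> \<nu>) = (\<Sum>i\<in>I. dot2 g P (Q i))"
proof (induction I rule: infinite_finite_induct)
  case (insert i I)
  then show ?case by (simp add: dot2_add_right)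
qed (simp_all add: dot2_def)

lemma cnj_dot2: "cnj (dot2 g P Q) = dot2 g (\<lambda>\<mu> \<nu>. cnj (P \<mu> \<nu>)) (\<lambda>\<mu> \<nu>. cnj (Q \<mu> \<nu>))"
  by (simp add: dot2_def)

definition raise2 :: "real^4^4 \<Rightarrow> complex tensor2 \<Rightarrow> complex tensor2" where
  "raise2 g Z \<mu> \<nu> = (\<Sum>\<mu>'\<in>UNIV. \<Sum>\<nu>'\<in>UNIV. of_real (ginv g \<mu> \<mu>' * ginv g \<nu> \<nu>') * Z \<mu>' \<nu>')"

lemma dot2_raise: "dot2 g P Z = (\<Sum>\<mu>\<in>UNIV. \<Sum>\<nu>\<in>UNIV. P \<mu> \<nu> * raise2 g Z \<mu> \<nu>)"
  by (simp add: dot2_def raise2_def sum_distrib_left ac_simps)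

text \<open>Pair symmetry of a curvature tensor becomes symmetry of its coefficient matrix only
  after two contractions trade places.\<close>

lemma dot2_nested_swap:
  "dot2 g P (\<lambda>\<mu> \<nu>. dot2 g Q (\<lambda>\<rho> \<sigma>. K \<rho> \<sigma> \<mu> \<nu>)) = dot2 g Q (\<lambda>\<rho> \<sigma>. dot2 g P (\<lambda>\<mu> \<nu>. K \<rho> \<sigma> \<mu> \<nu>))"
proof -
  have "dot2 g P (\<lambda>\<mu> \<nu>. dot2 g Q (\<lambda>\<rho> \<sigma>. K \<rho> \<sigma> \<mu> \<nu>)) =
    (\<Sum>\<rho>\<in>UNIV. \<Sum>\<sigma>\<in>UNIV. \<Sum>\<rho>'\<in>UNIV. \<Sum>\<sigma>'\<in>UNIV.
      dot2 g P (\<lambda>\<mu> \<nu>. (of_real (ginv g \<rho> \<rho>' * ginv g \<sigma> \<sigma>') * Q \<rho> \<sigma>) * K \<rho>' \<sigma>' \<mu> \<nu>))"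
    by (subst (2) dot2_def) (simp only: dot2_sum_right)
  also have "\<dots> = dot2 g Q (\<lambda>\<rho> \<sigma>. dot2 g P (\<lambda>\<mu> \<nu>. K \<rho> \<sigma> \<mu> \<nu>))"
    unfolding dot2_scale_right by (simp add: dot2_def[of g Q])
  finally show ?thesis .
qed

lemma lorentzian_inverse:
  assumes "lorentzian g"
  shows "g ** matrix_inv g = mat 1" "matrix_inv g ** g = mat 1" "transpose (matrix_inv g) = matrix_inv g"
proof -
  obtain F where F: "det F > 0" "g = transpose F ** minkowski ** F"
    using lorentzian_coframe[OF assms] .
  have "det g \<noteq> 0" using F(1) by (simp add: F(2) det_mul det_transpose det_minkowski)
  then obtain B where B: "g ** B = mat 1" "B ** g = mat 1"
    by (auto simp: invertible_det_nz[symmetric] invertible_def)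
  from B(1) have i: "matrix_inv g = B" by (rule matrix_inv_unique)
  show "g ** matrix_inv g = mat 1" "matrix_inv g ** g = mat 1" using B i by auto
  have "transpose g = g" using assms by (simp add: lorentzian_def)
  then have "g ** transpose B = transpose (B ** g)" by (simp add: matrix_transpose_mul)
  then have "matrix_inv g = transpose B" by (intro matrix_inv_unique) (simp add: B transpose_mat)
  then show "transpose (matrix_inv g) = matrix_inv g" unfolding i by (rule sym)
qed

lemma ginv_sym: "lorentzian g \<Longrightarrow> ginv g \<alpha> \<beta> = ginv g \<beta> \<alpha>"
  using arg_cong[OF lorentzian_inverse(3)[of g], of "\<lambda>M. M $ \<alpha> $ \<beta>"] by (simp add: transpose_def)

lemma dot2_metric:
  assumes "lorentzian g"
  shows "dot2 g (\<lambda>\<rho> \<sigma>. of_real (g $ \<alpha> $ \<rho> * g $ \<beta> $ \<sigma>)) Z = Z \<alpha> \<beta>"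
proof -
  have *: "(\<Sum>\<rho>\<in>UNIV. complex_of_real (g $ \<alpha> $ \<rho>) * of_real (ginv g \<rho> \<mu>)) = of_bool (\<alpha> = \<mu>)" for \<alpha> \<mu>
  proof -
    have "(g ** matrix_inv g) $ \<alpha> $ \<mu> = of_bool (\<alpha> = \<mu>)"
      unfolding lorentzian_inverse(1)[OF assms] by (simp add: mat_def)
    then have "complex_of_real ((g ** matrix_inv g) $ \<alpha> $ \<mu>) = of_bool (\<alpha> = \<mu>)" by simp
    then show ?thesis by (simp add: matrix_matrix_mult_def)
  qed
  have "dot2 g (\<lambda>\<rho> \<sigma>. of_real (g $ \<alpha> $ \<rho> * g $ \<beta> $ \<sigma>)) Z =
    (\<Sum>\<rho>'\<in>UNIV. \<Sum>\<sigma>'\<in>UNIV. \<Sum>\<rho>\<in>UNIV. \<Sum>\<sigma>\<in>UNIV.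
      complex_of_real (g $ \<alpha> $ \<rho>) * of_real (ginv g \<rho> \<rho>') *
      (complex_of_real (g $ \<beta> $ \<sigma>) * of_real (ginv g \<sigma> \<sigma>')) * Z \<rho>' \<sigma>')"
    unfolding dot2_def by (subst sum_rotate, subst sum_rotate) (simp add: ac_simps)
  also have "\<dots> = (\<Sum>\<rho>'\<in>UNIV. \<Sum>\<sigma>'\<in>UNIV.
      (\<Sum>\<rho>\<in>UNIV. complex_of_real (g $ \<alpha> $ \<rho>) * of_real (ginv g \<rho> \<rho>')) *
      (\<Sum>\<sigma>\<in>UNIV. complex_of_real (g $ \<beta> $ \<sigma>) * of_real (ginv g \<sigma> \<sigma>')) * Z \<rho>' \<sigma>')"
    unfolding sum_product by (simp only: sum_distrib_right)
  also have "\<dots> = (\<Sum>\<rho>'\<in>UNIV. \<Sum>\<sigma>'\<in>UNIV. if \<beta> = \<sigma>' then if \<alpha> = \<rho>' then Z \<rho>' \<sigma>' else 0 else 0)"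
    unfolding * by (intro sum.cong refl) simp
  also have "\<dots> = Z \<alpha> \<beta>" by (simp add: sum.delta')
  finally show ?thesis .
qed

lemma hodge_dot2:
  fixes Z :: "complex tensor4"
  shows "hodge g Z \<alpha> \<beta> \<mu> \<nu> = (1/2) * dot2 g (\<lambda>\<rho> \<sigma>. of_real (vol g \<alpha> \<beta> \<rho> \<sigma>)) (\<lambda>\<rho> \<sigma>. Z \<rho> \<sigma> \<mu> \<nu>)"
proof -
  have "hodge g Z \<alpha> \<beta> \<mu> \<nu> = (1/2) * (\<Sum>\<rho>\<in>UNIV. \<Sum>\<sigma>\<in>UNIV. \<Sum>\<rho>'\<in>UNIV. \<Sum>\<sigma>'\<in>UNIV.
        of_real (vol g \<alpha> \<beta> \<rho>' \<sigma>' * ginv g \<rho>' \<rho> * ginv g \<sigma>' \<sigma>) * Z \<rho> \<sigma> \<mu> \<nu>)"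
    by (simp add: hodge_def scaleR_conv_of_real)
  also have "\<dots> = (1/2) * dot2 g (\<lambda>\<rho> \<sigma>. of_real (vol g \<alpha> \<beta> \<rho> \<sigma>)) (\<lambda>\<rho> \<sigma>. Z \<rho> \<sigma> \<mu> \<nu>)"
    unfolding dot2_def by (subst sum_rotate, subst sum_rotate) (simp add: ac_simps)
  finally show ?thesis .
qed

lemma quaternionic_triple_complete:
  assumes "quaternionic_triple g d y"
  shows "(\<Sum>k\<in>UNIV. y k $ \<alpha> $ \<beta> * y k $ \<rho> $ \<sigma>) =
        of_real (g $ \<alpha> $ \<rho> * g $ \<beta> $ \<sigma> - g $ \<alpha> $ \<sigma> * g $ \<beta> $ \<rho>) - \<i> * of_real (vol g \<alpha> \<beta> \<rho> \<sigma>)"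
  using assms unfolding quaternionic_triple_def by blast

text \<open>Inserting completeness, the two metric terms give 2 Z by antisymmetry and the volume
  term gives -2 \<i> times the dual of Z, which together is four times the self-dual part.\<close>

lemma self_dual_triple:
  assumes g: "lorentzian g" and y: "quaternionic_triple g d y"
    and Z: "\<And>\<alpha> \<beta>. Z \<beta> \<alpha> \<mu> \<nu> = - Z \<alpha> \<beta> \<mu> \<nu>"
  shows "self_dual g Z \<alpha> \<beta> \<mu> \<nu> =
     (1/4) * (\<Sum>k\<in>UNIV. y k $ \<alpha> $ \<beta> * dot2 g (\<lambda>\<rho> \<sigma>. y k $ \<rho> $ \<sigma>) (\<lambda>\<rho> \<sigma>. Z \<rho> \<sigma> \<mu> \<nu>))"
proof -
  have "(\<Sum>k\<in>UNIV. y k $ \<alpha> $ \<beta> * dot2 g (\<lambda>\<rho> \<sigma>. y k $ \<rho> $ \<sigma>) (\<lambda>\<rho> \<sigma>. Z \<rho> \<sigma> \<mu> \<nu>)) =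
     dot2 g (\<lambda>\<rho> \<sigma>. \<Sum>k\<in>UNIV. y k $ \<alpha> $ \<beta> * y k $ \<rho> $ \<sigma>) (\<lambda>\<rho> \<sigma>. Z \<rho> \<sigma> \<mu> \<nu>)"
    by (simp only: dot2_sum_left dot2_scale_left)
  also have "\<dots> = dot2 g (\<lambda>\<rho> \<sigma>. of_real (g $ \<alpha> $ \<rho> * g $ \<beta> $ \<sigma>) + ((-1) * of_real (g $ \<beta> $ \<rho> * g $ \<alpha> $ \<sigma>)
       + (- \<i>) * of_real (vol g \<alpha> \<beta> \<rho> \<sigma>))) (\<lambda>\<rho> \<sigma>. Z \<rho> \<sigma> \<mu> \<nu>)"
    unfolding quaternionic_triple_complete[OF y] by (simp add: algebra_simps)
  also have "\<dots> = Z \<alpha> \<beta> \<mu> \<nu> - Z \<beta> \<alpha> \<mu> \<nu> - 2 * \<i> * hodge g Z \<alpha> \<beta> \<mu> \<nu>"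
    unfolding dot2_add_left dot2_scale_left dot2_metric[OF g] hodge_dot2 by simp
  finally have E: "(\<Sum>k\<in>UNIV. y k $ \<alpha> $ \<beta> * dot2 g (\<lambda>\<rho> \<sigma>. y k $ \<rho> $ \<sigma>) (\<lambda>\<rho> \<sigma>. Z \<rho> \<sigma> \<mu> \<nu>))
     = Z \<alpha> \<beta> \<mu> \<nu> - Z \<beta> \<alpha> \<mu> \<nu> - 2 * \<i> * hodge g Z \<alpha> \<beta> \<mu> \<nu>" .
  show ?thesis unfolding E self_dual_def Z[of \<alpha> \<beta>] by (simp add: field_simps)
qed

text \<open>In the sum of the completeness relation and its conjugate the volume form cancels, and
  four times the identity on 2-forms is left.\<close>

lemma two_form_expansion:
  assumes g: "lorentzian g" and y: "quaternionic_triple g d y"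
    and Z: "\<And>\<alpha> \<beta>. Z \<beta> \<alpha> = - Z \<alpha> \<beta>"
  shows "Z \<alpha> \<beta> = (1/4) * (\<Sum>k\<in>UNIV. y k $ \<alpha> $ \<beta> * dot2 g (\<lambda>\<rho> \<sigma>. y k $ \<rho> $ \<sigma>) Z
      + cnjm (y k) $ \<alpha> $ \<beta> * dot2 g (\<lambda>\<rho> \<sigma>. cnjm (y k) $ \<rho> $ \<sigma>) Z)"
proof -
  note c = quaternionic_triple_complete[OF y]
  have c': "(\<Sum>k\<in>UNIV. cnjm (y k) $ \<alpha> $ \<beta> * cnjm (y k) $ \<rho> $ \<sigma>) =
        of_real (g $ \<alpha> $ \<rho> * g $ \<beta> $ \<sigma> - g $ \<alpha> $ \<sigma> * g $ \<beta> $ \<rho>) + \<i> * of_real (vol g \<alpha> \<beta> \<rho> \<sigma>)" for \<rho> \<sigma>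
    using arg_cong[OF c[of \<alpha> \<beta> \<rho> \<sigma>], of cnj] by (simp add: cnjm_def)
  have "(\<Sum>k\<in>UNIV. y k $ \<alpha> $ \<beta> * dot2 g (\<lambda>\<rho> \<sigma>. y k $ \<rho> $ \<sigma>) Z
      + cnjm (y k) $ \<alpha> $ \<beta> * dot2 g (\<lambda>\<rho> \<sigma>. cnjm (y k) $ \<rho> $ \<sigma>) Z)
    = dot2 g (\<lambda>\<rho> \<sigma>. (\<Sum>k\<in>UNIV. y k $ \<alpha> $ \<beta> * y k $ \<rho> $ \<sigma>)
         + (\<Sum>k\<in>UNIV. cnjm (y k) $ \<alpha> $ \<beta> * cnjm (y k) $ \<rho> $ \<sigma>)) Z"
    by (simp only: dot2_sum_left dot2_scale_left dot2_add_left sum.distrib)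
  also have "\<dots> = dot2 g (\<lambda>\<rho> \<sigma>. 2 * of_real (g $ \<alpha> $ \<rho> * g $ \<beta> $ \<sigma>) + (-2) * of_real (g $ \<beta> $ \<rho> * g $ \<alpha> $ \<sigma>)) Z"
    unfolding c c' by (simp add: algebra_simps)
  also have "\<dots> = 2 * Z \<alpha> \<beta> - 2 * Z \<beta> \<alpha>"
    unfolding dot2_add_left dot2_scale_left dot2_metric[OF g] by simp
  finally show ?thesis by (simp add: Z[of \<alpha> \<beta>])
qed

text \<open>Traces bring contractions within reach of the multiplication rules of a triple.\<close>

lemma dot2_matrix:
  assumes "lorentzian g"
  shows "dot2 g (\<lambda>\<alpha> \<beta>. P $ \<alpha> $ \<beta>) (\<lambda>\<alpha> \<beta>. Q $ \<alpha> $ \<beta>)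
     = trace (P ** cmat (matrix_inv g) ** transpose Q ** cmat (matrix_inv g))"
proof -
  let ?G = "cmat (matrix_inv g)"
  have "trace (P ** ?G ** transpose Q ** ?G) = trace ((P ** ?G) ** (transpose Q ** ?G))"
    by (simp add: matrix_mul_assoc)
  also have "\<dots> = (\<Sum>\<mu>\<in>UNIV. \<Sum>\<nu>'\<in>UNIV. \<Sum>\<nu>\<in>UNIV. \<Sum>\<mu>'\<in>UNIV.
       (P $ \<mu> $ \<nu> * ?G $ \<nu> $ \<nu>') * (Q $ \<mu>' $ \<nu>' * ?G $ \<mu>' $ \<mu>))"
    by (simp add: trace_def matrix_matrix_mult_def transpose_def sum_product)
  also have "\<dots> = (\<Sum>\<mu>\<in>UNIV. \<Sum>\<nu>\<in>UNIV. \<Sum>\<mu>'\<in>UNIV. \<Sum>\<nu>'\<in>UNIV.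
       (P $ \<mu> $ \<nu> * ?G $ \<nu> $ \<nu>') * (Q $ \<mu>' $ \<nu>' * ?G $ \<mu>' $ \<mu>))"
    by (rule sum.cong[OF refl]) (rule sum_rotate)
  also have "\<dots> = dot2 g (\<lambda>\<alpha> \<beta>. P $ \<alpha> $ \<beta>) (\<lambda>\<alpha> \<beta>. Q $ \<alpha> $ \<beta>)"
    unfolding dot2_def by (intro sum.cong refl) (simp add: cmat_def ginv_sym[OF assms] ac_simps)
  finally show ?thesis by simp
qed

lemma dot1_matrix:
  "dot1 g (\<lambda>\<epsilon>. P $ \<alpha> $ \<epsilon>) (\<lambda>\<epsilon>. Q $ \<beta> $ \<epsilon>) = (P ** cmat (matrix_inv g) ** transpose Q) $ \<alpha> $ \<beta>"
proof -
  have "(P ** cmat (matrix_inv g) ** transpose Q) $ \<alpha> $ \<beta> =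
     (\<Sum>\<epsilon>'\<in>UNIV. \<Sum>\<epsilon>\<in>UNIV. of_real (ginv g \<epsilon> \<epsilon>') * P $ \<alpha> $ \<epsilon> * Q $ \<beta> $ \<epsilon>')"
    by (simp add: matrix_matrix_mult_def transpose_def cmat_def sum_distrib_right ac_simps sum_distrib_left)
  then show ?thesis unfolding dot1_def by (subst sum.swap) simp
qed

subsection \<open>The algebra of a quaternionic triple\<close>

definition cscale :: "complex \<Rightarrow> complex^'n^'m \<Rightarrow> complex^'n^'m" where
  "cscale c M = (\<chi> i j. c * M $ i $ j)"

lemma cscale_nth [simp]: "cscale c M $ i $ j = c * M $ i $ j"
  by (simp add: cscale_def)

lemma cscale_mult_left: "cscale c A ** B = cscale c (A ** B)"
  by (simp add: matrix_matrix_mult_def vec_eq_iff sum_distrib_left ac_simps)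

lemma cscale_mult_right: "A ** cscale c B = cscale c (A ** B)"
  by (simp add: matrix_matrix_mult_def vec_eq_iff sum_distrib_left ac_simps)

lemma cscale_cscale: "cscale a (cscale b M) = cscale (a * b) M"
  by (simp add: vec_eq_iff ac_simps)

lemma cscale_1 [simp]: "cscale 1 M = M"
  by (simp add: vec_eq_iff)

lemma cscale_uminus: "cscale (- c) M = - cscale c M" "cscale c (- M) = - cscale c M"
  by (simp_all add: vec_eq_iff)

lemma trace_cscale: "trace (cscale c M) = c * trace M"
  by (simp add: trace_def sum_distrib_left)

lemma trace_uminus: "trace (- M) = - trace M" for M :: "'a::ring_1^'n^'n"
  by (simp add: trace_def sum_negf)

lemma trace_cnjm: "trace (cnjm M) = cnj (trace M)"
  by (simp add: trace_def cnjm_def)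

lemma transpose_cscale: "transpose (cscale c M) = cscale c (transpose M)"
  by (simp add: transpose_def vec_eq_iff)

lemma cnjm_cscale: "cnjm (cscale c M) = cscale (cnj c) (cnjm M)"
  by (simp add: cnjm_def vec_eq_iff)

lemma scaleR_cscale: "c *\<^sub>R M = cscale (of_real c) M"
  unfolding vec_eq_iff cscale_nth vector_scaleR_component scaleR_conv_of_real[symmetric] by simp

lemma matrix_mult_sum_left: "(\<Sum>i\<in>I. A i) ** B = (\<Sum>i\<in>I. A i ** B)" for B :: "'a::ring_1^'n^'m"
  by (induction I rule: infinite_finite_induct)
    (simp_all add: matrix_matrix_mult_def vec_eq_iff distrib_right sum.distrib)

lemma matrix_mult_sum_right: "B ** (\<Sum>i\<in>I. A i) = (\<Sum>i\<in>I. B ** A i)" for B :: "'a::ring_1^'n^'m"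
  by (induction I rule: infinite_finite_induct) (simp_all add: matrix_add_ldistrib)

lemma trace_sum: "trace (\<Sum>i\<in>I. A i) = (\<Sum>i\<in>I. trace (A i))" for A :: "'i \<Rightarrow> 'a::comm_ring_1^'n^'n"
  by (simp add: trace_def, rule sum.swap)

lemma matrix_add_distrib_right: "(A + B) ** C = A ** C + B ** C" for A :: "'a::ring_1^'n^'m"
  by (simp add: matrix_matrix_mult_def vec_eq_iff distrib_right sum.distrib)

lemma cnjm_add: "cnjm (A + B) = cnjm A + cnjm B"
  by (simp add: cnjm_def vec_eq_iff)

lemma cnjm_sum: "cnjm (\<Sum>i\<in>I. A i) = (\<Sum>i\<in>I. cnjm (A i))"
  by (simp add: cnjm_def vec_eq_iff)

locale triple =
  fixes g :: "real^4^4" and d :: real and y :: "3 \<Rightarrow> complex^4^4"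
  assumes lor: "lorentzian g" and tri: "quaternionic_triple g d y"
begin

abbreviation "G \<equiv> cmat (matrix_inv g)"

text \<open>One index is raised: mixed components are endomorphisms, for which the quaternion rules
  are plain matrix products with \<open>mat 1\<close> as unit.\<close>

definition "Y k = y k ** G"
definition "Yc k = cnjm (y k) ** G"

lemma d_sq: "d * d = 1"
  using tri by (simp add: quaternionic_triple_def)

lemma d_cases: "d = 1 \<or> d = -1"
  using d_sq by (simp add: square_eq_1_iff)

lemma y_antisym: "transpose (y k) = - y k"
  using tri by (simp add: quaternionic_triple_def)

lemma y_antisym_nth: "y k $ \<beta> $ \<alpha> = - y k $ \<alpha> $ \<beta>"
  using arg_cong[OF y_antisym[of k], of "\<lambda>M. M $ \<alpha> $ \<beta>"] by (simp add: transpose_def)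

lemma G_sym: "transpose G = G"
  by (simp add: cmat_transpose[symmetric] lorentzian_inverse(3)[OF lor])

lemma gG: "cmat g ** G = mat 1" "G ** cmat g = mat 1"
  by (simp_all add: cmat_mult[symmetric] lorentzian_inverse[OF lor] cmat_mat_1)

lemma cnjm_Y: "cnjm (Y k) = Yc k"
  by (simp add: Y_def Yc_def cnjm_mult)

lemma Y_sq: "Y k ** Y k = - mat 1"
proof -
  have "y k ** G ** y k = - cmat g" using tri by (simp add: quaternionic_triple_def)
  then have "y k ** G ** y k ** G = - (cmat g ** G)" by (simp add: matrix_mult_uminus_left)
  then show ?thesis by (simp add: Y_def matrix_mul_assoc gG)
qed

lemma Y_cyclic:
  "Y 1 ** Y 2 = cscale d (Y 3)" "Y 2 ** Y 3 = cscale d (Y 1)" "Y 3 ** Y 1 = cscale d (Y 2)"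
  using tri by (simp_all add: Y_def matrix_mul_assoc quaternionic_triple_def scaleR_cscale cscale_mult_left)

text \<open>Transposing a product of two of the forms reverses the factors without a net sign, while
  the antisymmetric result changes sign.\<close>

lemma Y_anticyclic:
  "Y 2 ** Y 1 = cscale (- d) (Y 3)" "Y 3 ** Y 2 = cscale (- d) (Y 1)" "Y 1 ** Y 3 = cscale (- d) (Y 2)"
proof -
  have *: "Y l ** Y k = cscale (- d) (Y m)" if "Y k ** Y l = cscale d (Y m)" for k l m
  proof -
    have "y l ** G ** y k = transpose (y k ** G ** y l)"
      by (simp add: matrix_transpose_mul y_antisym G_sym matrix_mult_uminus_left matrix_mult_uminus_right matrix_mul_assoc)
    also have "y k ** G ** y l = cscale d (y m)"
      using arg_cong[OF that, of "\<lambda>M. M ** cmat g"]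
      by (simp add: Y_def cscale_mult_left matrix_mul_assoc[symmetric] gG)
    finally have "y l ** G ** y k = cscale (- d) (y m)"
      by (simp add: transpose_cscale y_antisym cscale_uminus)
    then show ?thesis by (simp add: Y_def matrix_mul_assoc cscale_mult_left)
  qed
  show "Y 2 ** Y 1 = cscale (- d) (Y 3)" "Y 3 ** Y 2 = cscale (- d) (Y 1)" "Y 1 ** Y 3 = cscale (- d) (Y 2)"
    by (rule *, rule Y_cyclic)+
qed

lemma Y_commute: "Y k ** Yc l = Yc l ** Y k"
  using tri by (simp add: Y_def Yc_def matrix_mul_assoc quaternionic_triple_def)

lemma Y_distinct:
  assumes "k \<noteq> l"
  obtains m e where "Y k ** Y l = cscale e (Y m)" "Y l ** Y k = cscale (- e) (Y m)" "m \<noteq> k" "m \<noteq> l"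
  using exhaust_3[of k] exhaust_3[of l] assms Y_cyclic Y_anticyclic 
  by (elim disjE) (fastforce simp: minus_equation_iff)+

text \<open>As \<open>d\<close> squares to 1 it can be moved across. The two expressions show that
  each \<open>Y m\<close> is proportional to a commutator, which is how they are used below.\<close>

lemma Y_as_commutator:
  obtains k l where "Y m = cscale d (Y k ** Y l)" "Y m = cscale (- d) (Y l ** Y k)"
proof -
  have dd: "complex_of_real d * of_real d = 1" using d_sq by (metis of_real_1 of_real_mult)
  have "\<exists>k l. Y k ** Y l = cscale d (Y m) \<and> Y l ** Y k = cscale (- d) (Y m)"
    using exhaust_3[of m] Y_cyclic Y_anticyclic by metis
  then obtain k l where kl: "Y k ** Y l = cscale d (Y m)" "Y l ** Y k = cscale (- d) (Y m)" by blast
  show thesis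
    by (rule that[of k l]) (simp_all add: kl cscale_cscale dd)
qed

text \<open>\<open>Y m\<close> is a multiple of the commutator of \<open>Y k\<close> and
  \<open>Y l\<close>, and by cyclicity the trace of \<open>A\<close> times that commutator vanishes
  when \<open>A\<close> commutes with \<open>Y l\<close>. The vanishing traces below rest on
  this.\<close>

lemma trace_commuting_Y:
  assumes "\<And>l. A ** Y l = Y l ** A"
  shows "trace (A ** Y m) = 0"
proof -
  obtain k l where kl: "Y m = cscale d (Y k ** Y l)" "Y m = cscale (- d) (Y l ** Y k)"
    by (rule Y_as_commutator)
  have "trace (A ** Y m) = d * trace (A ** Y k ** Y l)"
    by (simp add: kl(1) cscale_mult_right trace_cscale matrix_mul_assoc)
  also have "trace (A ** Y k ** Y l) = trace (Y l ** (A ** Y k))" by (rule trace_mul_sym)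
  also have "\<dots> = trace (A ** Y l ** Y k)" by (simp add: assms[of l] matrix_mul_assoc)
  also have "d * \<dots> = - trace (A ** Y m)"
    by (simp add: kl(2) cscale_mult_right trace_cscale matrix_mul_assoc)
  finally show ?thesis by simp
qed

lemma trace_commuting_Yc:
  assumes "\<And>l. A ** Yc l = Yc l ** A"
  shows "trace (A ** Yc m) = 0"
proof -
  have "cnjm A ** Y l = Y l ** cnjm A" for l
    using arg_cong[OF assms[of l], of cnjm] by (simp add: cnjm_mult cnjm_Y[symmetric])
  then have "trace (cnjm A ** Y m) = 0" by (rule trace_commuting_Y)
  then have "cnj (trace (cnjm A ** Y m)) = 0" by simp
  then show ?thesis by (simp add: trace_cnjm[symmetric] cnjm_mult cnjm_Y)
qed

lemma trace_Y: "trace (Y k) = 0"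
  using trace_commuting_Y[of "mat 1" k] by simp

lemma trace_Y_Y: "trace (Y k ** Y l) = (if k = l then -4 else 0)"
proof (cases "k = l")
  case False
  then obtain m e where "Y k ** Y l = cscale e (Y m)" by (rule Y_distinct)
  then show ?thesis using False by (simp add: trace_cscale trace_Y)
qed (simp add: Y_sq trace_uminus trace_I)

lemma Y_Yc_flip: "A ** Yc l ** Y k = A ** Y k ** Yc l"
  by (simp add: matrix_mul_assoc[symmetric] Y_commute)

text \<open>Any product of the \<open>Y\<close> commutes with every \<open>Yc\<close>, so the
  conjugate of the preceding argument applies.\<close>

lemma trace_Y_Y_Yc: "trace (Y i ** Y k ** Yc l) = 0"
  by (rule trace_commuting_Yc) (simp add: matrix_mul_assoc Y_commute[symmetric] Y_Yc_flip)

lemma trace_Y_Y_Y_Yc: "trace (Y i ** Y j ** Y k ** Yc l) = 0"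
  by (rule trace_commuting_Yc) (simp add: matrix_mul_assoc Y_commute[symmetric] Y_Yc_flip)

lemma trace_Y_Yc_Yc: "trace (Y i ** Yc k ** Yc l) = 0"
proof -
  have "trace (Y i ** Yc k ** Yc l) = trace (Yc k ** Yc l ** Y i)"
    by (metis matrix_mul_assoc trace_mul_sym)
  also have "\<dots> = cnj (trace (Y k ** Y l ** Yc i))"
    by (simp add: trace_cnjm[symmetric] cnjm_mult cnjm_Y[symmetric])
  finally show ?thesis by (simp add: trace_Y_Y_Yc)
qed

text \<open>If i = k the first two factors are -1 and the rest is a conjugated
  \<open>trace_Y_Y\<close>; otherwise they merge into one \<open>Y m\<close>, whose trace against
  two \<open>Yc\<close> is zero.\<close>

lemma trace_Y_Y_Yc_Yc: "trace (Y i ** Y k ** Yc j ** Yc l) = (if i = k \<and> j = l then 4 else 0)"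
proof (cases "i = k")
  case True
  have "trace (Yc j ** Yc l) = cnj (trace (Y j ** Y l))"
    by (simp add: trace_cnjm[symmetric] cnjm_mult cnjm_Y)
  then show ?thesis using True
    by (simp add: Y_sq matrix_mult_uminus_left trace_uminus trace_Y_Y)
next
  case False
  then obtain m e where "Y i ** Y k = cscale e (Y m)" by (rule Y_distinct)
  then show ?thesis using False by (simp add: cscale_mult_left trace_cscale trace_Y_Yc_Yc)
qed

lemma dot2_y_y: "dot2 g (\<lambda>\<alpha> \<beta>. y k $ \<alpha> $ \<beta>) (\<lambda>\<alpha> \<beta>. y l $ \<alpha> $ \<beta>) = (if k = l then 4 else 0)"
  unfolding dot2_matrix[OF lor] y_antisym
  using trace_Y_Y[of k l]
  by (simp add: Y_def matrix_mul_assoc matrix_mult_uminus_left matrix_mult_uminus_right trace_uminus split: if_splits)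

end

subsection \<open>The self-dual part of a Weyl tensor\<close>

lemma levi_civita_cyclic: "levi_civita a c d b = levi_civita a b c d"
proof -
  have "\<forall>a b c d. levi_civita a c d b = levi_civita a b c d"
    by (simp add: forall_4_from_0 levi_civita_table)
  then show ?thesis by blast
qed

text \<open>Relabelling the last three indices cyclically leaves \<open>U\<close> unchanged, so
  three times the sum equals the sum against the cyclic sum of \<open>K\<close>. It is applied to
  the volume form and the first Bianchi identity.\<close>

lemma sum_cyclic_zero:
  fixes U K :: "'i::finite \<Rightarrow> 'i \<Rightarrow> 'i \<Rightarrow> 'i \<Rightarrow> complex"
  assumes U: "\<And>a b c d. U a c d b = U a b c d"
    and K: "\<And>a b c d. K a b c d + K a c d b + K a d b c = 0"
  shows "(\<Sum>a\<in>UNIV. \<Sum>b\<in>UNIV. \<Sum>c\<in>UNIV. \<Sum>d\<in>UNIV. U a b c d * K a b c d) = 0"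
proof -
  define s where "s = (\<Sum>a\<in>UNIV. \<Sum>b\<in>UNIV. \<Sum>c\<in>UNIV. \<Sum>d\<in>UNIV. U a b c d * K a b c d)"
  have 1: "s = (\<Sum>a\<in>UNIV. \<Sum>b\<in>UNIV. \<Sum>c\<in>UNIV. \<Sum>d\<in>UNIV. U a b c d * K a c d b)"
    unfolding s_def by (subst (2) sum_rotate) (simp add: U)
  have 2: "s = (\<Sum>a\<in>UNIV. \<Sum>b\<in>UNIV. \<Sum>c\<in>UNIV. \<Sum>d\<in>UNIV. U a b c d * K a d b c)"
    unfolding 1 by (subst (2) sum_rotate) (simp add: U)
  have "3 * s = s + s + s" by simp
  also have "\<dots> = (\<Sum>a\<in>UNIV. \<Sum>b\<in>UNIV. \<Sum>c\<in>UNIV. \<Sum>d\<in>UNIV. U a b c d * (K a b c d + K a c d b + K a d b c))"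
    unfolding distrib_left sum.distrib by (simp only: s_def[symmetric] 1[symmetric] 2[symmetric])
  also have "\<dots> = 0" by (simp add: K)
  finally show ?thesis by (simp add: s_def)
qed

lemma vol_cyclic: "vol g a c d b = vol g a b c d"
  by (simp add: vol_def levi_civita_cyclic[of a c d b])

text \<open>With all four indices raised, iterated contractions are plain sums from which the
  completeness kernel can be factored out; reality and the cyclic identity survive the
  raising.\<close>

definition raise4 :: "real^4^4 \<Rightarrow> complex tensor4 \<Rightarrow> complex tensor4" where
  "raise4 g K \<alpha> \<beta> \<mu> \<nu> = (\<Sum>a\<in>UNIV. \<Sum>b\<in>UNIV. \<Sum>c\<in>UNIV. \<Sum>d\<in>UNIV.
     of_real (ginv g \<alpha> a * ginv g \<beta> b * ginv g \<mu> c * ginv g \<nu> d) * K a b c d)"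

lemma dot2_dot2_raise:
  "dot2 g P (\<lambda>\<rho> \<sigma>. dot2 g Q (\<lambda>\<mu> \<nu>. K \<rho> \<sigma> \<mu> \<nu>)) =
     (\<Sum>\<rho>\<in>UNIV. \<Sum>\<sigma>\<in>UNIV. \<Sum>\<mu>\<in>UNIV. \<Sum>\<nu>\<in>UNIV. P \<rho> \<sigma> * Q \<mu> \<nu> * raise4 g K \<rho> \<sigma> \<mu> \<nu>)"
proof -
  have r: "raise2 g (\<lambda>\<rho> \<sigma>. \<Sum>\<mu>\<in>UNIV. \<Sum>\<nu>\<in>UNIV. Q \<mu> \<nu> * raise2 g (K \<rho> \<sigma>) \<mu> \<nu>) \<rho> \<sigma>
     = (\<Sum>\<mu>\<in>UNIV. \<Sum>\<nu>\<in>UNIV. Q \<mu> \<nu> * raise4 g K \<rho> \<sigma> \<mu> \<nu>)" for \<rho> \<sigma>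
  proof -
    have "raise2 g (\<lambda>\<rho> \<sigma>. \<Sum>\<mu>\<in>UNIV. \<Sum>\<nu>\<in>UNIV. Q \<mu> \<nu> * raise2 g (K \<rho> \<sigma>) \<mu> \<nu>) \<rho> \<sigma>
      = (\<Sum>a\<in>UNIV. \<Sum>b\<in>UNIV. \<Sum>\<mu>\<in>UNIV. \<Sum>\<nu>\<in>UNIV.
           of_real (ginv g \<rho> a * ginv g \<sigma> b) * (Q \<mu> \<nu> * raise2 g (K a b) \<mu> \<nu>))"
      by (simp add: raise2_def[of g _ \<rho> \<sigma>] sum_distrib_left)
    also have "\<dots> = (\<Sum>\<mu>\<in>UNIV. \<Sum>\<nu>\<in>UNIV. \<Sum>a\<in>UNIV. \<Sum>b\<in>UNIV.
           of_real (ginv g \<rho> a * ginv g \<sigma> b) * (Q \<mu> \<nu> * raise2 g (K a b) \<mu> \<nu>))"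
      by (subst sum_rotate, subst sum_rotate) simp
    also have "\<dots> = (\<Sum>\<mu>\<in>UNIV. \<Sum>\<nu>\<in>UNIV. Q \<mu> \<nu> * raise4 g K \<rho> \<sigma> \<mu> \<nu>)"
      by (simp add: raise2_def raise4_def sum_distrib_left ac_simps)
    finally show ?thesis .
  qed
  show ?thesis unfolding dot2_raise[of g Q] dot2_raise[of g P] r
    by (simp add: sum_distrib_left ac_simps)
qed

lemma raise4_bianchi:
  assumes "\<And>a b c d. K a b c d + K a c d b + K a d b c = 0"
  shows "raise4 g K \<alpha> \<beta> \<mu> \<nu> + raise4 g K \<alpha> \<mu> \<nu> \<beta> + raise4 g K \<alpha> \<nu> \<beta> \<mu> = 0"
proof -
  let ?c = "\<lambda>a b c d. complex_of_real (ginv g \<alpha> a * ginv g \<beta> b * ginv g \<mu> c * ginv g \<nu> d)"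
  have 1: "raise4 g K \<alpha> \<mu> \<nu> \<beta> = (\<Sum>a\<in>UNIV. \<Sum>b\<in>UNIV. \<Sum>c\<in>UNIV. \<Sum>d\<in>UNIV. ?c a b c d * K a c d b)"
    unfolding raise4_def by (rule sum.cong[OF refl], subst sum_rotate, subst sum_rotate) (simp add: ac_simps)
  have 2: "raise4 g K \<alpha> \<nu> \<beta> \<mu> = (\<Sum>a\<in>UNIV. \<Sum>b\<in>UNIV. \<Sum>c\<in>UNIV. \<Sum>d\<in>UNIV. ?c a b c d * K a d b c)"
    unfolding raise4_def by (rule sum.cong[OF refl], subst sum_rotate) (simp add: ac_simps)
  have "raise4 g K \<alpha> \<beta> \<mu> \<nu> + raise4 g K \<alpha> \<mu> \<nu> \<beta> + raise4 g K \<alpha> \<nu> \<beta> \<mu> =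
    (\<Sum>a\<in>UNIV. \<Sum>b\<in>UNIV. \<Sum>c\<in>UNIV. \<Sum>d\<in>UNIV. ?c a b c d * (K a b c d + K a c d b + K a d b c))"
    unfolding 1 2 distrib_left sum.distrib by (simp add: raise4_def)
  then show ?thesis by (simp add: assms)
qed

lemma sum2_delta:
  fixes f :: "'i::finite \<Rightarrow> 'j::finite \<Rightarrow> 'a::comm_ring_1"
  shows "(\<Sum>k\<in>UNIV. \<Sum>l\<in>UNIV. f k l * (if k = i \<and> l = j then c else 0)) = f i j * c"
proof -
  have "f k l * (if k = i \<and> l = j then c else 0) = (if l = j then if k = i then f k l * c else 0 else 0)" for k l
    by simp
  then show ?thesis by (simp add: sum.delta)
qed

lemma sum_sum_diagonal:
  fixes f :: "'i::finite \<Rightarrow> 'i \<Rightarrow> 'a::comm_ring_1"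
  shows "(\<Sum>k\<in>UNIV. \<Sum>l\<in>UNIV. f k l * (if k = l then c else 0)) = (\<Sum>k\<in>UNIV. f k k * c)"
proof -
  have "f k l * (if k = l then c else 0) = (if k = l then f k l * c else 0)" for k l
    by simp
  then show ?thesis by (simp add: sum.delta')
qed

text \<open>In the basis of the \<open>y k\<close> and their conjugates a curvature tensor has a
  self-dual block \<open>N\<close>, its conjugate, and a mixed block \<open>M\<close>. The mixed
  block is the traceless Ricci tensor, the real part of the trace of \<open>N\<close> is the scalar
  curvature, and its imaginary part is the totally antisymmetric part; each is killed by one of the
  Weyl symmetries.\<close>

lemma (in triple) weyl_self_dual_form:
  assumes W: "weyl_tensor g W"
  obtains Q where "\<And>k l. Q k l = Q l k" "(\<Sum>k\<in>UNIV. Q k k) = 0"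
    "\<And>\<alpha> \<beta> \<mu> \<nu>. self_dual g (complexify4 W) \<alpha> \<beta> \<mu> \<nu> =
       (1/2) * (\<Sum>k\<in>UNIV. \<Sum>l\<in>UNIV. Q k l * y k $ \<alpha> $ \<beta> * y l $ \<mu> $ \<nu>)"
proof -
  define K where "K = complexify4 W"
  have W1: "W \<beta> \<alpha> \<mu> \<nu> = - W \<alpha> \<beta> \<mu> \<nu>" and W2: "W \<alpha> \<beta> \<nu> \<mu> = - W \<alpha> \<beta> \<mu> \<nu>"
    and W3: "W \<mu> \<nu> \<alpha> \<beta> = W \<alpha> \<beta> \<mu> \<nu>" and W4: "W \<alpha> \<beta> \<mu> \<nu> + W \<alpha> \<mu> \<nu> \<beta> + W \<alpha> \<nu> \<beta> \<mu> = 0"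
    and W5: "(\<Sum>\<alpha>\<in>UNIV. \<Sum>\<mu>\<in>UNIV. ginv g \<alpha> \<mu> * W \<alpha> \<beta> \<mu> \<nu>) = 0" for \<alpha> \<beta> \<mu> \<nu>
    using W unfolding weyl_tensor_def by blast+
  have K1: "K \<beta> \<alpha> \<mu> \<nu> = - K \<alpha> \<beta> \<mu> \<nu>" and K2: "K \<alpha> \<beta> \<nu> \<mu> = - K \<alpha> \<beta> \<mu> \<nu>"
    and K3: "K \<mu> \<nu> \<alpha> \<beta> = K \<alpha> \<beta> \<mu> \<nu>" and Kreal: "cnj (K \<alpha> \<beta> \<mu> \<nu>) = K \<alpha> \<beta> \<mu> \<nu>" for \<alpha> \<beta> \<mu> \<nu>
    unfolding K_def complexify4_def
    by (simp_all add: W1[of \<beta> \<alpha>] W2[of \<alpha> \<beta> \<nu> \<mu>] W3[of \<mu> \<nu> \<alpha> \<beta>])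
  have K4: "K \<alpha> \<beta> \<mu> \<nu> + K \<alpha> \<mu> \<nu> \<beta> + K \<alpha> \<nu> \<beta> \<mu> = 0" for \<alpha> \<beta> \<mu> \<nu>
    unfolding K_def complexify4_def of_real_add[symmetric] W4 by simp
  have K5: "(\<Sum>\<alpha>\<in>UNIV. \<Sum>\<mu>\<in>UNIV. of_real (ginv g \<alpha> \<mu>) * K \<alpha> \<beta> \<mu> \<nu>) = 0" for \<beta> \<nu>
    unfolding K_def complexify4_def of_real_mult[symmetric] of_real_sum[symmetric] W5 by simp
  have K3_eta: "(\<lambda>\<rho> \<sigma>. K \<rho> \<sigma> \<mu> \<nu>) = K \<mu> \<nu>" for \<mu> \<nu>
    by (intro ext) (rule K3)
  \<comment> \<open>Contracting the first index pair with \<open>y k\<close> leaves a 2-form in the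
    second pair; \<open>N\<close> and \<open>M\<close> are its components along the
    \<open>y l\<close> and their conjugates.\<close>
  define Vm where "Vm k = (\<chi> \<mu> \<nu>. dot2 g (\<lambda>\<rho> \<sigma>. y k $ \<rho> $ \<sigma>) (\<lambda>\<rho> \<sigma>. K \<rho> \<sigma> \<mu> \<nu>))" for k
  define N where "N k l = dot2 g (\<lambda>\<mu> \<nu>. y l $ \<mu> $ \<nu>) (\<lambda>\<mu> \<nu>. Vm k $ \<mu> $ \<nu>)" for k l
  define M where "M k l = dot2 g (\<lambda>\<mu> \<nu>. cnjm (y l) $ \<mu> $ \<nu>) (\<lambda>\<mu> \<nu>. Vm k $ \<mu> $ \<nu>)" for k l
  have V_cnj: "cnjm (Vm k) $ \<mu> $ \<nu> = dot2 g (\<lambda>\<rho> \<sigma>. cnjm (y k) $ \<rho> $ \<sigma>) (\<lambda>\<rho> \<sigma>. K \<rho> \<sigma> \<mu> \<nu>)" for k \<mu> \<nu>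
    by (simp add: cnjm_def Vm_def cnj_dot2 Kreal)
  have N_sym: "N k l = N l k" for k l
    unfolding N_def Vm_def vec_lambda_beta by (subst dot2_nested_swap) (simp only: K3_eta)
  have M_cnj: "cnj (M k l) = M l k" for k l
  proof -
    have "cnj (M k l) = dot2 g (\<lambda>\<mu> \<nu>. y l $ \<mu> $ \<nu>) (\<lambda>\<mu> \<nu>. cnjm (Vm k) $ \<mu> $ \<nu>)"
      by (simp add: M_def cnj_dot2 cnjm_def)
    also have "\<dots> = M l k" unfolding V_cnj unfolding M_def Vm_def vec_lambda_beta
      by (subst dot2_nested_swap) (simp only: K3_eta)
    finally show ?thesis .
  qed
  have K_exp: "K \<alpha> \<beta> \<mu> \<nu> = (1/4) * (\<Sum>k\<in>UNIV. y k $ \<alpha> $ \<beta> * Vm k $ \<mu> $ \<nu> + cnjm (y k) $ \<alpha> $ \<beta> * cnjm (Vm k) $ \<mu> $ \<nu>)"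
    for \<alpha> \<beta> \<mu> \<nu>
    unfolding V_cnj unfolding Vm_def vec_lambda_beta
    by (rule two_form_expansion[OF lor tri, of "\<lambda>\<alpha> \<beta>. K \<alpha> \<beta> \<mu> \<nu>" \<alpha> \<beta>]) (rule K1)
  have V_exp: "Vm k = (\<Sum>l\<in>UNIV. cscale (N k l / 4) (y l) + cscale (M k l / 4) (cnjm (y l)))" for k
  proof -
    have "Vm k $ \<nu> $ \<mu> = - Vm k $ \<mu> $ \<nu>" for \<mu> \<nu>
      unfolding Vm_def vec_lambda_beta dot2_uminus_right[symmetric]
      by (intro arg_cong[where f = "dot2 g _"] ext) (rule K2)
    from two_form_expansion[OF lor tri, of "\<lambda>\<alpha> \<beta>. Vm k $ \<alpha> $ \<beta>", OF this]
    show ?thesis unfolding N_def[symmetric] M_def[symmetric]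
      by (simp add: vec_eq_iff sum_distrib_left distrib_left sum.distrib ac_simps)
  qed
  \<comment> \<open>Vanishing of the Ricci contraction as a matrix identity; the transposes produced
    by contracting first indices amount to one common sign.\<close>
  have ric: "(\<Sum>k\<in>UNIV. y k ** G ** Vm k + cnjm (y k) ** G ** cnjm (Vm k)) = 0"
  proof -
    have "transpose P ** G ** U = (\<chi> \<beta> \<nu>. \<Sum>\<alpha>\<in>UNIV. \<Sum>\<mu>\<in>UNIV. of_real (ginv g \<alpha> \<mu>) * (P $ \<alpha> $ \<beta> * U $ \<mu> $ \<nu>))"
      for P U :: "complex^4^4"
    proof -
      have "transpose P ** G ** U = (\<chi> \<beta> \<nu>. \<Sum>\<mu>\<in>UNIV. \<Sum>\<alpha>\<in>UNIV. of_real (ginv g \<alpha> \<mu>) * (P $ \<alpha> $ \<beta> * U $ \<mu> $ \<nu>))"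
        by (simp add: matrix_matrix_mult_def transpose_def cmat_def sum_distrib_right ac_simps vec_eq_iff sum_distrib_left)
      then show ?thesis by (subst sum.swap) 
    qed
    note tr = this
    have "(\<Sum>k\<in>UNIV. transpose (y k) ** G ** Vm k + transpose (cnjm (y k)) ** G ** cnjm (Vm k)) $ \<beta> $ \<nu> = 0" for \<beta> \<nu>
    proof -
      have "(\<Sum>k\<in>UNIV. transpose (y k) ** G ** Vm k + transpose (cnjm (y k)) ** G ** cnjm (Vm k)) $ \<beta> $ \<nu>
        = (\<Sum>\<alpha>\<in>UNIV. \<Sum>\<mu>\<in>UNIV. of_real (ginv g \<alpha> \<mu>) * (4 * K \<alpha> \<beta> \<mu> \<nu>))"
        unfolding tr K_exp by (simp add: sum_3 sum.distrib distrib_left)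
      also have "\<dots> = 4 * (\<Sum>\<alpha>\<in>UNIV. \<Sum>\<mu>\<in>UNIV. of_real (ginv g \<alpha> \<mu>) * K \<alpha> \<beta> \<mu> \<nu>)"
        by (simp add: sum_distrib_left ac_simps)
      finally show ?thesis by (simp add: K5)
    qed
    then have "(\<Sum>k\<in>UNIV. transpose (y k) ** G ** Vm k + transpose (cnjm (y k)) ** G ** cnjm (Vm k)) = 0"
      by (simp add: vec_eq_iff)
    moreover have "transpose (cnjm (y k)) = - cnjm (y k)" for k
      by (simp add: cnjm_transpose[symmetric] y_antisym cnjm_uminus)
    ultimately have "- (\<Sum>k\<in>UNIV. y k ** G ** Vm k + cnjm (y k) ** G ** cnjm (Vm k)) = 0"
      by (simp add: y_antisym matrix_mult_uminus_left sum_negf[symmetric])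
    then show ?thesis by simp
  qed
  have VG: "Vm k ** G = (\<Sum>l\<in>UNIV. cscale (N k l / 4) (Y l) + cscale (M k l / 4) (Yc l))" for k
    unfolding V_exp by (simp add: matrix_mult_sum_left matrix_add_distrib_right cscale_mult_left Y_def Yc_def)
  have VGc: "cnjm (Vm k) ** G = (\<Sum>l\<in>UNIV. cscale (cnj (N k l) / 4) (Yc l) + cscale (cnj (M k l) / 4) (Y l))" for k
    using arg_cong[OF VG[of k], of cnjm]
    by (simp add: cnjm_mult cnjm_sum cnjm_add cnjm_cscale cnjm_Y[symmetric])
  \<comment> \<open>The matrix identity is probed by taking its trace against an arbitrary
    \<open>A\<close>; suitable products of \<open>Y\<close> and \<open>Yc\<close> isolate the
    coefficients.\<close>
  have ric_tr: "(\<Sum>k\<in>UNIV. \<Sum>l\<in>UNIV.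
       N k l / 4 * trace (Y k ** Y l ** A) + M k l / 4 * trace (Y k ** Yc l ** A)
     + (cnj (N k l) / 4 * trace (Yc k ** Yc l ** A) + cnj (M k l) / 4 * trace (Yc k ** Y l ** A))) = 0" for A
  proof -
    have "(\<Sum>k\<in>UNIV. Y k ** (Vm k ** G) ** A + Yc k ** (cnjm (Vm k) ** G) ** A)
        = (\<Sum>k\<in>UNIV. y k ** G ** Vm k + cnjm (y k) ** G ** cnjm (Vm k)) ** (G ** A)"
      by (simp add: matrix_mult_sum_left matrix_add_distrib_right Y_def Yc_def matrix_mul_assoc)
    also have "\<dots> = 0" unfolding ric by (simp add: matrix_matrix_mult_def vec_eq_iff)
    finally have "trace (\<Sum>k\<in>UNIV. Y k ** (Vm k ** G) ** A + Yc k ** (cnjm (Vm k) ** G) ** A) = 0"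
      by (simp add: trace_def)
    then show ?thesis
      unfolding VG VGc
      by (simp add: trace_sum trace_add matrix_mult_sum_left matrix_mult_sum_right matrix_add_distrib_right
          matrix_add_ldistrib cscale_mult_left cscale_mult_right trace_cscale sum.distrib)
  qed
  \<comment> \<open>Against \<open>Y i ** Yc j\<close> only two mixed terms have nonzero trace, and
    by \<open>M_cnj\<close> both equal \<open>M i j\<close>.\<close>
  have M0: "M i j = 0" for i j
  proof -
    have a: "trace (Y k ** Y l ** (Y i ** Yc j)) = 0" for k l
      using trace_Y_Y_Y_Yc by (simp add: matrix_mul_assoc)
    have b: "trace (Y k ** Yc l ** (Y i ** Yc j)) = (if k = i \<and> l = j then 4 else 0)" for k l
      using trace_Y_Y_Yc_Yc[of k i l j] by (simp add: matrix_mul_assoc Y_Yc_flip)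
    have c: "trace (Yc k ** Yc l ** (Y i ** Yc j)) = 0" for k l
    proof -
      have "trace (Yc k ** Yc l ** (Y i ** Yc j)) = trace (Yc j ** Yc k ** Yc l ** Y i)"
        by (metis matrix_mul_assoc trace_mul_sym)
      also have "\<dots> = cnj (trace (Y j ** Y k ** Y l ** Yc i))"
        by (simp add: trace_cnjm[symmetric] cnjm_mult cnjm_Y[symmetric])
      finally show ?thesis by (simp add: trace_Y_Y_Y_Yc)
    qed
    have e: "trace (Yc k ** Y l ** (Y i ** Yc j)) = (if k = j \<and> l = i then 4 else 0)" for k l
    proof -
      have "trace (Yc k ** Y l ** (Y i ** Yc j)) = trace (Y l ** Y i ** Yc j ** Yc k)"
        by (metis matrix_mul_assoc trace_mul_sym)
      then show ?thesis using trace_Y_Y_Yc_Yc[of l i j k] by auto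
    qed
    have "M i j + cnj (M j i) = 0"
      using ric_tr[of "Y i ** Yc j"] unfolding a b c e
      by (simp only: sum.distrib sum2_delta mult_zero_right sum.neutral_const) simp
    then show ?thesis by (simp add: M_cnj)
  qed
  have trN1: "(\<Sum>k\<in>UNIV. N k k) + cnj (\<Sum>k\<in>UNIV. N k k) = 0"
  proof -
    have "trace (Yc k ** Yc l) = cnj (trace (Y k ** Y l))" for k l
      by (simp add: trace_cnjm[symmetric] cnjm_mult cnjm_Y)
    then have Yc: "trace (Yc k ** Yc l) = (if k = l then -4 else 0)" for k l
      by (simp add: trace_Y_Y)
    have "(\<Sum>k\<in>UNIV. N k k / 4 * -4) + (\<Sum>k\<in>UNIV. cnj (N k k) / 4 * -4) = 0"
      using ric_tr[of "mat 1"]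
      by (simp only: matrix_mul_rid M0 complex_cnj_zero div_0 mult_zero_left add_0_right Yc trace_Y_Y
          sum.distrib sum_sum_diagonal)
    then have "- (\<Sum>k\<in>UNIV. N k k) - cnj (\<Sum>k\<in>UNIV. N k k) = 0"
      by (simp add: sum_negf)
    then show ?thesis by (simp add: add_eq_0_iff)
  qed
  \<comment> \<open>By completeness the trace of \<open>N\<close> is a real metric contraction minus
    \<i> times the contraction with the volume form, and the latter vanishes by the cyclic
    identity.\<close>
  have trN2: "(\<Sum>k\<in>UNIV. N k k) - cnj (\<Sum>k\<in>UNIV. N k k) = 0"
  proof -
    let ?R = "raise4 g K"
    have R_real: "cnj (?R \<rho> \<sigma> \<mu> \<nu>) = ?R \<rho> \<sigma> \<mu> \<nu>" for \<rho> \<sigma> \<mu> \<nu>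
      by (simp add: raise4_def Kreal)
    have NR: "N k k = (\<Sum>\<mu>\<in>UNIV. \<Sum>\<nu>\<in>UNIV. \<Sum>\<rho>\<in>UNIV. \<Sum>\<sigma>\<in>UNIV. y k $ \<mu> $ \<nu> * y k $ \<rho> $ \<sigma> * ?R \<mu> \<nu> \<rho> \<sigma>)" for k
      unfolding N_def Vm_def vec_lambda_beta dot2_dot2_raise[symmetric] by (simp only: K3_eta)
    have "(\<Sum>k\<in>UNIV. N k k) = (\<Sum>\<mu>\<in>UNIV. \<Sum>\<nu>\<in>UNIV. \<Sum>\<rho>\<in>UNIV. \<Sum>\<sigma>\<in>UNIV.
       (\<Sum>k\<in>UNIV. y k $ \<mu> $ \<nu> * y k $ \<rho> $ \<sigma>) * ?R \<mu> \<nu> \<rho> \<sigma>)"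
      unfolding NR by (simp add: sum_3 sum.distrib distrib_right)
    also have "\<dots> = (\<Sum>\<mu>\<in>UNIV. \<Sum>\<nu>\<in>UNIV. \<Sum>\<rho>\<in>UNIV. \<Sum>\<sigma>\<in>UNIV.
          of_real (g $ \<mu> $ \<rho> * g $ \<nu> $ \<sigma> - g $ \<mu> $ \<sigma> * g $ \<nu> $ \<rho>) * ?R \<mu> \<nu> \<rho> \<sigma>)
        - \<i> * (\<Sum>\<mu>\<in>UNIV. \<Sum>\<nu>\<in>UNIV. \<Sum>\<rho>\<in>UNIV. \<Sum>\<sigma>\<in>UNIV. of_real (vol g \<mu> \<nu> \<rho> \<sigma>) * ?R \<mu> \<nu> \<rho> \<sigma>)"
      unfolding quaternionic_triple_complete[OF tri]
      by (simp add: left_diff_distrib sum_subtractf sum_distrib_left mult.assoc)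
    also have "(\<Sum>\<mu>\<in>UNIV. \<Sum>\<nu>\<in>UNIV. \<Sum>\<rho>\<in>UNIV. \<Sum>\<sigma>\<in>UNIV. complex_of_real (vol g \<mu> \<nu> \<rho> \<sigma>) * ?R \<mu> \<nu> \<rho> \<sigma>) = 0"
      by (rule sum_cyclic_zero) (simp_all add: vol_cyclic raise4_bianchi K4)
    finally show ?thesis by (simp add: R_real)
  qed
  show thesis
  \<comment> \<open>The self-dual projection and the expansion of \<open>Vm\<close> each contribute
    1/4; the prefactor 1/2 of the statement leaves 1/8.\<close>
  proof (rule that[of "\<lambda>k l. N k l / 8"])
    show "N k l / 8 = N l k / 8" for k l by (simp add: N_sym)
    show "(\<Sum>k\<in>UNIV. N k k / 8) = 0"
      using trN1 trN2 by (simp add: sum_divide_distrib[symmetric])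
    show "self_dual g (complexify4 W) \<alpha> \<beta> \<mu> \<nu> =
       (1/2) * (\<Sum>k\<in>UNIV. \<Sum>l\<in>UNIV. N k l / 8 * y k $ \<alpha> $ \<beta> * y l $ \<mu> $ \<nu>)" for \<alpha> \<beta> \<mu> \<nu>
    proof -
      have "Vm k $ \<mu> $ \<nu> = (\<Sum>l\<in>UNIV. N k l / 4 * y l $ \<mu> $ \<nu>)" for k
        by (simp add: V_exp M0)
      moreover have "self_dual g K \<alpha> \<beta> \<mu> \<nu> = (1/4) * (\<Sum>k\<in>UNIV. y k $ \<alpha> $ \<beta> * Vm k $ \<mu> $ \<nu>)"
        unfolding Vm_def vec_lambda_beta by (rule self_dual_triple[OF lor tri]) (rule K1)
      ultimately show ?thesis
        by (simp add: K_def sum_distrib_left field_simps)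
    qed
  qed
qed

subsection \<open>Diagonalization\<close>

text \<open>This is Cayley-Hamilton: the first two coefficients of the characteristic polynomial
  vanish, and taking the trace identifies the remaining one.\<close>

lemma cube_of_traceless:
  fixes Q :: "complex^3^3"
  assumes sym: "transpose Q = Q" and tr: "trace Q = 0" and tr2: "trace (Q ** Q) = 0"
  shows "Q ** Q ** Q = mat (trace (Q ** Q ** Q) / 3)"
proof -
  define a b c e f h where v: "a = Q$1$1" "b = Q$1$2" "c = Q$1$3" "e = Q$2$2" "f = Q$2$3" "h = Q$3$3"
  have s: "Q$2$1 = b" "Q$3$1 = c" "Q$3$2 = f"
    using sym by (auto simp: transpose_def vec_eq_iff v)
  have h: "h = - a - e" using tr by (simp add: trace_def sum_3 v add_eq_0_iff algebra_simps)
  have t2: "a*a + e*e + h*h + 2*(b*b + c*c + f*f) = 0"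
    using tr2 by (simp add: trace_def matrix_matrix_mult_def sum_3 s v[symmetric] algebra_simps)
  show ?thesis
    unfolding vec_eq_iff forall_3 mat_def trace_def matrix_matrix_mult_def
    apply (simp add: sum_3 s v[symmetric])
    using t2 unfolding h
    apply (intro conjI)
    by algebra+
qed

text \<open>An idempotent of trace one has rank one, so its 2 by 2 minors vanish. A column through a
  nonzero diagonal entry, divided by a complex square root of that entry, is the vector; symmetry is
  bilinear here, without conjugation.\<close>

lemma rank_one_projection:
  fixes P :: "complex^3^3"
  assumes sym: "transpose P = P" and idem: "P ** P = P" and tr: "trace P = 1"
  obtains v where "\<And>a b. P $ a $ b = v a * v b"
proof -
  define a b c e f h where v: "a = P$1$1" "b = P$1$2" "c = P$1$3" "e = P$2$2" "f = P$2$3" "h = P$3$3"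
  have s: "P$2$1 = b" "P$3$1 = c" "P$3$2 = f"
    using sym by (auto simp: transpose_def vec_eq_iff v)
  have h: "h = 1 - a - e" using tr by (simp add: trace_def sum_3 v algebra_simps)
  have i: "a*a + b*b + c*c = a" "b*b + e*e + f*f = e" "c*c + f*f + h*h = h"
    "a*b + b*e + c*f = b" "a*c + b*f + c*h = c" "b*c + e*f + f*h = f"
    using idem by (auto simp: matrix_matrix_mult_def vec_eq_iff forall_3 sum_3 s v[symmetric] algebra_simps)
  \<comment> \<open>With the trace condition substituted, every minor is a combination of the
    residuals of the idempotency equations.\<close>
  have id: "2 * (b*b - a*e) = (a*a + b*b + c*c - a) + (b*b + e*e + f*f - e) - (c*c + f*f + h*h - h)"
    "a*h - c*c = (a - (a*a + b*b + c*c)) + (b*b - a*e)"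
    "e*h - f*f = (e - (b*b + e*e + f*f)) + (b*b - a*e)"
    "a*f - b*c = f - (b*c + e*f + f*h)" "b*f - c*e = (a*c + b*f + c*h) - c"
    "b*h - c*f = b - (a*b + b*e + c*f)"
    unfolding h by (simp_all add: algebra_simps)
  then have minors: "a*e = b*b" "a*h = c*c" "e*h = f*f" "a*f = b*c" "b*f = c*e" "b*h = c*f"
    unfolding i by simp_all
  have r: "P $ p $ m * P $ q $ m = P $ p $ q * P $ m $ m" for p q m
    using exhaust_3[of p] exhaust_3[of q] exhaust_3[of m] minors
    by (elim disjE; simp add: s v[symmetric]) (simp_all add: ac_simps)
  have "P$1$1 \<noteq> 0 \<or> P$2$2 \<noteq> 0 \<or> P$3$3 \<noteq> 0"
    using tr by (auto simp: trace_def sum_3)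
  then obtain m where m: "P $ m $ m \<noteq> 0" by blast
  define z where "z = csqrt (P $ m $ m)"
  have z: "z * z = P $ m $ m" "z \<noteq> 0" 
    using m by (auto simp: z_def power2_csqrt[unfolded power2_eq_square])
  show thesis
  proof (rule that[of "\<lambda>a. P $ a $ m / z"])
    show "P $ p $ q = P $ p $ m / z * (P $ q $ m / z)" for p q
      using r[of p m q] z m by (simp add: z(1))
  qed
qed

text \<open>As \<open>R\<close> has cube 1, averaging z^(-k) R^k over k = 0, 1, 2 gives the spectral
  projection for the eigenvalue z; the inverse powers of z are written as z^2 and z. Its trace is
  one because \<open>R\<close> and its square are traceless.\<close>

lemma cube_root_unity_projection:
  fixes R :: "complex^3^3"
  assumes sym: "transpose R = R" and tr: "trace R = 0" and tr2: "trace (R ** R) = 0"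
    and R3: "R ** R ** R = mat 1" and z: "z ^ 3 = 1"
  defines "P \<equiv> cscale (1/3) (mat 1 + cscale (z^2) R + cscale z (R ** R))"
  shows "transpose P = P" "P ** P = P" "trace P = 1"
proof -
  have tadd: "transpose (A + B) = transpose A + transpose B" for A B :: "complex^3^3"
    by (simp add: transpose_def vec_eq_iff)
  show "transpose P = P"
    by (simp add: P_def transpose_cscale tadd transpose_mat sym matrix_transpose_mul)
  show "trace P = 1"
    by (simp add: P_def trace_cscale trace_add trace_I tr tr2)
  have R3': "R ** (R ** R) = mat 1" using R3 by (simp add: matrix_mul_assoc)
  have R4: "(R ** R) ** (R ** R) = R"
    unfolding matrix_mul_assoc R3 by simp
  have z4: "z ^ 4 = z" using z by (simp add: eval_nat_numeral)
  have zx: "z * (z * x) = z\<^sup>2 * x" "z * (c * (z\<^sup>2 * x)) = c * x" for x c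
    using z by (simp_all add: power2_eq_square power3_eq_cube ac_simps) (simp add: mult.assoc[symmetric])?
  have "P ** P = cscale (1/9) (cscale 3 (mat 1 + cscale (z^2) R + cscale z (R ** R)))"
    unfolding P_def cscale_mult_left cscale_mult_right cscale_cscale matrix_add_ldistrib matrix_add_distrib_right
      matrix_mul_lid matrix_mul_rid R3 R3' R4
    by (simp add: vec_eq_iff algebra_simps) (simp add: zx z4 field_simps)
  then show "P ** P = P" by (simp add: P_def cscale_cscale)
qed

text \<open>\<open>Q\<close> divided by \<open>c\<close> has cube 1, so its three spectral
  projections have rank one. That they add up to the identity is the orthogonality of
  \<open>u\<close>; weighting them by the eigenvalues recovers \<open>Q\<close>.\<close>

lemma eigendecomposition:
  fixes Q :: "3 \<Rightarrow> 3 \<Rightarrow> complex"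
  assumes sym: "\<And>k l. Q k l = Q l k" and tr: "(\<Sum>k\<in>UNIV. Q k k) = 0"
    and tr2: "(\<Sum>k\<in>UNIV. \<Sum>l\<in>UNIV. Q k l * Q l k) = 0"
    and tr3: "(\<Sum>k\<in>UNIV. \<Sum>l\<in>UNIV. \<Sum>m\<in>UNIV. Q k l * Q l m * Q m k) = 3 * c ^ 3" and c: "c \<noteq> 0"
    and w: "1 + w + w^2 = 0"
  obtains u :: "3 \<Rightarrow> 3 \<Rightarrow> complex" where "\<And>a b. (\<Sum>i\<in>UNIV. u i a * u i b) = (if a = b then 1 else 0)"
    "\<And>a b. Q a b = c * u 1 a * u 1 b + c * w * u 2 a * u 2 b + c * w^2 * u 3 a * u 3 b"
proof -
  define Qm :: "complex^3^3" where "Qm = (\<chi> i j. Q i j)"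
  define R where "R = cscale (1 / c) Qm"
  have Qsym: "transpose Qm = Qm" using sym by (simp add: Qm_def transpose_def)
  have Qtr: "trace Qm = 0" "trace (Qm ** Qm) = 0" "trace (Qm ** Qm ** Qm) = 3 * c ^ 3"
    using tr tr2 tr3 by (simp_all add: Qm_def trace_def matrix_matrix_mult_def sum_3 algebra_simps)
  have Q3: "Qm ** Qm ** Qm = mat (c ^ 3)"
    using cube_of_traceless[OF Qsym Qtr(1,2)] by (simp add: Qtr(3))
  have R: "transpose R = R" "trace R = 0" "trace (R ** R) = 0" "R ** R ** R = mat 1"
    by (simp_all add: R_def transpose_cscale Qsym trace_cscale Qtr cscale_mult_left cscale_mult_right Q3)
      (use c in \<open>simp add: vec_eq_iff mat_def field_simps power3_eq_cube\<close>)
  have w3: "w ^ 3 = 1" using w by algebra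
  define P where "P z = cscale (1/3) (mat 1 + cscale (z^2) R + cscale z (R ** R))" for z
  have ex: "\<exists>v. \<forall>a b. P z $ a $ b = v a * v b" if "z ^ 3 = 1" for z
    using rank_one_projection[OF cube_root_unity_projection[OF R that]] unfolding P_def by metis
  obtain u1 where u1: "P 1 $ a $ b = u1 a * u1 b" for a b using ex[of 1] by auto
  obtain u2 where u2: "P w $ a $ b = u2 a * u2 b" for a b using ex[OF w3] by auto
  have "(w^2)^3 = 1" using w3 by (metis power_mult mult.commute power_one)
  from ex[OF this] obtain u3 where u3: "P (w^2) $ a $ b = u3 a * u3 b" for a b by auto
  define u where "u i = (if i = (1::3) then u1 else if i = 2 then u2 else u3)" for i
  have u: "u 1 = u1" "u 2 = u2" "u 3 = u3" by (simp_all add: u_def)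
  have w4: "w^4 = w" using w3 by (simp add: eval_nat_numeral)
  have w2: "w^2 = - 1 - w" using w by algebra
  show thesis
  proof (rule that[of u])
    show "(\<Sum>i\<in>UNIV. u i a * u i b) = (if a = b then 1 else 0)" for a b
      unfolding sum_3 u u1[symmetric] u2[symmetric] u3[symmetric]
      by (simp add: P_def w4) (auto simp: w2 mat_def field_simps)
    have "Q a b = c * R $ a $ b" for a b using c by (simp add: R_def Qm_def)
    moreover have "R $ a $ b = P 1 $ a $ b + w * P w $ a $ b + w^2 * P (w^2) $ a $ b" for a b
    proof -
      have "1/3 * (m + r + s) + w * (1/3 * (m + w^2 * r + w * s)) + w^2 * (1/3 * (m + w * r + w^2 * s))
          = 1/3 * ((1 + w + w^2) * m + (1 + 2 * w^3) * r + (1 + w^2 + w^4) * s)" for m r s :: complex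
        by (simp add: field_simps power2_eq_square power3_eq_cube power4_eq_xxxx)
      moreover have "1 + w^2 + w^4 = 0" using w by (simp add: w4 ac_simps)
      ultimately have *: "1/3 * (m + r + s) + w * (1/3 * (m + w^2 * r + w * s)) + w^2 * (1/3 * (m + w * r + w^2 * s)) = r"
        for m r s :: complex by (simp add: w w3)
      show ?thesis unfolding P_def using *[of "mat 1 $ a $ b" "R $ a $ b" "(R ** R) $ a $ b"]
        by (simp add: w4)
    qed
    ultimately show "Q a b = c * u 1 a * u 1 b + c * w * u 2 a * u 2 b + c * w^2 * u 3 a * u 3 b" for a b
      by (simp add: u u1 u2 u3 algebra_simps)
  qed
qed

section \<open>Complex rotations of a quaternionic triple\<close>

lemma orthogonal_rows_cross:
  fixes u :: "3 \<Rightarrow> 3 \<Rightarrow> complex"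
  assumes u: "\<And>a b. (\<Sum>i\<in>UNIV. u i a * u i b) = (if a = b then 1 else 0)"
  obtains D where "D = 1 \<or> D = -1" "\<And>i j. (\<Sum>a\<in>UNIV. u i a * u j a) = (if i = j then 1 else 0)"
    "u 1 2 * u 2 3 - u 1 3 * u 2 2 = D * u 3 1" "u 1 3 * u 2 1 - u 1 1 * u 2 3 = D * u 3 2"
    "u 1 1 * u 2 2 - u 1 2 * u 2 1 = D * u 3 3"
    "u 2 2 * u 3 3 - u 2 3 * u 3 2 = D * u 1 1" "u 2 3 * u 3 1 - u 2 1 * u 3 3 = D * u 1 2"
    "u 2 1 * u 3 2 - u 2 2 * u 3 1 = D * u 1 3"
    "u 3 2 * u 1 3 - u 3 3 * u 1 2 = D * u 2 1" "u 3 3 * u 1 1 - u 3 1 * u 1 3 = D * u 2 2"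
    "u 3 1 * u 1 2 - u 3 2 * u 1 1 = D * u 2 3"
proof -
  define U :: "complex^3^3" where "U = (\<chi> i a. u i a)"
  define D where "D = det U"
  have 1: "transpose U ** U = mat 1"
    using u by (simp add: U_def vec_eq_iff transpose_def matrix_matrix_mult_def mat_def)
  then have 2: "U ** transpose U = mat 1" by (simp add: matrix_left_right_inverse)
  have "D * D = 1" using arg_cong[OF 1, of det] by (simp add: det_mul D_def det_transpose)
  then have D: "D = 1 \<or> D = -1" by (simp add: square_eq_1_iff)
  have o: "(\<Sum>a\<in>UNIV. u i a * u j a) = (if i = j then 1 else 0)" for i j
    using arg_cong[OF 2, of "\<lambda>M. M $ i $ j"] by (simp add: U_def transpose_def matrix_matrix_mult_def mat_def)
  have Deq: "D = u 1 1 * u 2 2 * u 3 3 + u 1 2 * u 2 3 * u 3 1 + u 1 3 * u 2 1 * u 3 2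
     - u 1 1 * u 2 3 * u 3 2 - u 1 2 * u 2 1 * u 3 3 - u 1 3 * u 2 2 * u 3 1"
    by (simp add: D_def det_3 U_def)
  have c: "u 1 a * u 1 b + u 2 a * u 2 b + u 3 a * u 3 b = (if a = b then 1 else 0)" for a b
    using u[of a b] by (simp add: sum_3)
  text \<open>A covector is the combination of its products with the rows; for the cross product of two rows
    only the product with the third one survives.\<close>
  have ex: "p b = (\<Sum>a\<in>UNIV. p a * u 1 a) * u 1 b + (\<Sum>a\<in>UNIV. p a * u 2 a) * u 2 b + (\<Sum>a\<in>UNIV. p a * u 3 a) * u 3 b"
    for p :: "3 \<Rightarrow> complex" and b
  proof -
    have "p b = (\<Sum>a\<in>UNIV. p a * (if a = b then 1 else 0))" by (simp add: if_distrib cong: if_cong)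
    also have "\<dots> = (\<Sum>a\<in>UNIV. p a * (u 1 a * u 1 b + u 2 a * u 2 b + u 3 a * u 3 b))"
      by (simp only: c)
    also have "\<dots> = (\<Sum>a\<in>UNIV. p a * u 1 a) * u 1 b + (\<Sum>a\<in>UNIV. p a * u 2 a) * u 2 b + (\<Sum>a\<in>UNIV. p a * u 3 a) * u 3 b"
      by (simp only: distrib_left sum.distrib sum_distrib_right mult.assoc)
    finally show ?thesis .
  qed
  define X where "X p q a = (if a = (1::3) then p 2 * q 3 - p 3 * q 2 else if a = 2 then p 3 * q 1 - p 1 * q 3
     else p 1 * q 2 - p 2 * q (1::3))" for p q :: "3 \<Rightarrow> complex" and a
  have X: "X p q 1 = p 2 * q 3 - p 3 * q 2" "X p q 2 = p 3 * q 1 - p 1 * q 3" "X p q 3 = p 1 * q 2 - p 2 * q 1"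
    for p q by (simp_all add: X_def)
  have "X (u 1) (u 2) b = D * u 3 b" "X (u 2) (u 3) b = D * u 1 b" "X (u 3) (u 1) b = D * u 2 b" for b
    by (subst ex, simp add: sum_3 X Deq algebra_simps)+
  note this[of 1] this[of 2] this[of 3]
  from this[unfolded X] that[OF D o] show thesis by blast
qed

lemmas matrix_entries = vec_eq_iff cscale_nth vector_add_component vector_uminus_component

lemma transpose_add: "transpose (A + B) = transpose A + transpose B" for A B :: "'a::semiring_1^'n^'m"
  by (simp add: transpose_def vec_eq_iff)

context triple
begin

text \<open>Multiplication of imaginary quaternions: minus the scalar product, plus the cross
  product with handedness \<open>d\<close>.\<close>

lemma Y_combination_mult:
  fixes p q :: "3 \<Rightarrow> complex"
  shows "(\<Sum>a\<in>UNIV. cscale (p a) (Y a)) ** (\<Sum>b\<in>UNIV. cscale (q b) (Y b)) =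
     cscale (- (\<Sum>a\<in>UNIV. p a * q a)) (mat 1) + cscale (d * (p 2 * q 3 - p 3 * q 2)) (Y 1)
     + cscale (d * (p 3 * q 1 - p 1 * q 3)) (Y 2) + cscale (d * (p 1 * q 2 - p 2 * q 1)) (Y 3)"
  unfolding sum_3
  unfolding matrix_add_ldistrib matrix_add_distrib_right
  unfolding cscale_mult_left cscale_mult_right
  unfolding Y_sq
  unfolding Y_cyclic
  unfolding Y_anticyclic
  by (simp only: matrix_entries, intro allI, simp add: algebra_simps)

text \<open>Scalar products of the rows of \<open>u\<close> are those of an orthonormal system and
  cross products are again rows up to the determinant, so the multiplication rules persist with the
  handedness multiplied by that determinant. Completeness depends only on the orthonormality of the
  columns.\<close>

lemma rotated_triple:
  fixes u :: "3 \<Rightarrow> 3 \<Rightarrow> complex"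
  assumes u: "\<And>a b. (\<Sum>i\<in>UNIV. u i a * u i b) = (if a = b then 1 else 0)"
  defines "z \<equiv> \<lambda>i. \<Sum>a\<in>UNIV. cscale (u i a) (y a)"
  obtains d' where "quaternionic_triple g d' z"
proof -
  obtain D where D: "D = 1 \<or> D = -1" and o: "\<And>i j. (\<Sum>a\<in>UNIV. u i a * u j a) = (if i = j then 1 else 0)"
    and cross: "u 1 2 * u 2 3 - u 1 3 * u 2 2 = D * u 3 1" "u 1 3 * u 2 1 - u 1 1 * u 2 3 = D * u 3 2"
    "u 1 1 * u 2 2 - u 1 2 * u 2 1 = D * u 3 3"
    "u 2 2 * u 3 3 - u 2 3 * u 3 2 = D * u 1 1" "u 2 3 * u 3 1 - u 2 1 * u 3 3 = D * u 1 2"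
    "u 2 1 * u 3 2 - u 2 2 * u 3 1 = D * u 1 3"
    "u 3 2 * u 1 3 - u 3 3 * u 1 2 = D * u 2 1" "u 3 3 * u 1 1 - u 3 1 * u 1 3 = D * u 2 2"
    "u 3 1 * u 1 2 - u 3 2 * u 1 1 = D * u 2 3"
    by (rule orthogonal_rows_cross[OF u]) (rule that; assumption)
  \<comment> \<open>\<open>D\<close> is a complex number equal to 1 or -1, whereas the handedness is
    real by type.\<close>
  define d' where "d' = d * Re D"
  have d': "complex_of_real d' = d * D" "d' * d' = 1"
    using D d_cases by (auto simp: d'_def)
  have zG: "z i ** G = (\<Sum>a\<in>UNIV. cscale (u i a) (Y a))" for i
    by (simp add: z_def matrix_mult_sum_left cscale_mult_left Y_def)
  have cz: "cnjm (z i) ** G = (\<Sum>a\<in>UNIV. cscale (cnj (u i a)) (Yc a))" for i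
    by (simp add: z_def cnjm_sum cnjm_cscale matrix_mult_sum_left cscale_mult_left Yc_def)
  have inj: "A = B" if "A ** G = B ** G" for A B :: "complex^4^4"
    using arg_cong[OF that, of "\<lambda>M. M ** cmat g"] by (simp add: matrix_mul_assoc[symmetric] gG)
  have anti: "transpose (z i) = - z i" for i
    unfolding z_def sum_3 transpose_add transpose_cscale y_antisym cscale_uminus by simp
  have sq: "z i ** G ** z i = - cmat g" for i
  proof (rule inj)
    have "(z i ** G) ** (z i ** G) = - mat 1"
      unfolding zG Y_combination_mult o
      by (simp only: matrix_entries, intro allI, simp add: algebra_simps)
    then show "z i ** G ** z i ** G = - cmat g ** G"
      by (simp add: matrix_mul_assoc matrix_mult_uminus_left gG)
  qed
  have cyc: "z i ** G ** z j = d' *\<^sub>R z k"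
    if "(z i ** G) ** (z j ** G) = cscale (d * D) (z k ** G)" for i j k
    by (rule inj) (use that in \<open>simp add: matrix_mul_assoc scaleR_cscale cscale_mult_left d'\<close>)
  have comm: "z k ** G ** cnjm (z l) = cnjm (z l) ** G ** z k" for k l
  proof (rule inj)
    have "(z k ** G) ** (cnjm (z l) ** G) = (cnjm (z l) ** G) ** (z k ** G)"
      unfolding zG cz sum_3
      unfolding matrix_add_ldistrib matrix_add_distrib_right
      unfolding cscale_mult_left cscale_mult_right
      unfolding Y_commute
      by (simp only: matrix_entries, intro allI, simp add: algebra_simps)
    then show "z k ** G ** cnjm (z l) ** G = cnjm (z l) ** G ** z k ** G"
      by (simp add: matrix_mul_assoc)
  qed
  have compl: "(\<Sum>k\<in>UNIV. z k $ \<alpha> $ \<beta> * z k $ \<rho> $ \<sigma>) = (\<Sum>k\<in>UNIV. y k $ \<alpha> $ \<beta> * y k $ \<rho> $ \<sigma>)" for \<alpha> \<beta> \<rho> \<sigma>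
  proof -
    have "(\<Sum>k\<in>UNIV. z k $ \<alpha> $ \<beta> * z k $ \<rho> $ \<sigma>) =
      (\<Sum>a\<in>UNIV. \<Sum>b\<in>UNIV. (\<Sum>k\<in>UNIV. u k a * u k b) * (y a $ \<alpha> $ \<beta> * y b $ \<rho> $ \<sigma>))"
      by (simp add: z_def sum_3 algebra_simps)
    also have "\<dots> = (\<Sum>k\<in>UNIV. y k $ \<alpha> $ \<beta> * y k $ \<rho> $ \<sigma>)"
      unfolding u by (simp add: if_distribR if_distrib cong: if_cong)
    finally show ?thesis .
  qed
  have c3: "z 1 ** G ** z 2 = d' *\<^sub>R z 3"
    by (rule cyc, unfold zG, unfold Y_combination_mult o cross, unfold sum_3,
        simp only: matrix_entries, intro allI, simp add: algebra_simps)
  have c1: "z 2 ** G ** z 3 = d' *\<^sub>R z 1"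
    by (rule cyc, unfold zG, unfold Y_combination_mult o cross, unfold sum_3,
        simp only: matrix_entries, intro allI, simp add: algebra_simps)
  have c2: "z 3 ** G ** z 1 = d' *\<^sub>R z 2"
    by (rule cyc, unfold zG, unfold Y_combination_mult o cross, unfold sum_3,
        simp only: matrix_entries, intro allI, simp add: algebra_simps)
  have "quaternionic_triple g d' z"
    unfolding quaternionic_triple_def compl
    using d'(2) anti sq c1 c2 c3 comm quaternionic_triple_complete[OF tri] by blast
  then show thesis by (rule that)
qed

end

subsection \<open>The Bel-Robinson tensor in a quaternionic triple\<close>

lemma dot2_product: "dot2 g (\<lambda>\<rho> \<sigma>. u \<rho> * v \<sigma>) (\<lambda>\<rho> \<sigma>. u' \<rho> * v' \<sigma>) = dot1 g u u' * dot1 g v v'"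
proof -
  have "dot1 g u u' * dot1 g v v' = (\<Sum>\<mu>\<in>UNIV. \<Sum>\<nu>\<in>UNIV. \<Sum>\<mu>'\<in>UNIV. \<Sum>\<nu>'\<in>UNIV.
      (of_real (ginv g \<mu> \<mu>') * u \<mu> * u' \<mu>') * (of_real (ginv g \<nu> \<nu>') * v \<nu> * v' \<nu>'))"
    unfolding dot1_def by (simp only: sum_product)
  then show ?thesis by (simp add: dot2_def ac_simps)
qed

lemma sum_UNIV_prod: "(\<Sum>I\<in>UNIV. f I) = (\<Sum>i\<in>UNIV. \<Sum>k\<in>UNIV. f (i, k))"
  for f :: "'i::finite \<times> 'j::finite \<Rightarrow> 'a::comm_monoid_add"
  by (simp add: UNIV_Times_UNIV[symmetric] sum.cartesian_product del: UNIV_Times_UNIV)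

text \<open>Over an orthonormal family, \<open>comp4\<close> is the matrix product of the
  coefficients and \<open>trace4\<close> their trace.\<close>

definition tensor_sum :: "('i \<Rightarrow> complex tensor2) \<Rightarrow> ('i \<Rightarrow> 'i \<Rightarrow> complex) \<Rightarrow> complex tensor4" where
  "tensor_sum \<phi> c \<alpha> \<beta> \<mu> \<nu> = (\<Sum>I\<in>UNIV. \<Sum>J\<in>UNIV. c I J * \<phi> I \<alpha> \<beta> * \<phi> J \<mu> \<nu>)"

lemma comp4_tensor_sum:
  fixes \<phi> :: "'i::finite \<Rightarrow> complex tensor2"
  assumes orth: "\<And>I J. dot2 g (\<phi> I) (\<phi> J) = (if I = J then 1 else 0)"
  shows "comp4 g (tensor_sum \<phi> c) (tensor_sum \<phi> c') = tensor_sum \<phi> (\<lambda>I J. \<Sum>K\<in>UNIV. c I K * c' K J)"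
proof (intro ext)
  fix \<alpha> \<beta> \<rho> \<sigma>
  have l: "tensor_sum \<phi> c \<alpha> \<beta> = (\<lambda>\<mu> \<nu>. \<Sum>I\<in>UNIV. \<Sum>J\<in>UNIV. (c I J * \<phi> I \<alpha> \<beta>) * \<phi> J \<mu> \<nu>)"
    by (intro ext) (simp add: tensor_sum_def)
  have r: "(\<lambda>\<mu> \<nu>. tensor_sum \<phi> c' \<mu> \<nu> \<rho> \<sigma>) = (\<lambda>\<mu> \<nu>. \<Sum>K\<in>UNIV. \<Sum>L\<in>UNIV. (c' K L * \<phi> L \<rho> \<sigma>) * \<phi> K \<mu> \<nu>)"
    by (intro ext) (simp add: tensor_sum_def ac_simps)
  have "comp4 g (tensor_sum \<phi> c) (tensor_sum \<phi> c') \<alpha> \<beta> \<rho> \<sigma>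
     = (\<Sum>I\<in>UNIV. \<Sum>J\<in>UNIV. (c I J * \<phi> I \<alpha> \<beta>) * (\<Sum>K\<in>UNIV. \<Sum>L\<in>UNIV. (c' K L * \<phi> L \<rho> \<sigma>) * dot2 g (\<phi> J) (\<phi> K)))"
    unfolding comp4_def l r by (simp only: dot2_sum_left dot2_scale_left dot2_sum_right dot2_scale_right)
  also have "\<dots> = (\<Sum>I\<in>UNIV. \<Sum>J\<in>UNIV. \<Sum>L\<in>UNIV. c I J * c' J L * \<phi> I \<alpha> \<beta> * \<phi> L \<rho> \<sigma>)"
  proof -
    have "(\<Sum>K\<in>UNIV. \<Sum>L\<in>UNIV. (c' K L * \<phi> L \<rho> \<sigma>) * dot2 g (\<phi> J) (\<phi> K)) = (\<Sum>L\<in>UNIV. c' J L * \<phi> L \<rho> \<sigma>)" for J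
      unfolding orth by (subst sum.swap) (simp add: if_distrib cong: if_cong)
    then show ?thesis by (simp add: sum_distrib_left ac_simps)
  qed
  also have "\<dots> = (\<Sum>I\<in>UNIV. \<Sum>L\<in>UNIV. \<Sum>J\<in>UNIV. c I J * c' J L * \<phi> I \<alpha> \<beta> * \<phi> L \<rho> \<sigma>)"
    by (rule sum.cong[OF refl]) (rule sum.swap)
  also have "\<dots> = tensor_sum \<phi> (\<lambda>I J. \<Sum>K\<in>UNIV. c I K * c' K J) \<alpha> \<beta> \<rho> \<sigma>"
    by (simp add: tensor_sum_def sum_distrib_right)
  finally show "comp4 g (tensor_sum \<phi> c) (tensor_sum \<phi> c') \<alpha> \<beta> \<rho> \<sigma> = \<dots>" .
qed

lemma trace4_tensor_sum:
  fixes \<phi> :: "'i::finite \<Rightarrow> complex tensor2"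
  assumes orth: "\<And>I J. dot2 g (\<phi> I) (\<phi> J) = (if I = J then 1 else 0)"
  shows "trace4 g (tensor_sum \<phi> c) = (\<Sum>I\<in>UNIV. c I I)"
proof -
  have "trace4 g (tensor_sum \<phi> c) =
     (\<Sum>\<alpha>\<in>UNIV. \<Sum>\<beta>\<in>UNIV. \<Sum>\<alpha>'\<in>UNIV. \<Sum>\<beta>'\<in>UNIV. \<Sum>I\<in>UNIV. \<Sum>J\<in>UNIV.
        c I J * (of_real (ginv g \<alpha> \<alpha>' * ginv g \<beta> \<beta>') * \<phi> J \<alpha> \<beta> * \<phi> I \<alpha>' \<beta>'))"
    unfolding trace4_def tensor_sum_def sum_distrib_left by (intro sum.cong refl) (simp add: ac_simps)
  also have "\<dots> = (\<Sum>I\<in>UNIV. \<Sum>J\<in>UNIV. \<Sum>\<alpha>\<in>UNIV. \<Sum>\<beta>\<in>UNIV. \<Sum>\<alpha>'\<in>UNIV. \<Sum>\<beta>'\<in>UNIV.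
        c I J * (of_real (ginv g \<alpha> \<alpha>' * ginv g \<beta> \<beta>') * \<phi> J \<alpha> \<beta> * \<phi> I \<alpha>' \<beta>'))"
  proof -
    have 1: "(\<Sum>a\<in>A. \<Sum>b\<in>B. \<Sum>I\<in>P. \<Sum>J\<in>Q. f a b I J) = (\<Sum>I\<in>P. \<Sum>J\<in>Q. \<Sum>a\<in>A. \<Sum>b\<in>B. f a b I J)"
      for A :: "'a set" and B :: "'b set" and P :: "'c set" and Q :: "'d set" and f :: "_ \<Rightarrow> _ \<Rightarrow> _ \<Rightarrow> _ \<Rightarrow> complex"
      by (subst sum_rotate, subst sum_rotate) simp
    show ?thesis
      by (rule trans[OF sum.cong[OF refl sum.cong[OF refl 1]] 1])
  qed
  also have "\<dots> = (\<Sum>I\<in>UNIV. \<Sum>J\<in>UNIV. c I J * dot2 g (\<phi> J) (\<phi> I))"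
    by (simp add: dot2_def sum_distrib_left)
  also have "\<dots> = (\<Sum>I\<in>UNIV. c I I)"
    unfolding orth by (simp add: if_distrib cong: if_cong)
  finally show ?thesis .
qed

definition kron :: "('i \<Rightarrow> 'i \<Rightarrow> complex) \<Rightarrow> ('j \<Rightarrow> 'j \<Rightarrow> complex) \<Rightarrow> 'i \<times> 'j \<Rightarrow> 'i \<times> 'j \<Rightarrow> complex" where
  "kron a b I J = a (fst I) (fst J) * b (snd I) (snd J)"

lemma kron_mult:
  fixes a a' :: "'i::finite \<Rightarrow> 'i \<Rightarrow> complex" and b b' :: "'j::finite \<Rightarrow> 'j \<Rightarrow> complex"
  shows "(\<lambda>I J. \<Sum>K\<in>UNIV. kron a b I K * kron a' b' K J) =
    kron (\<lambda>i j. \<Sum>k\<in>UNIV. a i k * a' k j) (\<lambda>i j. \<Sum>k\<in>UNIV. b i k * b' k j)"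
  by (intro ext) (simp add: kron_def sum_UNIV_prod sum_product ac_simps)

lemma kron_trace:
  fixes a :: "'i::finite \<Rightarrow> 'i \<Rightarrow> complex" and b :: "'j::finite \<Rightarrow> 'j \<Rightarrow> complex"
  shows "(\<Sum>I\<in>UNIV. kron a b I I) = (\<Sum>i\<in>UNIV. a i i) * (\<Sum>j\<in>UNIV. b j j)"
  by (simp add: kron_def sum_UNIV_prod sum_product)

context triple
begin

text \<open>The factor 1/2 makes the nine tensors orthonormal. The transpose matches the form in
  which \<open>dot1_matrix\<close> delivers the contraction of \<open>y i\<close> with a
  conjugate.\<close>

definition hm :: "3 \<Rightarrow> 3 \<Rightarrow> complex^4^4" where
  "hm i j = cscale (1/2) (y i ** G ** transpose (cnjm (y j)))"

definition h2 :: "3 \<times> 3 \<Rightarrow> complex tensor2" where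
  "h2 I = (\<lambda>\<alpha> \<beta>. hm (fst I) (snd I) $ \<alpha> $ \<beta>)"

lemma cnjm_y_antisym: "transpose (cnjm (y k)) = - cnjm (y k)"
  by (simp add: cnjm_transpose[symmetric] y_antisym cnjm_uminus)

lemma hm_eq: "hm i j = cscale (-1/2) (y i ** G ** cnjm (y j))"
  unfolding hm_def cnjm_y_antisym matrix_mult_uminus_right by (simp add: vec_eq_iff)

lemma hm_transpose: "transpose (hm i j) = hm i j"
proof -
  have "transpose (y i ** G ** cnjm (y j)) = cnjm (y j) ** G ** y i"
    by (simp add: matrix_transpose_mul y_antisym cnjm_y_antisym G_sym matrix_mult_uminus_left
        matrix_mult_uminus_right matrix_mul_assoc)
  also have "\<dots> = y i ** G ** cnjm (y j)" using tri by (simp add: quaternionic_triple_def)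
  finally show ?thesis by (simp add: hm_eq transpose_cscale)
qed

lemma hm_G: "hm i j ** G = cscale (-1/2) (Y i ** Yc j)"
  by (simp add: hm_eq Y_def Yc_def cscale_mult_left matrix_mul_assoc)

text \<open>Conjugation exchanges the two factors, and these commute. This reality is what later
  makes the numbers x_i real.\<close>

lemma cnjm_hm_diag: "cnjm (hm i i) = hm i i"
proof -
  have "cnjm (y i ** G ** cnjm (y i)) = y i ** G ** cnjm (y i)"
    using tri by (simp add: cnjm_mult quaternionic_triple_def)
  then show ?thesis by (simp add: hm_eq cnjm_cscale)
qed

lemma matrix_G_cancel: "A ** G = B ** G \<Longrightarrow> A = B" for A B :: "complex^4^4"
proof -
  assume "A ** G = B ** G"
  then have "A ** (G ** cmat g) = B ** (G ** cmat g)" by (simp only: matrix_mul_assoc)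
  then show "A = B" by (simp add: gG)
qed

lemma h2_orthonormal: "dot2 g (h2 I) (h2 J) = (if I = J then 1 else 0)"
proof (cases I; cases J)
  fix i j k l assume I: "I = (i, j)" "J = (k, l)"
  have "dot2 g (h2 I) (h2 J) = trace ((hm i j ** G) ** (hm k l ** G))"
    by (simp add: h2_def I dot2_matrix[OF lor] hm_transpose matrix_mul_assoc)
  also have "\<dots> = (1/4) * trace (Y i ** Y k ** Yc j ** Yc l)"
    by (simp add: hm_G cscale_mult_left cscale_mult_right trace_cscale matrix_mul_assoc Y_Yc_flip cscale_cscale)
  also have "\<dots> = (if i = k \<and> j = l then 1 else 0)" unfolding trace_Y_Y_Yc_Yc by simp
  finally show ?thesis by (simp add: I)
qed

text \<open>One inner contraction pairs the first form of the self-dual tensor with the first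
  conjugate form, the other pairs the second ones. Each gives twice an \<open>h2\<close>, cancelling
  the two prefactors 1/2, so regrouping the labels as (i, k) and (j, l) gives a Kronecker
  product.\<close>

lemma bel_robinson_triple:
  assumes S: "\<And>\<alpha> \<beta> \<mu> \<nu>. self_dual g (complexify4 W) \<alpha> \<beta> \<mu> \<nu> =
       (1/2) * (\<Sum>k\<in>UNIV. \<Sum>l\<in>UNIV. Q k l * y k $ \<alpha> $ \<beta> * y l $ \<mu> $ \<nu>)"
  shows "bel_robinson g W = tensor_sum h2 (kron Q (\<lambda>k l. cnj (Q k l)))"
proof (intro ext)
  fix \<alpha> \<mu> \<beta> \<nu>
  have l: "(\<lambda>\<rho> \<sigma>. self_dual g (complexify4 W) \<alpha> \<rho> \<beta> \<sigma>) =
     (\<lambda>\<rho> \<sigma>. \<Sum>i\<in>UNIV. \<Sum>j\<in>UNIV. (Q i j / 2) * (y i $ \<alpha> $ \<rho> * y j $ \<beta> $ \<sigma>))"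
    unfolding S by (simp add: sum_distrib_left ac_simps)
  have r: "(\<lambda>\<rho> \<sigma>. cnj (self_dual g (complexify4 W) \<mu> \<rho> \<nu> \<sigma>)) =
     (\<lambda>\<rho> \<sigma>. \<Sum>k\<in>UNIV. \<Sum>l\<in>UNIV. (cnj (Q k l) / 2) * (cnjm (y k) $ \<mu> $ \<rho> * cnjm (y l) $ \<nu> $ \<sigma>))"
    unfolding S by (simp add: sum_distrib_left ac_simps cnjm_def)
  have d: "dot1 g (\<lambda>\<epsilon>. y i $ \<alpha> $ \<epsilon>) (\<lambda>\<epsilon>. cnjm (y k) $ \<mu> $ \<epsilon>) = 2 * h2 (i, k) \<alpha> \<mu>" for i k \<alpha> \<mu>
    unfolding dot1_matrix by (simp add: h2_def hm_def)
  have "bel_robinson g W \<alpha> \<mu> \<beta> \<nu> = (\<Sum>i\<in>UNIV. \<Sum>j\<in>UNIV. (Q i j / 2) * (\<Sum>k\<in>UNIV. \<Sum>l\<in>UNIV. (cnj (Q k l) / 2) *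
       ((2 * h2 (i, k) \<alpha> \<mu>) * (2 * h2 (j, l) \<beta> \<nu>))))"
    unfolding bel_robinson_def Let_def l r
    by (simp only: dot2_sum_left dot2_scale_left dot2_sum_right dot2_scale_right dot2_product d)
  also have "\<dots> = (\<Sum>i\<in>UNIV. \<Sum>j\<in>UNIV. \<Sum>k\<in>UNIV. \<Sum>l\<in>UNIV. Q i j * cnj (Q k l) * h2 (i, k) \<alpha> \<mu> * h2 (j, l) \<beta> \<nu>)"
    by (simp add: sum_distrib_left ac_simps)
  also have "\<dots> = (\<Sum>i\<in>UNIV. \<Sum>k\<in>UNIV. \<Sum>j\<in>UNIV. \<Sum>l\<in>UNIV. Q i j * cnj (Q k l) * h2 (i, k) \<alpha> \<mu> * h2 (j, l) \<beta> \<nu>)"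
    by (rule sum.cong[OF refl]) (rule sum.swap)
  also have "\<dots> = tensor_sum h2 (kron Q (\<lambda>k l. cnj (Q k l))) \<alpha> \<mu> \<beta> \<nu>"
    by (simp add: tensor_sum_def sum_UNIV_prod kron_def)
  finally show "bel_robinson g W \<alpha> \<mu> \<beta> \<nu> = \<dots>" .
qed

lemma bel_robinson_traces:
  assumes T: "T = tensor_sum h2 (kron Q (\<lambda>k l. cnj (Q k l)))"
  shows "trace4 g (comp4 g T T) =
      (\<Sum>i\<in>UNIV. \<Sum>k\<in>UNIV. Q i k * Q k i) * cnj (\<Sum>i\<in>UNIV. \<Sum>k\<in>UNIV. Q i k * Q k i)"
    "trace4 g (comp4 g (comp4 g T T) T) =
      (\<Sum>i\<in>UNIV. \<Sum>k\<in>UNIV. \<Sum>l\<in>UNIV. Q i k * Q k l * Q l i) *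
      cnj (\<Sum>i\<in>UNIV. \<Sum>k\<in>UNIV. \<Sum>l\<in>UNIV. Q i k * Q k l * Q l i)"
proof -
  have 2: "comp4 g T T = tensor_sum h2 (kron (\<lambda>i j. \<Sum>k\<in>UNIV. Q i k * Q k j) (\<lambda>i j. \<Sum>k\<in>UNIV. cnj (Q i k) * cnj (Q k j)))"
    unfolding T comp4_tensor_sum[of g h2, OF h2_orthonormal] kron_mult ..
  show "trace4 g (comp4 g T T) =
      (\<Sum>i\<in>UNIV. \<Sum>k\<in>UNIV. Q i k * Q k i) * cnj (\<Sum>i\<in>UNIV. \<Sum>k\<in>UNIV. Q i k * Q k i)"
    unfolding 2 trace4_tensor_sum[of g h2, OF h2_orthonormal] kron_trace by simp
  have "(\<Sum>i\<in>UNIV. \<Sum>l\<in>UNIV. (\<Sum>k\<in>UNIV. q i k * q k l) * q l i) = (\<Sum>i\<in>UNIV. \<Sum>k\<in>UNIV. \<Sum>l\<in>UNIV. q i k * q k l * q l i)"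
    for q :: "3 \<Rightarrow> 3 \<Rightarrow> complex"
    unfolding sum_distrib_right by (rule sum.cong[OF refl]) (rule sum.swap)
  note tr = this
  show "trace4 g (comp4 g (comp4 g T T) T) =
      (\<Sum>i\<in>UNIV. \<Sum>k\<in>UNIV. \<Sum>l\<in>UNIV. Q i k * Q k l * Q l i) *
      cnj (\<Sum>i\<in>UNIV. \<Sum>k\<in>UNIV. \<Sum>l\<in>UNIV. Q i k * Q k l * Q l i)"
    unfolding 2 unfolding T comp4_tensor_sum[of g h2, OF h2_orthonormal] kron_mult
      trace4_tensor_sum[of g h2, OF h2_orthonormal] kron_trace tr by simp
qed

text \<open>On \<open>h2 (i, k)\<close> the eigenvalue of T/t is a cube root of unity, equal to 1
  only for i = k, and the averaged powers project onto that eigenspace.\<close>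

lemma tensor_A_triple:
  assumes T: "T = tensor_sum h2 (kron (\<lambda>i j. if i = j then ev i else 0) (\<lambda>k l. cnj (if k = l then ev k else 0)))"
    and ev: "ev 1 = c" "ev 2 = c * w" "ev 3 = c * w^2" and c: "c * cnj c = of_real t" "t \<noteq> 0"
    and w: "1 + w + w^2 = 0" "cnj w = w^2"
  shows "tensor_A g t T = (\<lambda>\<alpha> \<beta> \<mu> \<nu>. h2 (1, 1) \<alpha> \<beta> * h2 (1, 1) \<mu> \<nu> + h2 (2, 2) \<alpha> \<beta> * h2 (2, 2) \<mu> \<nu>
       + h2 (3, 3) \<alpha> \<beta> * h2 (3, 3) \<mu> \<nu>)"
proof -
  define diag :: "(3 \<Rightarrow> complex) \<Rightarrow> 3 \<Rightarrow> 3 \<Rightarrow> complex" where "diag p i j = (if i = j then p i else 0)" for p i j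
  have dm: "(\<lambda>i j. \<Sum>k\<in>UNIV. diag p i k * diag q k j) = diag (\<lambda>i. p i * q i)" for p q
  proof (intro ext)
    fix i j
    have "diag p i k * diag q k j = (if i = k then diag (\<lambda>i. p i * q i) k j else 0)" for k
      by (simp add: diag_def)
    then show "(\<Sum>k\<in>UNIV. diag p i k * diag q k j) = diag (\<lambda>i. p i * q i) i j"
      by (simp add: sum.delta')
  qed
  have td: "tensor_sum h2 (kron (diag p) (diag q)) \<alpha> \<beta> \<mu> \<nu> = (\<Sum>I\<in>UNIV. (p (fst I) * q (snd I)) * (h2 I \<alpha> \<beta> * h2 I \<mu> \<nu>))"
    for p q \<alpha> \<beta> \<mu> \<nu>
  proof -
    have "kron (diag p) (diag q) I J = (if I = J then p (fst I) * q (snd I) else 0)" for I J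
      by (cases I; cases J) (auto simp: kron_def diag_def)
    then have "kron (diag p) (diag q) I J * h2 I \<alpha> \<beta> * h2 J \<mu> \<nu> =
        (if I = J then p (fst I) * q (snd I) * (h2 I \<alpha> \<beta> * h2 I \<mu> \<nu>) else 0)" for I J
      by simp
    then show ?thesis by (simp add: tensor_sum_def sum.delta')
  qed
  define e where "e i = cnj (ev i)" for i
  have T1: "T = tensor_sum h2 (kron (diag ev) (diag e))"
    unfolding T by (rule arg_cong[of _ _ "tensor_sum h2"], rule arg_cong2[of _ _ _ _ kron]) (auto simp: diag_def e_def fun_eq_iff)
  have T2: "comp4 g T T = tensor_sum h2 (kron (diag (\<lambda>i. ev i * ev i)) (diag (\<lambda>i. e i * e i)))"
    unfolding T1 comp4_tensor_sum[of g h2, OF h2_orthonormal] kron_mult dm ..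
  have T3: "comp4 g (comp4 g T T) T = tensor_sum h2 (kron (diag (\<lambda>i. ev i * ev i * ev i)) (diag (\<lambda>i. e i * e i * e i)))"
    unfolding T2 unfolding T1 comp4_tensor_sum[of g h2, OF h2_orthonormal] kron_mult dm ..
  \<comment> \<open>The eigenvalue of T/t; since c times its conjugate is t, it equals
    w^(i-k).\<close>
  define q where "q i k = ev i * e k / of_real t" for i k
  have co: "1 / of_real t * (ev i * e k) + 1 / of_real (t^2) * (ev i * ev i * (e k * e k))
      + 1 / of_real (t^3) * (ev i * ev i * ev i * (e k * e k * e k)) = q i k + q i k ^ 2 + q i k ^ 3" for i k
    by (simp add: q_def power2_eq_square power3_eq_cube mult_ac)
  have w3: "w ^ 3 = 1" using w(1) by algebra
  have w4: "w ^ 4 = w" using w3 by (simp add: eval_nat_numeral)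
  have w6: "w ^ 6 = 1" using w3 by (metis mult_2 numeral_Bit0 power_add power_one_right mult.right_neutral)
  have tc: "of_real t = c * cnj c" "c \<noteq> 0" using c by auto
  have qv: "q i k + q i k ^ 2 + q i k ^ 3 = (if i = k then 3 else 0)" for i k
  proof -
    have cw: "cnj (w^2) = w" by (simp add: w(2) w4 flip: power_mult)
    have ww: "w^2 * w^2 = w" "w * w^2 = 1" "w^2 * w = 1"
      using w3 w4 by (simp_all add: eval_nat_numeral ac_simps)
    have "q 1 1 = 1" "q 1 2 = w^2" "q 1 3 = w" "q 2 1 = w" "q 2 2 = 1" "q 2 3 = w * w"
      "q 3 1 = w^2" "q 3 2 = w" "q 3 3 = 1"
      using tc(2) by (simp_all add: q_def e_def ev tc(1) w(2) w4 cw ww del: complex_cnj_power)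
    moreover have "(w * w)^2 = w" "(w * w)^3 = 1" "(w^2)^2 = w" "(w^2)^3 = 1"
      by (simp_all add: w4 w6 flip: power_mult power2_eq_square)
    ultimately show ?thesis
      using exhaust_3[of i] exhaust_3[of k] w(1) w3
      by (elim disjE) (simp_all add: power2_eq_square[symmetric] ac_simps)
  qed
  show ?thesis
  proof (intro ext)
    fix \<alpha> \<beta> \<mu> \<nu>
    have "tensor_A g t T \<alpha> \<beta> \<mu> \<nu> = (1/3) * (\<Sum>I\<in>UNIV. (q (fst I) (snd I) + q (fst I) (snd I) ^ 2 + q (fst I) (snd I) ^ 3) * (h2 I \<alpha> \<beta> * h2 I \<mu> \<nu>))"
      unfolding tensor_A_def fun_cong[OF fun_cong[OF fun_cong[OF fun_cong[OF T3]]]]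
        fun_cong[OF fun_cong[OF fun_cong[OF fun_cong[OF T2]]]]
        fun_cong[OF fun_cong[OF fun_cong[OF fun_cong[OF T1]]]] td co[symmetric]
      by (simp only: sum_distrib_left distrib_right sum.distrib mult.assoc)
    also have "\<dots> = h2 (1, 1) \<alpha> \<beta> * h2 (1, 1) \<mu> \<nu> + h2 (2, 2) \<alpha> \<beta> * h2 (2, 2) \<mu> \<nu>
       + h2 (3, 3) \<alpha> \<beta> * h2 (3, 3) \<mu> \<nu>"
      unfolding qv sum_UNIV_prod sum_3 by (simp add: distrib_left[symmetric] del: distrib_left_numeral)
    finally show "tensor_A g t T \<alpha> \<beta> \<mu> \<nu> = \<dots>" .
  qed
qed

text \<open>The product splits into \<open>Y i ** Y j\<close> and its conjugate. For distinct labels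
  the handedness enters twice and cancels, so both orders agree; for equal labels the two factors -1
  cancel.\<close>

lemma h2_dot1:
  "dot1 g (h2 (i, i) \<alpha>) (h2 (i, i) \<beta>) = of_real (g $ \<alpha> $ \<beta>) / 4"
  "dot1 g (h2 (1, 1) \<alpha>) (h2 (2, 2) \<beta>) = - (1/2) * h2 (3, 3) \<alpha> \<beta>"
  "dot1 g (h2 (2, 2) \<alpha>) (h2 (1, 1) \<beta>) = - (1/2) * h2 (3, 3) \<alpha> \<beta>"
  "dot1 g (h2 (2, 2) \<alpha>) (h2 (3, 3) \<beta>) = - (1/2) * h2 (1, 1) \<alpha> \<beta>"
  "dot1 g (h2 (3, 3) \<alpha>) (h2 (2, 2) \<beta>) = - (1/2) * h2 (1, 1) \<alpha> \<beta>"
  "dot1 g (h2 (3, 3) \<alpha>) (h2 (1, 1) \<beta>) = - (1/2) * h2 (2, 2) \<alpha> \<beta>"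
  "dot1 g (h2 (1, 1) \<alpha>) (h2 (3, 3) \<beta>) = - (1/2) * h2 (2, 2) \<alpha> \<beta>"
proof -
  have p: "(hm i i ** G) ** (hm j j ** G) = cscale (1/4) (Y i ** Y j ** (Yc i ** Yc j))" for i j
    by (simp add: hm_G cscale_mult_left cscale_mult_right cscale_cscale matrix_mul_assoc Y_Yc_flip)
  have d: "dot1 g (h2 (i, i) \<alpha>) (h2 (j, j) \<beta>) = (hm i i ** G ** hm j j) $ \<alpha> $ \<beta>" for i j \<alpha> \<beta>
    unfolding h2_def fst_conv snd_conv dot1_matrix hm_transpose ..
  have Ycc: "Yc i ** Yc j = cnjm (Y i ** Y j)" for i j by (simp add: cnjm_mult cnjm_Y)
  have "hm i i ** G ** hm i i = cscale (1/4) (cmat g)"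
    by (rule matrix_G_cancel) (use p[of i i] in \<open>simp add: matrix_mul_assoc[symmetric] cscale_mult_left gG Ycc Y_sq
        cnjm_uminus matrix_mult_uminus_left matrix_mult_uminus_right cnjm_cmat[of "mat 1", unfolded cmat_mat_1]\<close>)
  then show "dot1 g (h2 (i, i) \<alpha>) (h2 (i, i) \<beta>) = of_real (g $ \<alpha> $ \<beta>) / 4"
    unfolding d by (simp add: cmat_def)
  have *: "dot1 g (h2 (i, i) \<alpha>) (h2 (j, j) \<beta>) = - (1/2) * h2 (k, k) \<alpha> \<beta>"
    if "Y i ** Y j = cscale e (Y k)" "cnj e * e = 1" for i j k e
  proof -
    have "hm i i ** G ** hm j j = cscale (-1/2) (hm k k)"
    proof (rule matrix_G_cancel)
      have "hm i i ** G ** hm j j ** G = cscale (1/4) (cscale (cnj e * e) (Y k ** Yc k))"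
        using p[of i j] by (simp add: matrix_mul_assoc that(1) Ycc cnjm_cscale cscale_mult_left cscale_mult_right cscale_cscale cnjm_Y)
      then show "hm i i ** G ** hm j j ** G = cscale (-1/2) (hm k k) ** G"
        by (simp add: that(2) cscale_mult_left hm_G cscale_cscale)
    qed
    then show ?thesis unfolding d by (simp add: h2_def)
  qed
  have dd: "cnj (complex_of_real d) * of_real d = 1" "cnj (complex_of_real (- d)) * of_real (- d) = 1"
    using d_cases by auto
  show "dot1 g (h2 (1, 1) \<alpha>) (h2 (2, 2) \<beta>) = - (1/2) * h2 (3, 3) \<alpha> \<beta>"
    "dot1 g (h2 (2, 2) \<alpha>) (h2 (3, 3) \<beta>) = - (1/2) * h2 (1, 1) \<alpha> \<beta>"
    "dot1 g (h2 (3, 3) \<alpha>) (h2 (1, 1) \<beta>) = - (1/2) * h2 (2, 2) \<alpha> \<beta>"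
    by (rule *[OF _ dd(1)], rule Y_cyclic)+
  show "dot1 g (h2 (2, 2) \<alpha>) (h2 (1, 1) \<beta>) = - (1/2) * h2 (3, 3) \<alpha> \<beta>"
    "dot1 g (h2 (3, 3) \<alpha>) (h2 (2, 2) \<beta>) = - (1/2) * h2 (1, 1) \<alpha> \<beta>"
    "dot1 g (h2 (1, 1) \<alpha>) (h2 (3, 3) \<beta>) = - (1/2) * h2 (2, 2) \<alpha> \<beta>"
    by (rule *[OF _ dd(2)], use Y_anticyclic in simp)+
qed

lemma h2_real: "cnj (h2 (i, i) \<alpha> \<beta>) = h2 (i, i) \<alpha> \<beta>"
  using arg_cong[OF cnjm_hm_diag[of i], of "\<lambda>M. M $ \<alpha> $ \<beta>"] by (simp add: h2_def cnjm_def)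

text \<open>The conjugate factors meet and square to -1, while \<open>Y i\<close> commutes with
  \<open>Y k\<close> if k = i and anticommutes otherwise.\<close>

lemma hm_sandwich: "hm i i ** G ** y k ** G ** hm i i = cscale (if k = i then 1/4 else -1/4) (y k)"
proof (rule matrix_G_cancel)
  have YY: "A ** Yc l ** Yc l = - A" for A l
  proof -
    have "Yc l ** Yc l = - mat 1"
      using arg_cong[OF Y_sq[of l], of cnjm] by (simp add: cnjm_mult cnjm_Y cnjm_uminus cnjm_cmat[of "mat 1", unfolded cmat_mat_1])
    then show ?thesis by (simp add: matrix_mul_assoc[symmetric] matrix_mult_uminus_right)
  qed
  have 1: "hm i i ** G ** y k ** G ** hm i i ** G = cscale (-1/4) (Y i ** Y k ** Y i)"
  proof -
    have "hm i i ** G ** y k ** G ** hm i i ** G = (hm i i ** G) ** Y k ** (hm i i ** G)"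
      by (simp add: Y_def matrix_mul_assoc)
    also have "\<dots> = cscale (1/4) (Y i ** Y k ** Y i ** Yc i ** Yc i)"
      by (simp add: hm_G cscale_mult_left cscale_mult_right cscale_cscale matrix_mul_assoc Y_Yc_flip)
    finally show ?thesis by (simp add: YY cscale_uminus)
  qed
  have 2: "Y i ** Y k ** Y i = cscale (if k = i then -1 else 1) (Y k)"
  proof (cases "k = i")
    case True
    then show ?thesis by (simp add: Y_sq matrix_mult_uminus_left vec_eq_iff)
  next
    case False
    then obtain m e where "Y k ** Y i = cscale e (Y m)" "Y i ** Y k = cscale (- e) (Y m)" 
      by (rule Y_distinct)
    then have "Y i ** Y k = - (Y k ** Y i)" by (simp add: cscale_uminus)
    then have "Y i ** Y k ** Y i = - (Y k ** (Y i ** Y i))"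
      by (simp add: matrix_mult_uminus_left matrix_mul_assoc)
    then show ?thesis using False by (simp add: Y_sq matrix_mult_uminus_right)
  qed
  show "hm i i ** G ** y k ** G ** hm i i ** G = cscale (if k = i then 1/4 else -1/4) (y k) ** G"
    unfolding 1 2 by (simp add: cscale_mult_left Y_def[symmetric] cscale_cscale)
qed

lemma dot2_sandwich:
  "dot2 g (\<lambda>\<alpha> \<beta>. P $ \<alpha> $ \<beta>) (\<lambda>\<alpha> \<beta>. U $ \<alpha> $ \<mu> * V $ \<beta> $ \<nu>) = (transpose U ** G ** P ** G ** V) $ \<mu> $ \<nu>"
proof -
  have "(transpose U ** G ** P ** G ** V) $ \<mu> $ \<nu> = ((transpose U ** G) ** (P ** (G ** V))) $ \<mu> $ \<nu>"
    by (simp add: matrix_mul_assoc)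
  also have "\<dots> = (\<Sum>\<alpha>\<in>UNIV. \<Sum>\<beta>\<in>UNIV. \<Sum>\<beta>'\<in>UNIV. \<Sum>\<alpha>'\<in>UNIV.
      U $ \<alpha>' $ \<mu> * G $ \<alpha>' $ \<alpha> * (P $ \<alpha> $ \<beta> * (G $ \<beta> $ \<beta>' * V $ \<beta>' $ \<nu>)))"
    by (simp add: matrix_matrix_mult_def transpose_def sum_distrib_left sum_distrib_right)
  also have "\<dots> = (\<Sum>\<alpha>\<in>UNIV. \<Sum>\<beta>\<in>UNIV. \<Sum>\<alpha>'\<in>UNIV. \<Sum>\<beta>'\<in>UNIV.
      U $ \<alpha>' $ \<mu> * G $ \<alpha>' $ \<alpha> * (P $ \<alpha> $ \<beta> * (G $ \<beta> $ \<beta>' * V $ \<beta>' $ \<nu>)))"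
    by (rule sum.cong[OF refl], rule sum.cong[OF refl]) (rule sum.swap)
  also have "\<dots> = dot2 g (\<lambda>\<alpha> \<beta>. P $ \<alpha> $ \<beta>) (\<lambda>\<alpha> \<beta>. U $ \<alpha> $ \<mu> * V $ \<beta> $ \<nu>)"
    unfolding dot2_def by (intro sum.cong refl) (simp add: cmat_def ginv_sym[OF lor] ac_simps)
  finally show ?thesis by simp
qed

text \<open>By \<open>hm_sandwich\<close> the contraction of \<open>tensor_J H\<close> with
  \<open>y k\<close> has coefficient 2 \<open>h k\<close> minus the sum of all \<open>h i\<close>.
  For weights of sum zero, antisymmetrizing thus undoes the passage from \<open>y k\<close> to
  \<open>h2 (k, k)\<close>.\<close>

lemma self_dual_tensor_J:
  assumes H: "\<And>\<alpha> \<beta> \<mu> \<nu>. H \<alpha> \<beta> \<mu> \<nu> = (\<Sum>i\<in>UNIV. h i * h2 (i, i) \<alpha> \<beta> * h2 (i, i) \<mu> \<nu>)"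
    and h: "(\<Sum>i\<in>UNIV. h i) = 0"
  shows "self_dual g (\<lambda>\<alpha> \<beta> \<mu> \<nu>. a * tensor_J H \<alpha> \<beta> \<mu> \<nu>) \<alpha> \<beta> \<mu> \<nu> =
     a * ((1/2) * (\<Sum>k\<in>UNIV. h k * y k $ \<alpha> $ \<beta> * y k $ \<mu> $ \<nu>))"
proof -
  have d: "dot2 g (\<lambda>\<rho> \<sigma>. y k $ \<rho> $ \<sigma>) (\<lambda>\<rho> \<sigma>. a * tensor_J H \<rho> \<sigma> \<mu> \<nu>) = a * (2 * h k) * y k $ \<mu> $ \<nu>" for k
  proof -
    have J: "(\<lambda>\<rho> \<sigma>. a * tensor_J H \<rho> \<sigma> \<mu> \<nu>) = (\<lambda>\<rho> \<sigma>. \<Sum>i\<in>UNIV. (2 * a * h i) * (hm i i $ \<rho> $ \<mu> * hm i i $ \<sigma> $ \<nu>)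
       + (- 2 * a * h i) * (hm i i $ \<rho> $ \<nu> * hm i i $ \<sigma> $ \<mu>))"
      by (simp add: tensor_J_def H h2_def sum_subtractf sum_distrib_left sum.distrib algebra_simps sum_negf)
    have "dot2 g (\<lambda>\<rho> \<sigma>. y k $ \<rho> $ \<sigma>) (\<lambda>\<rho> \<sigma>. a * tensor_J H \<rho> \<sigma> \<mu> \<nu>) =
       (\<Sum>i\<in>UNIV. (2 * a * h i) * ((if k = i then 1/4 else -1/4) * y k $ \<mu> $ \<nu>)
          + (- 2 * a * h i) * ((if k = i then 1/4 else -1/4) * y k $ \<nu> $ \<mu>))"
      unfolding J by (simp only: dot2_sum_right dot2_add_right dot2_scale_right dot2_sandwich hm_transpose hm_sandwich cscale_nth)
    also have "\<dots> = (\<Sum>i\<in>UNIV. a * y k $ \<mu> $ \<nu> * ((if k = i then 2 * h i else 0) - h i))"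
      unfolding y_antisym_nth[of k \<nu> \<mu>] by (intro sum.cong refl) (simp add: field_simps)
    also have "\<dots> = a * (2 * h k) * y k $ \<mu> $ \<nu>"
      unfolding sum_distrib_left[symmetric] sum_subtractf h by simp
    finally show ?thesis .
  qed
  have "self_dual g (\<lambda>\<alpha> \<beta> \<mu> \<nu>. a * tensor_J H \<alpha> \<beta> \<mu> \<nu>) \<alpha> \<beta> \<mu> \<nu> =
     (1/4) * (\<Sum>k\<in>UNIV. y k $ \<alpha> $ \<beta> * dot2 g (\<lambda>\<rho> \<sigma>. y k $ \<rho> $ \<sigma>) (\<lambda>\<rho> \<sigma>. a * tensor_J H \<rho> \<sigma> \<mu> \<nu>))"
    by (rule self_dual_triple[OF lor tri]) (simp add: tensor_J_def H algebra_simps)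
  then show ?thesis unfolding d by (simp add: sum_distrib_left ac_simps)
qed

end

subsection \<open>The concomitants of the theorem\<close>

text \<open>The product table is all that the formulas of the theorem see of the three tensors;
  \<open>X\<close> enters only through the numbers \<open>x1\<close>, \<open>x2\<close>,
  \<open>x3\<close>.\<close>

locale concomitants =
  fixes g :: "real^4^4" and H1 H2 H3 :: "complex tensor2" and X :: "complex tensor2"
  assumes dot1_same: "dot1 g (H1 \<alpha>) (H1 \<beta>) = of_real (g $ \<alpha> $ \<beta>) / 4"
      "dot1 g (H2 \<alpha>) (H2 \<beta>) = of_real (g $ \<alpha> $ \<beta>) / 4"
      "dot1 g (H3 \<alpha>) (H3 \<beta>) = of_real (g $ \<alpha> $ \<beta>) / 4"
    and dot1_distinct: "dot1 g (H1 \<alpha>) (H2 \<beta>) = - (1/2) * H3 \<alpha> \<beta>"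
      "dot1 g (H2 \<alpha>) (H1 \<beta>) = - (1/2) * H3 \<alpha> \<beta>"
      "dot1 g (H2 \<alpha>) (H3 \<beta>) = - (1/2) * H1 \<alpha> \<beta>"
      "dot1 g (H3 \<alpha>) (H2 \<beta>) = - (1/2) * H1 \<alpha> \<beta>"
      "dot1 g (H3 \<alpha>) (H1 \<beta>) = - (1/2) * H2 \<alpha> \<beta>"
      "dot1 g (H1 \<alpha>) (H3 \<beta>) = - (1/2) * H2 \<alpha> \<beta>"
begin

definition "x1 = dot2 g H1 X"
definition "x2 = dot2 g H2 X"
definition "x3 = dot2 g H3 X"

definition A :: "complex tensor4" where
  "A \<alpha> \<beta> = (\<lambda>\<mu> \<nu>. H1 \<alpha> \<beta> * H1 \<mu> \<nu> + H2 \<alpha> \<beta> * H2 \<mu> \<nu> + H3 \<alpha> \<beta> * H3 \<mu> \<nu>)"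

lemma A_apply: "A \<alpha> \<beta> \<mu> = (\<lambda>\<nu>. H1 \<alpha> \<beta> * H1 \<mu> \<nu> + H2 \<alpha> \<beta> * H2 \<mu> \<nu> + H3 \<alpha> \<beta> * H3 \<mu> \<nu>)"
  by (simp add: A_def)

lemmas dot1_rules = dot1_add_left dot1_add_right dot1_scale_left dot1_scale_right dot1_same dot1_distinct
lemmas dot2_rules = dot2_add_left dot2_scale_left x1_def[symmetric] x2_def[symmetric] x3_def[symmetric]

text \<open>Products with equal labels add up to half of \<open>A\<close> times the metric, which is
  the term subtracted; the six products with distinct labels remain.\<close>

lemma B_eq: "tensor_B g A \<alpha> \<beta> \<gamma> \<delta> \<kappa> \<mu> =
    (- (H1 \<alpha> \<beta> * H2 \<gamma> \<delta> + H2 \<alpha> \<beta> * H1 \<gamma> \<delta>)) * H3 \<kappa> \<mu>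
  + (- (H2 \<alpha> \<beta> * H3 \<gamma> \<delta> + H3 \<alpha> \<beta> * H2 \<gamma> \<delta>)) * H1 \<kappa> \<mu>
  + (- (H3 \<alpha> \<beta> * H1 \<gamma> \<delta> + H1 \<alpha> \<beta> * H3 \<gamma> \<delta>)) * H2 \<kappa> \<mu>"
  unfolding tensor_B_def A_apply dot1_rules by (simp add: field_simps)

lemma BX_eq: "contr6 g (tensor_B g A) X \<alpha> \<beta> \<gamma> \<delta> =
    (- (H2 \<alpha> \<beta> * x3 + H3 \<alpha> \<beta> * x2)) * H1 \<gamma> \<delta>
  + (- (H1 \<alpha> \<beta> * x3 + H3 \<alpha> \<beta> * x1)) * H2 \<gamma> \<delta>
  + (- (H1 \<alpha> \<beta> * x2 + H2 \<alpha> \<beta> * x1)) * H3 \<gamma> \<delta>"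
proof -
  have "tensor_B g A \<alpha> \<beta> \<gamma> \<delta> = (\<lambda>\<kappa> \<mu>. (- (H1 \<alpha> \<beta> * H2 \<gamma> \<delta> + H2 \<alpha> \<beta> * H1 \<gamma> \<delta>)) * H3 \<kappa> \<mu>
    + (- (H2 \<alpha> \<beta> * H3 \<gamma> \<delta> + H3 \<alpha> \<beta> * H2 \<gamma> \<delta>)) * H1 \<kappa> \<mu>
    + (- (H3 \<alpha> \<beta> * H1 \<gamma> \<delta> + H1 \<alpha> \<beta> * H3 \<gamma> \<delta>)) * H2 \<kappa> \<mu>)"
    by (intro ext) (rule B_eq)
  then show ?thesis
    unfolding contr6_def contr4_def by (simp only: dot2_rules) (simp add: algebra_simps)
qed

lemma BXX_eq: "contr4 g (contr6 g (tensor_B g A) X) X \<alpha> \<beta> =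
    (-2 * x2 * x3) * H1 \<alpha> \<beta> + (-2 * x1 * x3) * H2 \<alpha> \<beta> + (-2 * x1 * x2) * H3 \<alpha> \<beta>"
proof -
  have "contr6 g (tensor_B g A) X \<alpha> \<beta> = (\<lambda>\<gamma> \<delta>. (- (H2 \<alpha> \<beta> * x3 + H3 \<alpha> \<beta> * x2)) * H1 \<gamma> \<delta>
    + (- (H1 \<alpha> \<beta> * x3 + H3 \<alpha> \<beta> * x1)) * H2 \<gamma> \<delta>
    + (- (H1 \<alpha> \<beta> * x2 + H2 \<alpha> \<beta> * x1)) * H3 \<gamma> \<delta>)"
    by (intro ext) (rule BX_eq)
  then show ?thesis
    unfolding contr4_def by (simp only: dot2_rules) (simp add: algebra_simps)
qed

lemma beta_eq: "scalar_\<beta> g A X = - (x1 * x2 * x3)"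
proof -
  have "contr4 g (contr6 g (tensor_B g A) X) X = (\<lambda>\<alpha> \<beta>. (-2 * x2 * x3) * H1 \<alpha> \<beta>
     + (-2 * x1 * x3) * H2 \<alpha> \<beta> + (-2 * x1 * x2) * H3 \<alpha> \<beta>)"
    by (intro ext) (rule BXX_eq)
  then show ?thesis
    unfolding scalar_\<beta>_def by (simp only: dot2_rules) simp
qed

lemma AX_eq: "contr4 g A X \<alpha> \<beta> = x1 * H1 \<alpha> \<beta> + x2 * H2 \<alpha> \<beta> + x3 * H3 \<alpha> \<beta>"
  unfolding contr4_def A_def by (simp only: dot2_rules) (simp add: algebra_simps)

lemma alpha_eq: "scalar_\<alpha> g A X = (x1^2 + x2^2 + x3^2) / 3"
proof -
  have "contr4 g A X = (\<lambda>\<alpha> \<beta>. x1 * H1 \<alpha> \<beta> + x2 * H2 \<alpha> \<beta> + x3 * H3 \<alpha> \<beta>)"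
    by (intro ext) (rule AX_eq)
  then show ?thesis
    unfolding scalar_\<alpha>_def by (simp only: dot2_rules) (simp add: power2_eq_square)
qed

text \<open>The same cancellation occurs once more, \<open>B\<close> being symmetric in its index
  pairs. In each surviving term two distinct labels occur twice, so four contractions give products
  of two squares.\<close>

lemma C_eq: "tensor_C g A \<alpha> \<beta> \<nu> \<rho> \<gamma> \<delta> \<kappa> \<mu> =
    ((H1 \<alpha> \<beta> * H2 \<nu> \<rho> + H2 \<alpha> \<beta> * H1 \<nu> \<rho>) * H2 \<gamma> \<delta> + (H1 \<alpha> \<beta> * H3 \<nu> \<rho> + H3 \<alpha> \<beta> * H1 \<nu> \<rho>) * H3 \<gamma> \<delta>) * H1 \<kappa> \<mu>
  + ((H1 \<alpha> \<beta> * H2 \<nu> \<rho> + H2 \<alpha> \<beta> * H1 \<nu> \<rho>) * H1 \<gamma> \<delta> + (H2 \<alpha> \<beta> * H3 \<nu> \<rho> + H3 \<alpha> \<beta> * H2 \<nu> \<rho>) * H3 \<gamma> \<delta>) * H2 \<kappa> \<mu>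
  + ((H1 \<alpha> \<beta> * H3 \<nu> \<rho> + H3 \<alpha> \<beta> * H1 \<nu> \<rho>) * H1 \<gamma> \<delta> + (H2 \<alpha> \<beta> * H3 \<nu> \<rho> + H3 \<alpha> \<beta> * H2 \<nu> \<rho>) * H2 \<gamma> \<delta>) * H3 \<kappa> \<mu>"
proof -
  have "tensor_B g A \<gamma> \<delta> \<kappa> \<mu> \<rho> = (\<lambda>\<epsilon>.
      (- (H1 \<gamma> \<delta> * H2 \<kappa> \<mu> + H2 \<gamma> \<delta> * H1 \<kappa> \<mu>)) * H3 \<rho> \<epsilon>
    + (- (H2 \<gamma> \<delta> * H3 \<kappa> \<mu> + H3 \<gamma> \<delta> * H2 \<kappa> \<mu>)) * H1 \<rho> \<epsilon>
    + (- (H3 \<gamma> \<delta> * H1 \<kappa> \<mu> + H1 \<gamma> \<delta> * H3 \<kappa> \<mu>)) * H2 \<rho> \<epsilon>)"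
    by (intro ext) (rule B_eq)
  then show ?thesis
    unfolding tensor_C_def A_apply B_eq by (simp only: dot1_rules) (simp add: field_simps)
qed

lemma CX_eq: "contr8 g (tensor_C g A) X \<alpha> \<beta> \<nu> \<rho> \<gamma> \<delta> =
    ((H1 \<alpha> \<beta> * H2 \<nu> \<rho> + H2 \<alpha> \<beta> * H1 \<nu> \<rho>) * x2 + (H1 \<alpha> \<beta> * H3 \<nu> \<rho> + H3 \<alpha> \<beta> * H1 \<nu> \<rho>) * x3) * H1 \<gamma> \<delta>
  + ((H1 \<alpha> \<beta> * H2 \<nu> \<rho> + H2 \<alpha> \<beta> * H1 \<nu> \<rho>) * x1 + (H2 \<alpha> \<beta> * H3 \<nu> \<rho> + H3 \<alpha> \<beta> * H2 \<nu> \<rho>) * x3) * H2 \<gamma> \<delta>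
  + ((H1 \<alpha> \<beta> * H3 \<nu> \<rho> + H3 \<alpha> \<beta> * H1 \<nu> \<rho>) * x1 + (H2 \<alpha> \<beta> * H3 \<nu> \<rho> + H3 \<alpha> \<beta> * H2 \<nu> \<rho>) * x2) * H3 \<gamma> \<delta>"
proof -
  have "tensor_C g A \<alpha> \<beta> \<nu> \<rho> \<gamma> \<delta> = (\<lambda>\<kappa> \<mu>.
    ((H1 \<alpha> \<beta> * H2 \<nu> \<rho> + H2 \<alpha> \<beta> * H1 \<nu> \<rho>) * H2 \<gamma> \<delta> + (H1 \<alpha> \<beta> * H3 \<nu> \<rho> + H3 \<alpha> \<beta> * H1 \<nu> \<rho>) * H3 \<gamma> \<delta>) * H1 \<kappa> \<mu>
  + ((H1 \<alpha> \<beta> * H2 \<nu> \<rho> + H2 \<alpha> \<beta> * H1 \<nu> \<rho>) * H1 \<gamma> \<delta> + (H2 \<alpha> \<beta> * H3 \<nu> \<rho> + H3 \<alpha> \<beta> * H2 \<nu> \<rho>) * H3 \<gamma> \<delta>) * H2 \<kappa> \<mu>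
  + ((H1 \<alpha> \<beta> * H3 \<nu> \<rho> + H3 \<alpha> \<beta> * H1 \<nu> \<rho>) * H1 \<gamma> \<delta> + (H2 \<alpha> \<beta> * H3 \<nu> \<rho> + H3 \<alpha> \<beta> * H2 \<nu> \<rho>) * H2 \<gamma> \<delta>) * H3 \<kappa> \<mu>)"
    by (intro ext) (rule C_eq)
  then show ?thesis
    unfolding contr8_def contr6_def contr4_def by (simp only: dot2_rules) (simp add: algebra_simps)
qed

lemma CXX_eq: "contr6 g (contr8 g (tensor_C g A) X) X \<alpha> \<beta> \<nu> \<rho> =
    (2 * x1 * x2 * H2 \<alpha> \<beta> + 2 * x1 * x3 * H3 \<alpha> \<beta>) * H1 \<nu> \<rho>
  + (2 * x1 * x2 * H1 \<alpha> \<beta> + 2 * x2 * x3 * H3 \<alpha> \<beta>) * H2 \<nu> \<rho>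
  + (2 * x1 * x3 * H1 \<alpha> \<beta> + 2 * x2 * x3 * H2 \<alpha> \<beta>) * H3 \<nu> \<rho>"
proof -
  have "contr8 g (tensor_C g A) X \<alpha> \<beta> \<nu> \<rho> = (\<lambda>\<gamma> \<delta>.
    ((H1 \<alpha> \<beta> * H2 \<nu> \<rho> + H2 \<alpha> \<beta> * H1 \<nu> \<rho>) * x2 + (H1 \<alpha> \<beta> * H3 \<nu> \<rho> + H3 \<alpha> \<beta> * H1 \<nu> \<rho>) * x3) * H1 \<gamma> \<delta>
  + ((H1 \<alpha> \<beta> * H2 \<nu> \<rho> + H2 \<alpha> \<beta> * H1 \<nu> \<rho>) * x1 + (H2 \<alpha> \<beta> * H3 \<nu> \<rho> + H3 \<alpha> \<beta> * H2 \<nu> \<rho>) * x3) * H2 \<gamma> \<delta>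
  + ((H1 \<alpha> \<beta> * H3 \<nu> \<rho> + H3 \<alpha> \<beta> * H1 \<nu> \<rho>) * x1 + (H2 \<alpha> \<beta> * H3 \<nu> \<rho> + H3 \<alpha> \<beta> * H2 \<nu> \<rho>) * x2) * H3 \<gamma> \<delta>)"
    by (intro ext) (rule CX_eq)
  then show ?thesis
    unfolding contr6_def contr4_def by (simp only: dot2_rules) (simp add: algebra_simps)
qed

lemma gamma_eq: "scalar_\<gamma> g A X = (x1^2 * x2^2 + x2^2 * x3^2 + x3^2 * x1^2) / 3"
proof -
  have "contr6 g (contr8 g (tensor_C g A) X) X \<alpha> \<beta> = (\<lambda>\<nu> \<rho>.
    (2 * x1 * x2 * H2 \<alpha> \<beta> + 2 * x1 * x3 * H3 \<alpha> \<beta>) * H1 \<nu> \<rho>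
  + (2 * x1 * x2 * H1 \<alpha> \<beta> + 2 * x2 * x3 * H3 \<alpha> \<beta>) * H2 \<nu> \<rho>
  + (2 * x1 * x3 * H1 \<alpha> \<beta> + 2 * x2 * x3 * H2 \<alpha> \<beta>) * H3 \<nu> \<rho>)" for \<alpha> \<beta>
    by (intro ext) (rule CXX_eq)
  then have "contr4 g (contr6 g (contr8 g (tensor_C g A) X) X) X \<alpha> \<beta> =
     (2 * x1 * (x2^2 + x3^2)) * H1 \<alpha> \<beta> + (2 * x2 * (x1^2 + x3^2)) * H2 \<alpha> \<beta> + (2 * x3 * (x1^2 + x2^2)) * H3 \<alpha> \<beta>" for \<alpha> \<beta>
    unfolding contr4_def by (simp only: dot2_rules) (simp add: algebra_simps power2_eq_square)
  then have "contr4 g (contr6 g (contr8 g (tensor_C g A) X) X) X = (\<lambda>\<alpha> \<beta>.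
     (2 * x1 * (x2^2 + x3^2)) * H1 \<alpha> \<beta> + (2 * x2 * (x1^2 + x3^2)) * H2 \<alpha> \<beta> + (2 * x3 * (x1^2 + x2^2)) * H3 \<alpha> \<beta>)"
    by (intro ext)
  then show ?thesis
    unfolding scalar_\<gamma>_def by (simp only: dot2_rules) (simp add: field_simps power2_eq_square)
qed

text \<open>Half of \<open>C(X,X)\<close> is precisely the off-diagonal part of the square of
  \<open>A(X)\<close>, so only the diagonal is left.\<close>

lemma E_eq: "tensor_E g A X \<alpha> \<beta> \<mu> \<nu> =
    x1^2 * H1 \<alpha> \<beta> * H1 \<mu> \<nu> + x2^2 * H2 \<alpha> \<beta> * H2 \<mu> \<nu> + x3^2 * H3 \<alpha> \<beta> * H3 \<mu> \<nu>"
  unfolding tensor_E_def Let_def AX_eq CXX_eq by (simp add: field_simps power2_eq_square)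

text \<open>Off the diagonal the square of \<open>B(X,X)\<close> carries the factor x1 x2 x3, that
  is minus \<beta>, and \<open>B(X)\<close> supplies the cofactor that cancels it.\<close>

lemma I_eq: "tensor_I g A X \<alpha> \<beta> \<mu> \<nu> =
    x2^2 * x3^2 * H1 \<alpha> \<beta> * H1 \<mu> \<nu> + x1^2 * x3^2 * H2 \<alpha> \<beta> * H2 \<mu> \<nu> + x1^2 * x2^2 * H3 \<alpha> \<beta> * H3 \<mu> \<nu>"
  unfolding tensor_I_def Let_def BXX_eq BX_eq beta_eq by (simp add: field_simps power2_eq_square)

lemma H_eq:
  fixes \<Delta> w :: complex
  defines "a \<equiv> scalar_\<alpha> g A X" and "r \<equiv> scalar_r g A X"
  defines "k p q \<equiv> (- (a * w^3 + 2 * r * a^2 + r^2) + (w^3 + r * a) * p + r * q) / (2 * w * \<Delta>)"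
  shows "tensor_H g A X \<Delta> w \<alpha> \<beta> \<mu> \<nu> =
     k (x1^2) (x2^2 * x3^2) * H1 \<alpha> \<beta> * H1 \<mu> \<nu> + k (x2^2) (x1^2 * x3^2) * H2 \<alpha> \<beta> * H2 \<mu> \<nu>
     + k (x3^2) (x1^2 * x2^2) * H3 \<alpha> \<beta> * H3 \<mu> \<nu>"
proof -
  have Ae: "A \<alpha> \<beta> \<mu> \<nu> = H1 \<alpha> \<beta> * H1 \<mu> \<nu> + H2 \<alpha> \<beta> * H2 \<mu> \<nu> + H3 \<alpha> \<beta> * H3 \<mu> \<nu>"
    by (simp add: A_def)
  define n where "n = 1 / (2 * w * \<Delta>)"
  define b where "b = - (a * w^3 + 2 * r * a^2 + r^2)"
  define m where "m = w^3 + r * a"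
  have k: "k p q = n * (b + m * p + r * q)" for p q
    by (simp add: k_def n_def b_def m_def)
  show ?thesis
    unfolding tensor_H_def Let_def a_def[symmetric] r_def[symmetric] E_eq I_eq Ae k
      n_def[symmetric] b_def[symmetric] m_def[symmetric]
    by (simp add: algebra_simps)
qed

end

text \<open>For the cubic with roots \<open>p\<^sub>i - a\<close>, the Lagrange resolvents \<open>u\<close>, \<open>v\<close> are conjugate
  because the \<open>p\<^sub>i\<close> are real, so neither vanishes unless the roots coincide.\<close>

lemma cardano_weights:
  fixes p1 p2 p3 a r s w \<Delta> :: complex
  assumes real: "p1 \<in> \<real>" "p2 \<in> \<real>" "p3 \<in> \<real>" and w: "1 + w + w^2 = 0" "cnj w = w^2"
    and a: "a = (p1 + p2 + p3) / 3"
    and r: "r = (p1 * p2 + p2 * p3 + p3 * p1) / 3 - a^2"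
    and s: "s = (1/2) * (3 * a * ((p1 * p2 + p2 * p3 + p3 * p1) / 3) - p1 * p2 * p3) - a^3"
    and D: "\<Delta>^2 = s^2 + r^3" "\<Delta> \<noteq> 0"
  obtains e :: complex and u where "e \<in> {1, -1}" "u \<noteq> 0" "u^3 = - s + e * \<Delta>"
    "\<And>z. z^3 = - s + e * \<Delta> \<Longrightarrow> z \<noteq> 0 \<and> cmod z = cmod u \<and>
       (- (a * z^3 + 2 * r * a^2 + r^2) + (z^3 + r * a) * p1 + r * (p2 * p3)) / (2 * z * \<Delta>) = e * u / z \<and>
       (- (a * z^3 + 2 * r * a^2 + r^2) + (z^3 + r * a) * p2 + r * (p1 * p3)) / (2 * z * \<Delta>) = e * u / z * w \<and>
       (- (a * z^3 + 2 * r * a^2 + r^2) + (z^3 + r * a) * p3 + r * (p1 * p2)) / (2 * z * \<Delta>) = e * u / z * w^2"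
proof -
  define c where "c = (p1 * p2 + p2 * p3 + p3 * p1) / 3"
  note a_def = a and r_def = r[folded c_def] and s_def = s[folded c_def]
  \<comment> \<open>Discrete Fourier transform of the roots over the cube roots of unity;
    \<open>p\<close> below is its inversion, in which the i-th root is a + l u + l^2 v with l =
    w^(i-1).\<close>
  define u where "u = (p1 + w^2 * p2 + w * p3) / 3"
  define v where "v = (p1 + w * p2 + w^2 * p3) / 3"
  have w3: "w^3 = 1" using w(1) by algebra
  have p: "p1 = a + u + v" "p2 = a + w * u + w^2 * v" "p3 = a + w^2 * u + w * v"
  proof -
    have "a + u + v = (3 * p1 + (1 + w + w^2) * (p2 + p3)) / 3"
      by (simp add: a_def u_def v_def field_simps)
    then show "p1 = a + u + v" by (simp add: w(1))
    have "a + w * u + w^2 * v = ((1 + w + w^2) * p1 + (1 + 2 * w^3) * p2 + (1 + w^2 + w^3 * w) * p3) / 3"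
      by (simp add: a_def u_def v_def field_simps power2_eq_square power3_eq_cube)
    moreover have "1 + w^2 + w = 0" using w(1) by (simp add: ac_simps)
    ultimately show "p2 = a + w * u + w^2 * v" by (simp add: w(1) w3)
    have "a + w^2 * u + w * v = ((1 + w + w^2) * p1 + (1 + w^2 + w^3 * w) * p2 + (1 + 2 * w^3) * p3) / 3"
      by (simp add: a_def u_def v_def field_simps power2_eq_square power3_eq_cube)
    with \<open>1 + w^2 + w = 0\<close> show "p3 = a + w^2 * u + w * v" by (simp add: w(1) w3)
  qed
  \<comment> \<open>It follows that r = -uv and s = -(u^3 + v^3)/2, so s^2 + r^3 is the square of
    (u^3 - v^3)/2.\<close>
  have c: "c = a^2 - u * v"
  proof -
    have "p1 * p2 + p2 * p3 + p3 * p1 = 3 * (a^2 - u * v)"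
      unfolding p using w(1) by algebra
    then show ?thesis by (simp add: c_def)
  qed
  then have r: "r = - (u * v)" by (simp add: r_def)
  have s: "2 * s = - (u^3 + v^3)"
  proof -
    have P: "p1 * p2 * p3 = a^3 - 3 * a * (u * v) + u^3 + v^3"
      unfolding p using w(1) by algebra
    have "2 * s = 3 * a * c - (a^3 - 3 * a * (u * v) + u^3 + v^3) - 2 * a^3"
      unfolding s_def P[symmetric] by (simp add: field_simps)
    also have "\<dots> = - (u^3 + v^3)"
      unfolding c by (simp add: algebra_simps power2_eq_square power3_eq_cube)
    finally show ?thesis .
  qed
  have "cnj u = v"
  proof -
    have "(w^2)^2 = w" using w3 by (simp add: eval_nat_numeral)
    then show ?thesis using real by (simp add: u_def v_def w(2) Reals_cnj_iff)
  qed
  \<comment> \<open>Hence u^3 is one of the two values -s + \<Delta> and -s - \<Delta>;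
    \<open>e\<close> is the sign that makes every admissible z a cube root of u^3 rather than of
    v^3.\<close>
  have "(u^3 + s)^2 = \<Delta>^2"
    unfolding D(1) r using s by algebra
  then obtain e where e: "e \<in> {1, -1::complex}" "u^3 + s = e * \<Delta>"
  proof -
    assume e: "\<And>e. e \<in> {1, -1} \<Longrightarrow> u^3 + s = e * \<Delta> \<Longrightarrow> thesis"
    from \<open>(u^3 + s)^2 = \<Delta>^2\<close> have "u^3 + s = \<Delta> \<or> u^3 + s = - \<Delta>" by (simp add: power2_eq_iff)
    then show thesis using e[of 1] e[of "-1"] by auto
  qed
  have ed: "u^3 - v^3 = 2 * (e * \<Delta>)" using s e(2) by algebra
  \<comment> \<open>Being conjugate, \<open>u\<close> and \<open>v\<close> vanish together, and then
    so would \<Delta>.\<close>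
  have u0: "u \<noteq> 0"
  proof
    assume "u = 0"
    then have "u^3 - v^3 = 0" using \<open>cnj u = v\<close> by auto
    then show False using ed D(2) e(1) by auto
  qed
  show thesis
  proof (rule that[of e u])
    show "e \<in> {1, -1}" by fact
    show "u \<noteq> 0" by fact
    show u3: "u^3 = - s + e * \<Delta>" using e(2) by (simp add: algebra_simps)
    fix z assume "z^3 = - s + e * \<Delta>"
    then have z3: "z^3 = u^3" using u3 by simp
    then have z0: "z \<noteq> 0" using u0 by auto
    have "cmod z ^ 3 = cmod u ^ 3" using z3 by (metis norm_power)
    then have zu: "cmod z = cmod u" by (simp add: power_eq_iff_eq_base)
    \<comment> \<open>One identity covers the three weights: relative to the root with parameter l,
      the other two have parameters l w and l w^2. The numerator collapses to l u (u^3 -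
      v^3).\<close>
    have num: "- (a * z^3 + 2 * r * a^2 + r^2) + (z^3 + r * a) * (a + l * u + l^2 * v) + r * ((a + l * (w * u) + l^2 * (w^2 * v)) * (a + l * (w^2 * u) + l^2 * (w * v)))
        = l * u * (2 * (e * \<Delta>))" if "l^3 = 1" for l
      unfolding z3 ed[symmetric] r using that w(1) by algebra
    have fin: "l * u * (2 * (e * \<Delta>)) / (2 * z * \<Delta>) = e * u / z * l" for l
      using D(2) z0 by (simp add: field_simps)
    have w33: "(w^2)^3 = 1" using w3 by (metis power_mult mult.commute power_one)
    let ?c = "- (a * z^3 + 2 * r * a^2 + r^2)"
    have n: "?c + (z^3 + r * a) * p1 + r * (p2 * p3) = 1 * u * (2 * (e * \<Delta>))"
      "?c + (z^3 + r * a) * p2 + r * (p1 * p3) = w * u * (2 * (e * \<Delta>))"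
      "?c + (z^3 + r * a) * p3 + r * (p1 * p2) = w^2 * u * (2 * (e * \<Delta>))"
    proof -
      have ww: "w * (w * x) = w^2 * x" "w^2 * (w * x) = x" "w * (w^2 * x) = x" "w^2 * (w^2 * x) = w * x"
        "(w^2)^2 = w" for x
        using w3 by (simp_all add: power2_eq_square power3_eq_cube mult.assoc[symmetric])
      show "?c + (z^3 + r * a) * p1 + r * (p2 * p3) = 1 * u * (2 * (e * \<Delta>))"
        using num[of 1] by (simp add: p)
      show "?c + (z^3 + r * a) * p2 + r * (p1 * p3) = w * u * (2 * (e * \<Delta>))"
        unfolding num[OF w3, symmetric] ww p by (simp add: ac_simps)
      show "?c + (z^3 + r * a) * p3 + r * (p1 * p2) = w^2 * u * (2 * (e * \<Delta>))"
        unfolding num[OF w33, symmetric] ww p by (simp add: ac_simps)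
    qed
    show "z \<noteq> 0 \<and> cmod z = cmod u \<and>
       (- (a * z^3 + 2 * r * a^2 + r^2) + (z^3 + r * a) * p1 + r * (p2 * p3)) / (2 * z * \<Delta>) = e * u / z \<and>
       (- (a * z^3 + 2 * r * a^2 + r^2) + (z^3 + r * a) * p2 + r * (p1 * p3)) / (2 * z * \<Delta>) = e * u / z * w \<and>
       (- (a * z^3 + 2 * r * a^2 + r^2) + (z^3 + r * a) * p3 + r * (p1 * p2)) / (2 * z * \<Delta>) = e * u / z * w^2"
      using z0 zu by (simp only: n fin mult_1_right simp_thms)
  qed
qed

subsection \<open>Recovering the Weyl tensor\<close>

lemma hodge_scale: "hodge g (\<lambda>\<alpha> \<beta> \<mu> \<nu>. a * Z \<alpha> \<beta> \<mu> \<nu>) \<alpha> \<beta> \<mu> \<nu> = a * hodge g Z \<alpha> \<beta> \<mu> \<nu>"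
  for a :: complex
  by (simp add: hodge_dot2 dot2_scale_right)

text \<open>The norm 4 of the \<open>y k\<close> cancels the 1/4 of the projection, so
  \<open>S\<close> is its own self-dual part, and S = (S - \<i> *S)/2 is solved for the
  dual.\<close>

lemma (in triple) hodge_diagonal_form:
  assumes S: "\<And>\<alpha> \<beta> \<mu> \<nu>. S \<alpha> \<beta> \<mu> \<nu> = (\<Sum>k\<in>UNIV. e k * y k $ \<alpha> $ \<beta> * y k $ \<mu> $ \<nu>)"
  shows "hodge g S \<alpha> \<beta> \<mu> \<nu> = \<i> * S \<alpha> \<beta> \<mu> \<nu>"
proof -
  have "S \<beta> \<alpha> \<mu> \<nu> = - S \<alpha> \<beta> \<mu> \<nu>" for \<alpha> \<beta> \<mu> \<nu>
    unfolding S y_antisym_nth[of _ \<beta> \<alpha>] by (simp add: sum_negf)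
  then have "self_dual g S \<alpha> \<beta> \<mu> \<nu> =
      (1/4) * (\<Sum>k\<in>UNIV. y k $ \<alpha> $ \<beta> * dot2 g (\<lambda>\<rho> \<sigma>. y k $ \<rho> $ \<sigma>) (\<lambda>\<rho> \<sigma>. S \<rho> \<sigma> \<mu> \<nu>))"
    by (rule self_dual_triple[OF lor tri])
  moreover have "dot2 g (\<lambda>\<rho> \<sigma>. y k $ \<rho> $ \<sigma>) (\<lambda>\<rho> \<sigma>. S \<rho> \<sigma> \<mu> \<nu>) = 4 * (e k * y k $ \<mu> $ \<nu>)" for k
  proof -
    have "(\<lambda>\<rho> \<sigma>. S \<rho> \<sigma> \<mu> \<nu>) = (\<lambda>\<rho> \<sigma>. \<Sum>l\<in>UNIV. (e l * y l $ \<mu> $ \<nu>) * y l $ \<rho> $ \<sigma>)"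
      by (intro ext) (simp add: S ac_simps)
    then have "dot2 g (\<lambda>\<rho> \<sigma>. y k $ \<rho> $ \<sigma>) (\<lambda>\<rho> \<sigma>. S \<rho> \<sigma> \<mu> \<nu>) =
        (\<Sum>l\<in>UNIV. (e l * y l $ \<mu> $ \<nu>) * (if k = l then 4 else 0))"
      by (simp only: dot2_sum_right dot2_scale_right dot2_y_y)
    also have "\<dots> = (\<Sum>l\<in>UNIV. if k = l then 4 * (e l * y l $ \<mu> $ \<nu>) else 0)"
      by (intro sum.cong refl) simp
    finally show ?thesis by simp
  qed
  ultimately have "self_dual g S \<alpha> \<beta> \<mu> \<nu> = S \<alpha> \<beta> \<mu> \<nu>"
    by (simp add: S sum_distrib_left ac_simps)
  then have "S \<alpha> \<beta> \<mu> \<nu> = - (\<i> * hodge g S \<alpha> \<beta> \<mu> \<nu>)"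
    by (simp add: self_dual_def field_simps eq_neg_iff_add_eq_0)
  then have "\<i> * S \<alpha> \<beta> \<mu> \<nu> = - (\<i> * \<i>) * hodge g S \<alpha> \<beta> \<mu> \<nu>"
    by (simp only: mult_minus_right mult.assoc mult_minus_left)
  then show ?thesis by simp
qed

lemma diagonal_self_dual_weyl:
  assumes g: "lorentzian g" and W: "weyl_tensor g W"
    and tr2: "trace4 g (comp4 g (bel_robinson g W) (bel_robinson g W)) = 0"
    and tr3: "9 * complex_of_real t ^ 3 = trace4 g (comp4 g (comp4 g (bel_robinson g W) (bel_robinson g W)) (bel_robinson g W))"
    and nz: "t \<noteq> 0" and w: "1 + w + w^2 = 0"
  obtains d and z :: "3 \<Rightarrow> complex^4^4" and c where "quaternionic_triple g d z" "t > 0" "c * cnj c = of_real t"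
    "\<And>\<alpha> \<beta> \<mu> \<nu>. self_dual g (complexify4 W) \<alpha> \<beta> \<mu> \<nu> =
       (1/2) * (c * z 1 $ \<alpha> $ \<beta> * z 1 $ \<mu> $ \<nu> + c * w * z 2 $ \<alpha> $ \<beta> * z 2 $ \<mu> $ \<nu>
          + c * w^2 * z 3 $ \<alpha> $ \<beta> * z 3 $ \<mu> $ \<nu>)"
proof -
  obtain x where x: "quaternionic_triple g 1 x"
    using quaternionic_triple_exists[OF g] .
  interpret X: triple g 1 x by unfold_locales (fact g, fact x)
  obtain Q where Qs: "\<And>k l. Q k l = Q l k" and Qt: "(\<Sum>k\<in>UNIV. Q k k) = 0"
    and S: "\<And>\<alpha> \<beta> \<mu> \<nu>. self_dual g (complexify4 W) \<alpha> \<beta> \<mu> \<nu> =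
       (1/2) * (\<Sum>k\<in>UNIV. \<Sum>l\<in>UNIV. Q k l * x k $ \<alpha> $ \<beta> * x l $ \<mu> $ \<nu>)"
    using X.weyl_self_dual_form[OF W] by blast
  define q where "q = (\<Sum>i\<in>UNIV. \<Sum>k\<in>UNIV. \<Sum>l\<in>UNIV. Q i k * Q k l * Q l i)"
  note traces = X.bel_robinson_traces[OF X.bel_robinson_triple[OF S]]
  have Q2: "(\<Sum>i\<in>UNIV. \<Sum>k\<in>UNIV. Q i k * Q k i) = 0"
    using tr2 unfolding traces(1) by (simp only: mult_eq_0_iff complex_cnj_zero_iff disj_absorb)
  have q: "q * cnj q = 9 * complex_of_real t ^ 3"
    using tr3 unfolding traces(2) q_def by simp
  \<comment> \<open>Eigenvalues c, c w, c w^2 have cubes with sum 3 c^3, and this sum is the third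
    trace \<open>q\<close>.\<close>
  obtain c where c: "c ^ 3 = q / 3"
  proof
    show "(if q = 0 then 0 else exp (Ln (q / 3) / 3)) ^ 3 = q / 3"
    proof (cases "q = 0")
      case False
      then show ?thesis using exp_of_nat_mult[of 3 "Ln (q / 3) / 3", symmetric] by simp
    qed simp
  qed
  have "(c * cnj c) ^ 3 = complex_of_real t ^ 3"
  proof -
    have "(c * cnj c) ^ 3 = q * cnj q / 9"
      by (simp add: power_mult_distrib c flip: complex_cnj_power)
    then show ?thesis by (simp add: q)
  qed
  then have "complex_of_real ((cmod c)^2) ^ 3 = complex_of_real t ^ 3"
    by (simp only: complex_norm_square)
  then have ct3: "((cmod c)^2) ^ 3 = t ^ 3"
    by (simp only: of_real_power[symmetric] of_real_eq_iff)
  \<comment> \<open>The real cube root is injective on the whole line; positivity of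
    \<open>t\<close> comes out afterwards.\<close>
  have ct: "(cmod c)^2 = t"
  proof -
    have o: "odd (3 :: nat)" by simp
    show ?thesis using arg_cong[OF ct3, of "root 3"] unfolding odd_real_root_power_cancel[OF o] .
  qed
  then have cc: "c * cnj c = of_real t" by (simp only: complex_norm_square[symmetric])
  have c0: "c \<noteq> 0" using ct nz by auto
  have t: "t > 0" using ct c0 by auto
  have Q3: "(\<Sum>i\<in>UNIV. \<Sum>k\<in>UNIV. \<Sum>l\<in>UNIV. Q i k * Q k l * Q l i) = 3 * c ^ 3"
    unfolding q_def[symmetric] by (simp add: c)
  obtain u :: "3 \<Rightarrow> 3 \<Rightarrow> complex" where u: "\<And>a b. (\<Sum>i\<in>UNIV. u i a * u i b) = (if a = b then 1 else 0)"
    and Qu: "\<And>a b. Q a b = c * u 1 a * u 1 b + c * w * u 2 a * u 2 b + c * w^2 * u 3 a * u 3 b"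
    by (rule eigendecomposition[OF Qs Qt Q2 Q3 c0 w]) (rule that)
  define z where "z i = (\<Sum>a\<in>UNIV. cscale (u i a) (x a))" for i
  obtain d where d: "quaternionic_triple g d z"
    using X.rotated_triple[OF u] unfolding z_def[abs_def] .
  have "self_dual g (complexify4 W) \<alpha> \<beta> \<mu> \<nu> =
       (1/2) * (c * z 1 $ \<alpha> $ \<beta> * z 1 $ \<mu> $ \<nu> + c * w * z 2 $ \<alpha> $ \<beta> * z 2 $ \<mu> $ \<nu>
          + c * w^2 * z 3 $ \<alpha> $ \<beta> * z 3 $ \<mu> $ \<nu>)" for \<alpha> \<beta> \<mu> \<nu>
  proof -
    define \<xi> \<zeta> where "\<xi> k = x k $ \<alpha> $ \<beta>" and "\<zeta> k = x k $ \<mu> $ \<nu>" for k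
    have z1: "z i $ \<alpha> $ \<beta> = (\<Sum>a\<in>UNIV. u i a * \<xi> a)" "z i $ \<mu> $ \<nu> = (\<Sum>a\<in>UNIV. u i a * \<zeta> a)" for i
      by (simp_all add: z_def \<xi>_def \<zeta>_def)
    have "(\<Sum>k\<in>UNIV. \<Sum>l\<in>UNIV. Q k l * \<xi> k * \<zeta> l) =
       c * ((\<Sum>k\<in>UNIV. u 1 k * \<xi> k) * (\<Sum>l\<in>UNIV. u 1 l * \<zeta> l))
       + c * w * ((\<Sum>k\<in>UNIV. u 2 k * \<xi> k) * (\<Sum>l\<in>UNIV. u 2 l * \<zeta> l))
       + c * w^2 * ((\<Sum>k\<in>UNIV. u 3 k * \<xi> k) * (\<Sum>l\<in>UNIV. u 3 l * \<zeta> l))"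
      unfolding Qu sum_product
      unfolding sum_distrib_left sum.distrib[symmetric]
      by (intro sum.cong refl) (simp add: algebra_simps)
    then show ?thesis unfolding S z1 \<xi>_def[symmetric] \<zeta>_def[symmetric] by (simp only: mult.assoc)
  qed
  with d t cc show thesis by (rule that)
qed

text \<open>With the sign fixed, passing to another cube root \<open>w\<close> multiplies
  \<open>H\<close> by a cube root of unity, which the angle absorbs; so one sign serves all three
  roots.\<close>

theorem theorem5:
  fixes g :: "real^4^4" and W :: "real tensor4" and X :: "real tensor2" and t :: real
    and T A :: "complex tensor4" and Xc :: "complex tensor2" and r s \<Delta> :: complex
  assumes metric: "lorentzian g"
    and weyl: "weyl_tensor g W"
    and T: "T = bel_robinson g W"
    and tr2: "trace4 g (comp4 g T T) = 0"
    and tr3: "9 * complex_of_real t ^ 3 = trace4 g (comp4 g (comp4 g T T) T)"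
    and tr3_nz: "trace4 g (comp4 g (comp4 g T T) T) \<noteq> 0"
    and A: "A = tensor_A g t T"
    and X_sym: "\<forall>\<alpha> \<beta>. X \<alpha> \<beta> = X \<beta> \<alpha>"
    and Xc: "Xc = complexify2 X"
    and r: "r = scalar_r g A Xc"
    and s: "s = scalar_s g A Xc"
    and Delta: "\<Delta>^2 = s^2 + r^3"
    and Delta_nz: "\<Delta> \<noteq> 0"
  shows "\<exists>\<epsilon>\<in>{1, -1}. \<forall>w. w^3 = - s + \<epsilon> * \<Delta> \<longrightarrow> w \<noteq> 0 \<and>
           (let J = tensor_J (tensor_H g A Xc \<Delta> w);
                W\<^sub>0 = real_form g (\<lambda>\<alpha> \<beta> \<mu> \<nu>. complex_of_real (sqrt t) * J \<alpha> \<beta> \<mu> \<nu>)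
            in \<exists>\<theta>::real. \<forall>\<alpha> \<beta> \<mu> \<nu>.
                 W \<alpha> \<beta> \<mu> \<nu> = cos \<theta> * W\<^sub>0 \<alpha> \<beta> \<mu> \<nu> + sin \<theta> * hodge g W\<^sub>0 \<alpha> \<beta> \<mu> \<nu>)"
proof -
  define \<omega> where "\<omega> = Complex (-1/2) (sqrt 3 / 2)"
  have \<omega>: "1 + \<omega> + \<omega>^2 = 0" "cnj \<omega> = \<omega>^2"
    by (simp_all add: \<omega>_def complex_eq_iff power2_eq_square)
  have t0: "t \<noteq> 0" using tr3 tr3_nz by auto
  obtain d and z :: "3 \<Rightarrow> complex^4^4" and c where z: "quaternionic_triple g d z" and t: "t > 0" and c: "c * cnj c = of_real t"
    and S: "\<And>\<alpha> \<beta> \<mu> \<nu>. self_dual g (complexify4 W) \<alpha> \<beta> \<mu> \<nu> =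
       (1/2) * (c * z 1 $ \<alpha> $ \<beta> * z 1 $ \<mu> $ \<nu> + c * \<omega> * z 2 $ \<alpha> $ \<beta> * z 2 $ \<mu> $ \<nu>
          + c * \<omega>^2 * z 3 $ \<alpha> $ \<beta> * z 3 $ \<mu> $ \<nu>)"
    by (rule diagonal_self_dual_weyl[OF metric weyl tr2[unfolded T] tr3[unfolded T] t0 \<omega>(1)]) (rule that)
  have c0: "c \<noteq> 0" using c t0 by auto
  interpret Z: triple g d z by unfold_locales (fact metric, fact z)
  define ev where "ev i = (if i = (1::3) then c else if i = 2 then c * \<omega> else c * \<omega>^2)" for i
  have ev: "ev 1 = c" "ev 2 = c * \<omega>" "ev 3 = c * \<omega>^2" by (simp_all add: ev_def)
  define F where "F = self_dual g (complexify4 W)"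
  have F: "F \<alpha> \<beta> \<mu> \<nu> = (\<Sum>k\<in>UNIV. (ev k / 2) * z k $ \<alpha> $ \<beta> * z k $ \<mu> $ \<nu>)" for \<alpha> \<beta> \<mu> \<nu>
    unfolding F_def S by (simp add: sum_3 ev field_simps)
  have "F \<alpha> \<beta> \<mu> \<nu> = (1/2) * (\<Sum>k\<in>UNIV. \<Sum>l\<in>UNIV. (if k = l then ev k else 0) * z k $ \<alpha> $ \<beta> * z l $ \<mu> $ \<nu>)" for \<alpha> \<beta> \<mu> \<nu>
  proof -
    have "(if k = l then ev k else 0) * z k $ \<alpha> $ \<beta> * z l $ \<mu> $ \<nu> = (if k = l then ev k * z k $ \<alpha> $ \<beta> * z k $ \<mu> $ \<nu> else 0)" for k l
      by simp
    then show ?thesis unfolding F by (simp add: sum_distrib_left ac_simps)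
  qed
  then have T_diag: "T = tensor_sum Z.h2 (kron (\<lambda>i j. if i = j then ev i else 0) (\<lambda>k l. cnj (if k = l then ev k else 0)))"
    unfolding T F_def by (rule Z.bel_robinson_triple)
  interpret C: concomitants g "Z.h2 (1, 1)" "Z.h2 (2, 2)" "Z.h2 (3, 3)" Xc
    by unfold_locales (rule Z.h2_dot1)+
  have A_C: "A = C.A"
    unfolding A Z.tensor_A_triple[OF T_diag ev c t0 \<omega>] by (intro ext) (simp add: C.A_def)
  \<comment> \<open>Reality of \<open>X\<close> enters here: it makes the x_i real and so the two
    resolvents conjugate.\<close>
  have "cnj (dot2 g (Z.h2 (i, i)) Xc) = dot2 g (Z.h2 (i, i)) Xc" for i
    unfolding cnj_dot2 Z.h2_real by (simp add: Xc complexify2_def)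
  then have real: "C.x1^2 \<in> \<real>" "C.x2^2 \<in> \<real>" "C.x3^2 \<in> \<real>"
    by (simp_all add: C.x1_def C.x2_def C.x3_def Reals_cnj_iff)
  define a where "a = scalar_\<alpha> g A Xc"
  have a: "a = (C.x1^2 + C.x2^2 + C.x3^2) / 3"
    unfolding a_def A_C by (rule C.alpha_eq)
  have r_eq: "r = (C.x1^2 * C.x2^2 + C.x2^2 * C.x3^2 + C.x3^2 * C.x1^2) / 3 - a^2"
    unfolding r scalar_r_def a_def A_C C.gamma_eq ..
  have s_eq: "s = (1/2) * (3 * a * ((C.x1^2 * C.x2^2 + C.x2^2 * C.x3^2 + C.x3^2 * C.x1^2) / 3)
      - C.x1^2 * C.x2^2 * C.x3^2) - a^3"
    unfolding s scalar_s_def a_def A_C C.gamma_eq C.beta_eq by (simp add: power_mult_distrib)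
  obtain e :: complex and u where e: "e \<in> {1, -1}" and u0: "u \<noteq> 0" and "u^3 = - s + e * \<Delta>"
    and wt: "\<And>w. w^3 = - s + e * \<Delta> \<Longrightarrow> w \<noteq> 0 \<and> cmod w = cmod u \<and>
       (- (a * w^3 + 2 * r * a^2 + r^2) + (w^3 + r * a) * C.x1^2 + r * (C.x2^2 * C.x3^2)) / (2 * w * \<Delta>) = e * u / w \<and>
       (- (a * w^3 + 2 * r * a^2 + r^2) + (w^3 + r * a) * C.x2^2 + r * (C.x1^2 * C.x3^2)) / (2 * w * \<Delta>) = e * u / w * \<omega> \<and>
       (- (a * w^3 + 2 * r * a^2 + r^2) + (w^3 + r * a) * C.x3^2 + r * (C.x1^2 * C.x2^2)) / (2 * w * \<Delta>) = e * u / w * \<omega>^2"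
    by (rule cardano_weights[OF real \<omega> a r_eq s_eq Delta Delta_nz]) (rule that)
  show ?thesis
  proof (rule bexI[OF _ e], intro allI impI)
    fix w assume "w^3 = - s + e * \<Delta>"
    note wt = wt[OF this]
    note k = wt[THEN conjunct2, THEN conjunct2]
    define H where "H = tensor_H g A Xc \<Delta> w"
    \<comment> \<open>Dividing the eigenvalue by \<open>c\<close> leaves 1, \<omega>, \<omega>^2;
      the prefactor is common to all labels.\<close>
    define h where "h i = e * u / w * (ev i / c)" for i
    have H: "H \<alpha> \<beta> \<mu> \<nu> = (\<Sum>i\<in>UNIV. h i * Z.h2 (i, i) \<alpha> \<beta> * Z.h2 (i, i) \<mu> \<nu>)" for \<alpha> \<beta> \<mu> \<nu>
      unfolding H_def C.H_eq[of \<Delta> w \<alpha> \<beta> \<mu> \<nu>, folded A_C, folded r a_def] k[THEN conjunct1]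
        k[THEN conjunct2, THEN conjunct1] k[THEN conjunct2, THEN conjunct2] sum_3 h_def ev
      using c0 by simp
    have "(\<Sum>i\<in>UNIV. h i) = e * u / w * (1 + \<omega> + \<omega>^2)"
      using c0 by (simp add: sum_3 h_def ev algebra_simps)
    then have h0: "(\<Sum>i\<in>UNIV. h i) = 0" by (simp only: \<omega> mult_zero_right)
    \<comment> \<open>The ratio between the self-dual part recovered from \<open>T\<close> and the
      given one. Its modulus is one since \<open>c\<close> has modulus \<open>sqrt t\<close>,
      \<open>u\<close> and \<open>w\<close> have equal modulus, and \<open>e\<close> is a
      sign.\<close>
    define m where "m = of_real (sqrt t) * (e * u / w) / c"
    have sd: "self_dual g (\<lambda>\<alpha> \<beta> \<mu> \<nu>. complex_of_real (sqrt t) * tensor_J H \<alpha> \<beta> \<mu> \<nu>) \<alpha> \<beta> \<mu> \<nu> = m * F \<alpha> \<beta> \<mu> \<nu>"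
      for \<alpha> \<beta> \<mu> \<nu>
      unfolding Z.self_dual_tensor_J[OF H h0] F
      by (simp add: m_def h_def sum_distrib_left ac_simps)
    define W0 where "W0 = real_form g (\<lambda>\<alpha> \<beta> \<mu> \<nu>. complex_of_real (sqrt t) * tensor_J H \<alpha> \<beta> \<mu> \<nu>)"
    have W0: "W0 = (\<lambda>\<alpha> \<beta> \<mu> \<nu>. Re (2 * m * F \<alpha> \<beta> \<mu> \<nu>))"
      unfolding W0_def real_form_def[abs_def] sd by (simp add: mult.assoc)
    \<comment> \<open>On the self-dual part the dual is multiplication by \<i>, so a combination
      with cosine and sine multiplies it by \<open>cis\<close>. The angle must therefore undo the
      argument of \<open>m\<close>.\<close>
    have dual: "hodge g W0 \<alpha> \<beta> \<mu> \<nu> = Re (2 * m * (\<i> * F \<alpha> \<beta> \<mu> \<nu>))" for \<alpha> \<beta> \<mu> \<nu>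
      unfolding W0 hodge_Re[symmetric] hodge_scale Z.hodge_diagonal_form[OF F] ..
    have W: "W \<alpha> \<beta> \<mu> \<nu> = Re (2 * F \<alpha> \<beta> \<mu> \<nu>)" for \<alpha> \<beta> \<mu> \<nu>
      using fun_cong[OF fun_cong[OF fun_cong[OF fun_cong[OF real_form_complexify4[of g W]]]], of \<alpha> \<beta> \<mu> \<nu>]
      by (simp add: real_form_def F_def)
    have "cmod m = 1"
    proof -
      have "(cmod c)^2 = t" using c unfolding complex_norm_square[symmetric] by (simp only: of_real_eq_iff)
      then have "cmod c = sqrt t" by (metis norm_ge_zero real_sqrt_unique)
      moreover have "cmod e = 1" using e by auto
      ultimately show ?thesis using wt u0 t by (auto simp: m_def norm_mult norm_divide)
    qed
    then have m: "cis (- Arg m) * m = 1"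
      using rcis_cmod_Arg[of m] by (metis cis_mult cis_zero add.left_inverse rcis_def mult_1 of_real_1)
    have "W \<alpha> \<beta> \<mu> \<nu> = cos (- Arg m) * W0 \<alpha> \<beta> \<mu> \<nu> + sin (- Arg m) * hodge g W0 \<alpha> \<beta> \<mu> \<nu>" for \<alpha> \<beta> \<mu> \<nu>
    proof -
      have Re_mult: "Re (complex_of_real p * q) = p * Re q" for p q by simp
      have "W \<alpha> \<beta> \<mu> \<nu> = Re (2 * (cis (- Arg m) * m) * F \<alpha> \<beta> \<mu> \<nu>)" unfolding m W by simp
      also have "2 * (cis (- Arg m) * m) * F \<alpha> \<beta> \<mu> \<nu> =
          of_real (cos (- Arg m)) * (2 * m * F \<alpha> \<beta> \<mu> \<nu>) + of_real (sin (- Arg m)) * (2 * m * (\<i> * F \<alpha> \<beta> \<mu> \<nu>))"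
        unfolding cis_conv_exp exp_Euler cos_of_real sin_of_real by (simp add: algebra_simps)
      also have "Re \<dots> = cos (- Arg m) * W0 \<alpha> \<beta> \<mu> \<nu> + sin (- Arg m) * hodge g W0 \<alpha> \<beta> \<mu> \<nu>"
        unfolding dual unfolding W0 by (simp only: plus_complex.sel Re_mult)
      finally show ?thesis .
    qed
    then show "w \<noteq> 0 \<and>
           (let J = tensor_J (tensor_H g A Xc \<Delta> w);
                W\<^sub>0 = real_form g (\<lambda>\<alpha> \<beta> \<mu> \<nu>. complex_of_real (sqrt t) * J \<alpha> \<beta> \<mu> \<nu>)
            in \<exists>\<theta>::real. \<forall>\<alpha> \<beta> \<mu> \<nu>.
                 W \<alpha> \<beta> \<mu> \<nu> = cos \<theta> * W\<^sub>0 \<alpha> \<beta> \<mu> \<nu> + sin \<theta> * hodge g W\<^sub>0 \<alpha> \<beta> \<mu> \<nu>)"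
      unfolding Let_def H_def[symmetric] W0_def[symmetric] using wt by blast
  qed
qed

end
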